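(* Let $P(t)=(p_{\mathbf{ij}}(t);\mathbf i,\mathbf j\in\mathbf Z_+^n)$ be a transition function and put $F_{\mathbf i}(t,\mathbf s)=\sum_{\mathbf j\in\mathbf Z_+^n}p_{\mathbf{ij}}(t)\mathbf s^{\mathbf j}$ for $\mathbf i\in\mathbf Z_+^n$, $\mathbf s\in[-1,1]^n$. The following statements are equivalent. (i) $P(t)$ is the Feller minimal $Q$-function, where $Q$ is of the form $$q_{\mathbf{ij}}=\sum_{k=1}^n i_k b^{(k)}_{\mathbf j-\mathbf i+\mathbf e_k}\chi(\mathbf j-\mathbf i+\mathbf e_k)+a_{\mathbf j-\mathbf i}\chi(\mathbf j-\mathbf i)\qquad(\mathbf i,\mathbf j\in\mathbf Z_+^n)$$ with $a_{\mathbf j}\ge0$ $(\mathbf j\ne\mathbf 0)$, $0<\sum_{\mathbf j\ne\mathbf 0}a_{\mathbf j}\le-a_{\mathbf 0}<\infty$, and, for $k=1,\dots,n$, $b^{(k)}_{\mathbf j}\ge0$ $(\mathbf j\ne\mathbf e_k)$, $0<\sum_{\mathbf j\ne\mathbf e_k}b^{(k)}_{\mathbf j}\le-b^{(k)}_{\mathbf e_k}<\infty$. (ii) There is an $n$-type ordinary branching $q$-matrix $\tilde Q$ (not necessarily conservative), with Feller minimal $\tilde Q$-function $(\tilde p_{\mathbf{ij}}(t))$, such that for all $\mathbf i\in\mathbf Z_+^n$, $t\ge0$, $\mathbf s\in[-1,1]^n$, $$F_{\mathbf i}(t,\mathbf s)=F_{\mathbf 0}(t,\mathbf s)\cdot\prod_{k=1}^n\Big(\sum_{\mathbf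 j\in\mathbf Z_+^n}\tilde p_{\mathbf e_k\mathbf j}(t)\mathbf s^{\mathbf j}\Big)^{i_k}.$$ (iii) For all $\mathbf i\in\mathbf Z_+^n$, $t\ge0$, $\mathbf s\in[-1,1]^n$, $$F_{\mathbf i}(t,\mathbf s)=F_{\mathbf 0}(t,\mathbf s)\cdot\prod_{k=1}^n\big(F_{\mathbf e_k}(t,\mathbf s)/F_{\mathbf 0}(t,\mathbf s)\big)^{i_k}.$$ In particular, $p_{\mathbf{i0}}(t)=p_{\mathbf{00}}(t)\prod_{k=1}^n(p_{\mathbf e_k\mathbf 0}(t)/p_{\mathbf{00}}(t))^{i_k}$ for $|\mathbf i|\ge1$.
   Context: $n\ge1$ is fixed; $\mathbf 0$ is the zero vector and $\mathbf e_k$ the $k$-th unit vector in $\mathbf Z_+^n$; $|\mathbf i|=\sum_k i_k$; $\mathbf s^{\mathbf j}=s_1^{j_1}\cdots s_n^{j_n}$; $\chi$ is the indicator function of $\mathbf Z_+^n$. A transition function is a standard (continuous at $t=0$), possibly dishonest, continuous-time transition function on $\mathbf Z_+^n$. An $n$-type ordinary branching $q$-matrix (not necessarily conservative) is a matrix $\tilde Q=(\tilde q_{\mathbf{ij}})$ with $\tilde q_{\mathbf{0j}}=0$ and $\tilde q_{\mathbf{ij}}=\sum_{k=1}^n i_kb^{(k)}_{\mathbf j-\mathbf i+\mathbf e_k}\chi(\mathbf j-\mathbf i+\mathbf e_k)$ for $|\mathbf i|>0$, where $b^{(k)}_{\mathbf j}\ge0$ $(\mathbf j\ne\mathbf e_k)$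 and $0<\sum_{\mathbf j\ne\mathbf e_k}b^{(k)}_{\mathbf j}\le-b^{(k)}_{\mathbf e_k}<\infty$ for $k=1,\dots,n$.
   Formalization: (ii)⇒(i) assumes p_0j(t)≠0 for some t≥0, j≠0; (iii)⇒(ii) assumes that for each k, at some t, row e_k of P(t) is not a multiple of row 0 shifted by e_k. Without these it fails: no immigration gives (ii) not (i); P(t)=Id gives (iii) not (ii). In (iii), x/0=0. *)

theory Defs
  imports "HOL-Analysis.Analysis"
begin

section \<open>Continuous-time transition functions\<close>

text \<open>Only the values at times \<open>t \<ge> 0\<close> are constrained.  Row sums may be smaller than 1
  (dishonest case); \<open>standard\<close> means continuous at \<open>t = 0\<close>.\<close>

definition transition_function :: "(real \<Rightarrow> 'a \<Rightarrow> 'a \<Rightarrow> real) \<Rightarrow> bool" where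
  "transition_function P \<longleftrightarrow>
     (\<forall>t\<ge>0. \<forall>i j. 0 \<le> P t i j) \<and>
     (\<forall>t\<ge>0. \<forall>i. (\<lambda>j. P t i j) summable_on UNIV \<and> (\<Sum>\<^sub>\<infinity>j. P t i j) \<le> 1) \<and>
     (\<forall>i j. P 0 i j = (if i = j then 1 else 0)) \<and>
     (\<forall>t\<ge>0. \<forall>u\<ge>0. \<forall>i j. P (t + u) i j = (\<Sum>\<^sub>\<infinity>k. P t i k * P u k j)) \<and>
     (\<forall>i j. ((\<lambda>t. P t i j) \<longlongrightarrow> (if i = j then 1 else 0)) (at_right 0))"

text \<open>A \<open>Q\<close>-function is a transition function with \<open>q\<close>-matrix \<open>Q\<close>, i.e. with (one-sided)
  derivative \<open>Q\<close> at time 0; it need not satisfy the forward equation, nor (when \<open>Q\<close> is not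
  conservative) the backward equation.\<close>

definition Q_function ::
    "('a \<Rightarrow> 'a \<Rightarrow> real) \<Rightarrow> (real \<Rightarrow> 'a \<Rightarrow> 'a \<Rightarrow> real) \<Rightarrow> bool" where
  "Q_function Q P \<longleftrightarrow> transition_function P \<and>
     (\<forall>i j. ((\<lambda>t. P t i j) has_real_derivative Q i j) (at_right 0))"

definition Feller_minimal ::
    "('a \<Rightarrow> 'a \<Rightarrow> real) \<Rightarrow> (real \<Rightarrow> 'a \<Rightarrow> 'a \<Rightarrow> real) \<Rightarrow> bool" where
  "Feller_minimal Q P \<longleftrightarrow> Q_function Q P \<and>
     (\<forall>R. Q_function Q R \<longrightarrow> (\<forall>t\<ge>0. \<forall>i j. P t i j \<le> R t i j))"

section \<open>Generating functions on the lattice of multi-indices\<close>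

abbreviation unit_index :: "'n::finite \<Rightarrow> nat ^ 'n" where
  "unit_index k \<equiv> axis k 1"

definition mono_pow :: "real ^ 'n::finite \<Rightarrow> nat ^ 'n \<Rightarrow> real" where
  "mono_pow s j = (\<Prod>k\<in>UNIV. (s $ k) ^ (j $ k))"

definition gen_fun ::
    "(real \<Rightarrow> nat ^ 'n::finite \<Rightarrow> nat ^ 'n \<Rightarrow> real) \<Rightarrow> nat ^ 'n \<Rightarrow> real \<Rightarrow> real ^ 'n \<Rightarrow> real" where
  "gen_fun P i t s = (\<Sum>\<^sub>\<infinity>j. P t i j * mono_pow s j)"

definition unit_cube :: "(real ^ 'n::finite) set" where
  "unit_cube = {s. \<forall>k. -1 \<le> s $ k \<and> s $ k \<le> 1}"

text \<open>\<open>coeff_diff c j i\<close> is \<open>c\<close> at \<open>j - i\<close> times the indicator of \<open>j - i\<close> being a nonnegative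
  vector; the guard (the componentwise order) makes the truncated subtraction harmless.\<close>

definition coeff_diff :: "(nat ^ 'n::finite \<Rightarrow> real) \<Rightarrow> nat ^ 'n \<Rightarrow> nat ^ 'n \<Rightarrow> real" where
  "coeff_diff c j i = (if i \<le> j then c (j - i) else 0)"

section \<open>Branching and immigration rates\<close>

definition rates_at :: "'a \<Rightarrow> ('a \<Rightarrow> real) \<Rightarrow> bool" where
  "rates_at x c \<longleftrightarrow> (\<forall>j. j \<noteq> x \<longrightarrow> 0 \<le> c j) \<and> c summable_on (- {x}) \<and>
     0 < (\<Sum>\<^sub>\<infinity>j\<in>- {x}. c j) \<and> (\<Sum>\<^sub>\<infinity>j\<in>- {x}. c j) \<le> - c x"

definition branching_rate ::
    "('n::finite \<Rightarrow> nat ^ 'n \<Rightarrow> real) \<Rightarrow> nat ^ 'n \<Rightarrow> nat ^ 'n \<Rightarrow> real" where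
  "branching_rate b i j =
     (\<Sum>k\<in>UNIV. real (i $ k) * coeff_diff (b k) (j + unit_index k) i)"

definition branching_q_matrix :: "(nat ^ 'n::finite \<Rightarrow> nat ^ 'n \<Rightarrow> real) \<Rightarrow> bool" where
  "branching_q_matrix Q \<longleftrightarrow>
     (\<exists>b. (\<forall>k. rates_at (unit_index k) (b k)) \<and>
        (\<forall>j. Q 0 j = 0) \<and>
        (\<forall>i j. (\<Sum>k\<in>UNIV. i $ k) > 0 \<longrightarrow> Q i j = branching_rate b i j))"

definition branching_immigration_q_matrix ::
    "(nat ^ 'n::finite \<Rightarrow> nat ^ 'n \<Rightarrow> real) \<Rightarrow> bool" where
  "branching_immigration_q_matrix Q \<longleftrightarrow>
     (\<exists>a b. rates_at 0 a \<and> (\<forall>k. rates_at (unit_index k) (b k)) \<and>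
        (\<forall>i j. Q i j = branching_rate b i j + coeff_diff a j i))"

section \<open>The three descriptions of a branching process with immigration\<close>

definition minimal_branching_immigration ::
    "(real \<Rightarrow> nat ^ 'n::finite \<Rightarrow> nat ^ 'n \<Rightarrow> real) \<Rightarrow> bool" where
  "minimal_branching_immigration P \<longleftrightarrow>
     (\<exists>Q. branching_immigration_q_matrix Q \<and> Feller_minimal Q P)"

definition factorizes_by_branching ::
    "(real \<Rightarrow> nat ^ 'n::finite \<Rightarrow> nat ^ 'n \<Rightarrow> real) \<Rightarrow> bool" where
  "factorizes_by_branching P \<longleftrightarrow>
     (\<exists>Q' P'. branching_q_matrix Q' \<and> Feller_minimal Q' P' \<and>
        (\<forall>i. \<forall>t\<ge>0. \<forall>s\<in>unit_cube.
           gen_fun P i t s =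
             gen_fun P 0 t s * (\<Prod>k\<in>UNIV. gen_fun P' (unit_index k) t s ^ (i $ k))))"

text \<open>The division is the total one with \<open>x / 0 = 0\<close>.  This adds no solutions: for a transition
  function with this property \<open>gen_fun P 0 t s\<close> is positive for all \<open>t \<ge> 0\<close> and
  \<open>s \<in> unit_cube\<close>.\<close>

definition factorizes_by_quotients ::
    "(real \<Rightarrow> nat ^ 'n::finite \<Rightarrow> nat ^ 'n \<Rightarrow> real) \<Rightarrow> bool" where
  "factorizes_by_quotients P \<longleftrightarrow>
     (\<forall>i. \<forall>t\<ge>0. \<forall>s\<in>unit_cube.
        gen_fun P i t s =
          gen_fun P 0 t s *
            (\<Prod>k\<in>UNIV. (gen_fun P (unit_index k) t s / gen_fun P 0 t s) ^ (i $ k)))"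

section \<open>Nondegeneracy\<close>

text \<open>The rates in \<^const>\<open>branching_immigration_q_matrix\<close> and \<^const>\<open>branching_q_matrix\<close> are
  required not to vanish identically, but the factorization properties also hold for degenerate
  processes.  An ordinary branching process without immigration satisfies
  \<^const>\<open>factorizes_by_branching\<close> but not \<^const>\<open>minimal_branching_immigration\<close>; the constant
  transition function (the identity matrix at all times) satisfies
  \<^const>\<open>factorizes_by_quotients\<close> but neither of the other two.

  The following two conditions exclude exactly this.  The first says that from 0 the process
  reaches some other state, i.e. the off-diagonal immigration rates are not all 0.  The second
  says that an individual of type \<open>k\<close> does something besides possibly killing the whole process:
  the row at \<open>unit_index k\<close> is not, at all times, a constant multiple of the row at 0 shifted by
  \<open>unit_index k\<close>.\<close>

definition immigration_nondegenerate ::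
    "(real \<Rightarrow> nat ^ 'n::finite \<Rightarrow> nat ^ 'n \<Rightarrow> real) \<Rightarrow> bool" where
  "immigration_nondegenerate P \<longleftrightarrow> (\<exists>t\<ge>0. \<exists>j. j \<noteq> 0 \<and> P t 0 j \<noteq> 0)"

definition branching_nondegenerate ::
    "(real \<Rightarrow> nat ^ 'n::finite \<Rightarrow> nat ^ 'n \<Rightarrow> real) \<Rightarrow> bool" where
  "branching_nondegenerate P \<longleftrightarrow>
     (\<forall>k. \<exists>t\<ge>0. \<not> (\<exists>c. \<forall>j. P t (unit_index k) j = c * coeff_diff (P t 0) j (unit_index k)))"

end

theory Submission
  imports Defs "HOL-Computational_Algebra.Primes"
begin

text \<open>
  Write \<open>F i t s\<close> for the generating functions of \<open>P\<close> and \<open>G k = F (unit_index k) / F 0\<close>.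

  The minimal process of a q-matrix is the supremum, over all partitions of the time interval, of products
  of kernels that allow at most one jump; every Q-function dominates these kernels.  If the q-matrix is of
  branching type with immigration, then the kernels are compared with powers of a
  number \<open>r < 1\<close>, so that \<open>F i t s\<close> tends to 0 as \<open>i\<close> tends to infinity, for \<open>s\<close> in \<open>[0, 1/2]\<close>.
  For functions vanishing at infinity the backward equation holds and obeys a maximum principle.
  This yields the factorization of \<open>F\<close>, because both of its sides solve the same equation, and it also
  shows that a Q-function whose generating functions vanish at infinity is the minimal one.

  Conversely, if \<open>F\<close> factorizes into quotients, then \<open>G\<close> is a semigroup of self-maps of the cube and
  \<open>G t\<close> is a small Lipschitz perturbation of the identity for small \<open>t\<close>.  This forces \<open>G h s - s\<close>
  and \<open>1 - F 0 h s\<close> to be of order \<open>h\<close>, so \<open>P\<close> has a finite q-matrix, whose form is obtained by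
  differentiating the factorization.
\<close>

section \<open>Infinite sums against bounded functions\<close>

text \<open>One q-matrix can have many Q-functions, because mass that has escaped to infinity in
  finite time may be returned. Functions vanishing at infinity do not see such mass. This is why the
  analysis takes place on \<open>corner_box (1 / 2)\<close>: monomials vanish at infinity only at
  points whose coordinates stay away from modulus 1. Identities reach the whole cube afterwards, by
  uniqueness of power series coefficients. The bound by powers of \<open>r\<close> is that of a pure
  death process. A branching event removes at most one individual and immigration removes none, so a
  large population does not become small within bounded time, except with small probability. The
  value 1/2 is the reciprocal of the smallest prime: coefficients are recovered from values at
  points built from reciprocals of primes. The larger box with 3/4 is room for the motion of
  \<open>G t\<close>. Differentiating the quotient form gives rates that may vanish identically; the
  two nondegeneracy conditions serve to exclude this.\<close>

lemma summable_abs_real: "(a :: 'a \<Rightarrow> real) summable_on A \<Longrightarrow> (\<lambda>k. \<bar>a k\<bar>) summable_on A"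
  using summable_on_iff_abs_summable_on_real[of a A] by simp

lemma summable_mult_bounded:
  fixes a f :: "'a \<Rightarrow> real"
  assumes "a summable_on A" "\<And>k. k \<in> A \<Longrightarrow> \<bar>f k\<bar> \<le> C"
  shows "(\<lambda>k. a k * f k) summable_on A"
proof -
  have "(\<lambda>k. \<bar>a k\<bar> * C) summable_on A"
    using summable_abs_real[OF assms(1)] by (rule summable_on_cmult_left)
  then have "(\<lambda>k. norm (a k * f k)) summable_on A"
    by (rule summable_on_comparison_test) (auto simp: abs_mult intro!: mult_left_mono assms(2))
  then show ?thesis by (rule abs_summable_summable)
qed

lemma
  fixes f g :: "'a \<Rightarrow> real"
  assumes "f summable_on A" "g summable_on A"
  shows summable_on_diff_real: "(\<lambda>x. f x - g x) summable_on A"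
    and infsum_diff_real: "(\<Sum>\<^sub>\<infinity>x\<in>A. f x - g x) = infsum f A - infsum g A"
  using summable_on_add[OF assms(1), of "\<lambda>x. - g x"] infsum_add[OF assms(1), of "\<lambda>x. - g x"] assms(2)
  by (simp_all add: infsum_uminus summable_on_uminus)

lemma abs_infsum_mult_le:
  fixes a f :: "'a \<Rightarrow> real"
  assumes "a summable_on A" "\<And>k. k \<in> A \<Longrightarrow> \<bar>f k\<bar> \<le> C"
  shows "\<bar>\<Sum>\<^sub>\<infinity>k\<in>A. a k * f k\<bar> \<le> (\<Sum>\<^sub>\<infinity>k\<in>A. \<bar>a k\<bar>) * C"
proof -
  have s: "(\<lambda>k. \<bar>a k\<bar> * C) summable_on A"
    using summable_abs_real[OF assms(1)] by (rule summable_on_cmult_left)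
  have "((\<lambda>k. a k * f k) has_sum (\<Sum>\<^sub>\<infinity>k\<in>A. a k * f k)) A"
    using summable_mult_bounded[OF assms] by simp
  moreover have "((\<lambda>k. \<bar>a k\<bar> * C) has_sum (\<Sum>\<^sub>\<infinity>k\<in>A. \<bar>a k\<bar> * C)) A"
    using s by simp
  ultimately have "norm (\<Sum>\<^sub>\<infinity>k\<in>A. a k * f k) \<le> (\<Sum>\<^sub>\<infinity>k\<in>A. \<bar>a k\<bar> * C)"
    by (rule norm_infsum_le) (auto simp: abs_mult intro!: mult_left_mono assms(2))
  then show ?thesis by (simp add: infsum_cmult_left')
qed

lemma infsum_delta [simp]:
  fixes f :: "'a \<Rightarrow> real"
  shows "(\<Sum>\<^sub>\<infinity>k. if k = i then f k else 0) = f i" "(\<Sum>\<^sub>\<infinity>k. if i = k then f k else 0) = f i"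
proof -
  have "(\<Sum>\<^sub>\<infinity>k. if k = i then f k else 0) = (\<Sum>\<^sub>\<infinity>k\<in>{i}. f k)"
    by (rule infsum_cong_neutral) auto
  then show "(\<Sum>\<^sub>\<infinity>k. if k = i then f k else 0) = f i" by simp
  have "(\<Sum>\<^sub>\<infinity>k. if i = k then f k else 0) = (\<Sum>\<^sub>\<infinity>k\<in>{i}. f k)"
    by (rule infsum_cong_neutral) auto
  then show "(\<Sum>\<^sub>\<infinity>k. if i = k then f k else 0) = f i" by simp
qed

lemma summable_delta [simp]:
  fixes f :: "'a \<Rightarrow> real"
  shows "(\<lambda>k. if k = i then f k else 0) summable_on UNIV"
    "(\<lambda>k. if i = k then f k else 0) summable_on UNIV"
  by (rule finite_nonzero_values_imp_summable_on; rule finite_subset[of _ "{i}"]; auto)+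

lemma
  fixes f :: "'a \<Rightarrow> real"
  assumes "f summable_on UNIV"
  shows summable_fun_upd: "f(i := c) summable_on UNIV"
    and infsum_fun_upd: "infsum (f(i := c)) UNIV = infsum f UNIV - f i + c"
proof -
  have eq: "f(i := c) = (\<lambda>k. f k + (if k = i then c - f k else 0))" by auto
  show "f(i := c) summable_on UNIV" unfolding eq by (intro summable_on_add assms summable_delta)
  show "infsum (f(i := c)) UNIV = infsum f UNIV - f i + c"
    unfolding eq by (subst infsum_add) (simp_all add: assms)
qed

lemma abs_summable_tail:
  fixes d :: "'a \<Rightarrow> real"
  assumes "d summable_on UNIV" "\<epsilon> > 0"
  shows "\<exists>A. finite A \<and> (\<forall>B. finite B \<longrightarrow> B \<inter> A = {} \<longrightarrow> (\<Sum>k\<in>B. \<bar>d k\<bar>) \<le> \<epsilon>)"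
proof -
  have s: "(\<lambda>k. \<bar>d k\<bar>) summable_on UNIV" using assms(1) by (rule summable_abs_real)
  obtain A where A: "finite A" "dist (\<Sum>k\<in>A. \<bar>d k\<bar>) (\<Sum>\<^sub>\<infinity>k. \<bar>d k\<bar>) \<le> \<epsilon>"
    using infsum_finite_approximation[OF s assms(2)] by auto
  have "(\<Sum>k\<in>B. \<bar>d k\<bar>) \<le> \<epsilon>" if B: "finite B" "B \<inter> A = {}" for B
  proof -
    have "(\<Sum>k\<in>B \<union> A. \<bar>d k\<bar>) \<le> (\<Sum>\<^sub>\<infinity>k. \<bar>d k\<bar>)"
      by (rule finite_sum_le_infsum[OF s]) (use A B in auto)
    then show ?thesis using A B by (auto simp: sum.union_disjoint dist_real_def)
  qed
  with A show ?thesis by blast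
qed

text \<open>Difference quotients of a Q-function need not have a common summable majorant, so only
  tails that are eventually small off one finite set are asked for. The two lemmas built on this get
  small tails from fixed summable weights and from a factor vanishing at infinity,
  respectively.\<close>

lemma tendsto_infsum_uniform_tails:
  fixes x :: "'h \<Rightarrow> 'a \<Rightarrow> real"
  assumes lim: "\<And>k. ((\<lambda>h. x h k) \<longlongrightarrow> y k) F"
    and y: "y summable_on UNIV"
    and summ: "\<forall>\<^sub>F h in F. x h summable_on UNIV"
    and tails: "\<And>\<epsilon>. \<epsilon> > 0 \<Longrightarrow> \<exists>A. finite A \<and>
       (\<forall>\<^sub>F h in F. \<forall>B. finite B \<longrightarrow> B \<inter> A = {} \<longrightarrow> (\<Sum>k\<in>B. \<bar>x h k\<bar>) \<le> \<epsilon>)"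
  shows "((\<lambda>h. infsum (x h) UNIV) \<longlongrightarrow> infsum y UNIV) F"
proof (rule tendstoI)
  fix e :: real assume e: "e > 0"
  have tail: "\<bar>infsum z UNIV - sum z A\<bar> \<le> \<epsilon>"
    if "z summable_on UNIV" "finite A"
      "\<And>B. finite B \<Longrightarrow> B \<inter> A = {} \<Longrightarrow> (\<Sum>k\<in>B. \<bar>z k\<bar>) \<le> \<epsilon>"
    for z :: "'a \<Rightarrow> real" and A \<epsilon>
  proof -
    have s: "z summable_on (- A)" using that(1) by (rule summable_on_subset_banach) simp
    have "infsum z UNIV = infsum z (A \<union> - A)" by simp
    also have "\<dots> = sum z A + infsum z (- A)"
      using s that(2) by (subst infsum_Un_disjoint) auto
    finally have "infsum z UNIV - sum z A = infsum z (- A)" by simp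
    also have "\<bar>\<dots>\<bar> \<le> (\<Sum>\<^sub>\<infinity>k\<in>-A. \<bar>z k\<bar>)"
      using abs_infsum_mult_le[OF s, of "\<lambda>_. 1" 1] by simp
    also have "\<dots> \<le> \<epsilon>"
      by (rule infsum_le_finite_sums[OF summable_abs_real[OF s]]) (use that(3) in auto)
    finally show ?thesis .
  qed
  obtain A1 where A1: "finite A1"
    "\<forall>\<^sub>F h in F. \<forall>B. finite B \<longrightarrow> B \<inter> A1 = {} \<longrightarrow> (\<Sum>k\<in>B. \<bar>x h k\<bar>) \<le> e / 4"
    using tails[of "e / 4"] e by auto
  obtain A2 where A2: "finite A2"
    "\<And>B. finite B \<Longrightarrow> B \<inter> A2 = {} \<Longrightarrow> (\<Sum>k\<in>B. \<bar>y k\<bar>) \<le> e / 4"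
    using abs_summable_tail[OF y, of "e / 4"] e by auto
  define A where "A = A1 \<union> A2"
  have A: "finite A" using A1 A2 by (simp add: A_def)
  have "((\<lambda>h. sum (x h) A) \<longlongrightarrow> sum y A) F" by (intro tendsto_sum lim)
  then have "\<forall>\<^sub>F h in F. dist (sum (x h) A) (sum y A) < e / 4"
    using e by (intro tendstoD) auto
  with A1(2) summ show "\<forall>\<^sub>F h in F. dist (infsum (x h) UNIV) (infsum y UNIV) < e"
  proof eventually_elim
    case (elim h)
    have "\<bar>infsum (x h) UNIV - sum (x h) A\<bar> \<le> e / 4"
      by (rule tail) (use elim A in \<open>auto simp: A_def\<close>)
    moreover have "\<bar>infsum y UNIV - sum y A\<bar> \<le> e / 4"
      by (rule tail) (use A2 y A in \<open>auto simp: A_def\<close>)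
    ultimately show ?case using elim(3) e unfolding dist_real_def by linarith
  qed
qed

lemma tendsto_infsum_mult_dominated:
  fixes d :: "'a \<Rightarrow> real" and f :: "'h \<Rightarrow> 'a \<Rightarrow> real"
  assumes d: "d summable_on UNIV"
    and bound: "\<forall>\<^sub>F h in F. \<forall>k. \<bar>f h k\<bar> \<le> C" and gb: "\<And>k. \<bar>g k\<bar> \<le> C"
    and lim: "\<And>k. ((\<lambda>h. f h k) \<longlongrightarrow> g k) F"
  shows "((\<lambda>h. \<Sum>\<^sub>\<infinity>k. d k * f h k) \<longlongrightarrow> (\<Sum>\<^sub>\<infinity>k. d k * g k)) F"
proof (rule tendsto_infsum_uniform_tails)
  show "((\<lambda>h. d k * f h k) \<longlongrightarrow> d k * g k) F" for k by (intro tendsto_intros lim)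
  show "(\<lambda>k. d k * g k) summable_on UNIV" using d gb by (rule summable_mult_bounded)
  show "\<forall>\<^sub>F h in F. (\<lambda>k. d k * f h k) summable_on UNIV"
    using bound by eventually_elim (rule summable_mult_bounded[OF d], auto)
  fix \<epsilon> :: real assume "\<epsilon> > 0"
  define D where "D = max C 0 + 1"
  have D: "D > 0" "C \<le> D" by (auto simp: D_def)
  obtain A where A: "finite A" "\<And>B. finite B \<Longrightarrow> B \<inter> A = {} \<Longrightarrow> (\<Sum>k\<in>B. \<bar>d k\<bar>) \<le> \<epsilon> / D"
    using abs_summable_tail[OF d, of "\<epsilon> / D"] \<open>\<epsilon> > 0\<close> D by auto
  have "\<forall>\<^sub>F h in F. \<forall>B. finite B \<longrightarrow> B \<inter> A = {} \<longrightarrow> (\<Sum>k\<in>B. \<bar>d k * f h k\<bar>) \<le> \<epsilon>"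
    using bound
  proof eventually_elim
    case (elim h)
    show ?case
    proof (intro allI impI)
      fix B assume B: "finite B" "B \<inter> A = {}"
      have "(\<Sum>k\<in>B. \<bar>d k * f h k\<bar>) \<le> (\<Sum>k\<in>B. \<bar>d k\<bar> * D)"
        by (intro sum_mono) (use elim D in \<open>auto simp: abs_mult intro!: mult_left_mono order_trans[of _ C D]\<close>)
      also have "\<dots> \<le> \<epsilon> / D * D"
        unfolding sum_distrib_right[symmetric] using A(2)[OF B] D by (intro mult_right_mono) auto
      finally show "(\<Sum>k\<in>B. \<bar>d k * f h k\<bar>) \<le> \<epsilon>" using D by simp
    qed
  qed
  with A show "\<exists>A. finite A \<and> (\<forall>\<^sub>F h in F. \<forall>B. finite B \<longrightarrow> B \<inter> A = {} \<longrightarrow>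
      (\<Sum>k\<in>B. \<bar>d k * f h k\<bar>) \<le> \<epsilon>)" by blast
qed

text \<open>The class C_0 for the discrete topology. It refers to no size or order on the index
  type, so it serves for multi-indices as well as for pairs of them.\<close>

definition vanishes_at_infinity :: "('a \<Rightarrow> real) \<Rightarrow> bool" where
  "vanishes_at_infinity g \<longleftrightarrow> (\<forall>\<epsilon>>0. finite {k. \<epsilon> < \<bar>g k\<bar>})"

lemma vanishes_at_infinity_bounded:
  assumes "vanishes_at_infinity g"
  obtains C where "C \<ge> 0" "\<And>k. \<bar>g k\<bar> \<le> C"
proof
  have fin: "finite {k. 1 < \<bar>g k\<bar>}" using assms by (simp add: vanishes_at_infinity_def)
  let ?C = "1 + (\<Sum>k\<in>{k. 1 < \<bar>g k\<bar>}. \<bar>g k\<bar>)"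
  show "?C \<ge> 0" by (simp add: sum_nonneg add_nonneg_nonneg)
  show "\<bar>g k\<bar> \<le> ?C" for k
  proof (cases "1 < \<bar>g k\<bar>")
    case True
    then have "\<bar>g k\<bar> \<le> (\<Sum>k\<in>{k. 1 < \<bar>g k\<bar>}. \<bar>g k\<bar>)" by (intro member_le_sum fin) auto
    then show ?thesis by simp
  next
    case False
    then show ?thesis by (smt (verit) sum_nonneg abs_ge_zero)
  qed
qed

text \<open>A function vanishing at infinity compensates for a lack of uniformity in the tails of \<open>d\<close>.\<close>

lemma tendsto_infsum_mult_vanishing:
  fixes d f :: "'h \<Rightarrow> 'a \<Rightarrow> real"
  assumes dlim: "\<And>k. ((\<lambda>h. d h k) \<longlongrightarrow> e k) F" and e: "e summable_on UNIV"
    and ds: "\<forall>\<^sub>F h in F. d h summable_on UNIV"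
    and db: "\<forall>\<^sub>F h in F. \<forall>B. finite B \<longrightarrow> (\<Sum>k\<in>B. \<bar>d h k\<bar>) \<le> C"
    and flim: "\<And>k. ((\<lambda>h. f h k) \<longlongrightarrow> f0 k) F"
    and g: "vanishes_at_infinity g" and fg: "\<forall>\<^sub>F h in F. \<forall>k. \<bar>f h k\<bar> \<le> g k"
    and f0g: "\<And>k. \<bar>f0 k\<bar> \<le> g k"
  shows "((\<lambda>h. \<Sum>\<^sub>\<infinity>k. d h k * f h k) \<longlongrightarrow> (\<Sum>\<^sub>\<infinity>k. e k * f0 k)) F"
proof (rule tendsto_infsum_uniform_tails)
  obtain G where G: "\<And>k. \<bar>g k\<bar> \<le> G" using vanishes_at_infinity_bounded[OF g] by blast
  show "((\<lambda>h. d h k * f h k) \<longlongrightarrow> e k * f0 k) F" for k by (intro tendsto_intros dlim flim)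
  show "(\<lambda>k. e k * f0 k) summable_on UNIV"
    by (rule summable_mult_bounded[OF e, of _ G]) (use G f0g in \<open>smt (verit)\<close>)
  show "\<forall>\<^sub>F h in F. (\<lambda>k. d h k * f h k) summable_on UNIV"
    using ds fg by eventually_elim (rule summable_mult_bounded[of _ _ _ G]; use G in \<open>smt (verit)\<close>)
  fix \<epsilon> :: real assume "\<epsilon> > 0"
  define D where "D = max C 0 + 1"
  have D: "D > 0" "C \<le> D" by (auto simp: D_def)
  define A where "A = {k. \<epsilon> / D < \<bar>g k\<bar>}"
  have A: "finite A" using g \<open>\<epsilon> > 0\<close> D by (simp add: vanishes_at_infinity_def A_def)
  have "\<forall>\<^sub>F h in F. \<forall>B. finite B \<longrightarrow> B \<inter> A = {} \<longrightarrow> (\<Sum>k\<in>B. \<bar>d h k * f h k\<bar>) \<le> \<epsilon>"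
    using db fg
  proof eventually_elim
    case (elim h)
    show ?case
    proof (intro allI impI)
      fix B assume B: "finite B" "B \<inter> A = {}"
      have "(\<Sum>k\<in>B. \<bar>d h k * f h k\<bar>) \<le> (\<Sum>k\<in>B. \<bar>d h k\<bar> * (\<epsilon> / D))"
      proof (intro sum_mono)
        fix k assume "k \<in> B"
        then have "\<bar>g k\<bar> \<le> \<epsilon> / D" using B by (auto simp: A_def not_less)
        then have "\<bar>f h k\<bar> \<le> \<epsilon> / D" using elim by (smt (verit))
        then show "\<bar>d h k * f h k\<bar> \<le> \<bar>d h k\<bar> * (\<epsilon> / D)"
          unfolding abs_mult by (rule mult_left_mono) simp
      qed
      also have "\<dots> \<le> D * (\<epsilon> / D)"
        unfolding sum_distrib_right[symmetric] using elim(1) B D \<open>\<epsilon> > 0\<close>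
        by (intro mult_right_mono) (auto intro: order_trans)
      finally show "(\<Sum>k\<in>B. \<bar>d h k * f h k\<bar>) \<le> \<epsilon>" using D by simp
    qed
  qed
  with A show "\<exists>A. finite A \<and> (\<forall>\<^sub>F h in F. \<forall>B. finite B \<longrightarrow> B \<inter> A = {} \<longrightarrow>
      (\<Sum>k\<in>B. \<bar>d h k * f h k\<bar>) \<le> \<epsilon>)" by blast
qed

section \<open>Substochastic kernels\<close>

definition substoch :: "('a \<Rightarrow> 'b \<Rightarrow> real) \<Rightarrow> bool" where
  "substoch A \<longleftrightarrow> (\<forall>i j. 0 \<le> A i j) \<and> (\<forall>i. A i summable_on UNIV \<and> infsum (A i) UNIV \<le> 1)"

definition kcomp :: "('a \<Rightarrow> 'b \<Rightarrow> real) \<Rightarrow> ('b \<Rightarrow> 'c \<Rightarrow> real) \<Rightarrow> 'a \<Rightarrow> 'c \<Rightarrow> real" where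
  "kcomp A B i j = (\<Sum>\<^sub>\<infinity>k. A i k * B k j)"

definition id_kernel :: "'a \<Rightarrow> 'a \<Rightarrow> real" where
  "id_kernel i j = (if i = j then 1 else 0)"

lemma substochD:
  assumes "substoch A"
  shows "0 \<le> A i j" "A i summable_on UNIV" "infsum (A i) UNIV \<le> 1"
  using assms by (auto simp: substoch_def)

lemma substoch_finite_sum_le:
  assumes "substoch A" "finite F"
  shows "sum (A i) F \<le> 1"
  using finite_sum_le_infsum[of "A i" UNIV F] substochD[OF assms(1)] assms(2)
  by (metis order_trans subset_UNIV)

lemma substoch_le_1: "substoch A \<Longrightarrow> A i j \<le> 1"
  using substoch_finite_sum_le[of A "{j}" i] by simp

lemma substoch_pair_le_1: "substoch A \<Longrightarrow> i \<noteq> j \<Longrightarrow> A k i + A k j \<le> 1"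
  using substoch_finite_sum_le[of A "{i, j}" k] by simp

lemma substoch_abs_le_1: "substoch A \<Longrightarrow> \<bar>A i j\<bar> \<le> 1"
  using substoch_le_1[of A i j] substochD(1)[of A i j] by simp

lemma substoch_summable_mult:
  "substoch A \<Longrightarrow> (\<And>k. \<bar>f k\<bar> \<le> C) \<Longrightarrow> (\<lambda>k. A i k * f k) summable_on UNIV"
  by (rule summable_mult_bounded[of _ _ _ C]) (auto dest: substochD)

lemma substoch_abs_infsum_le:
  assumes A: "substoch A" and f: "\<And>k. \<bar>f k\<bar> \<le> C"
  shows "\<bar>\<Sum>\<^sub>\<infinity>k. A i k * f k\<bar> \<le> C"
proof -
  have "0 \<le> C" using f[of undefined] by linarith
  have "\<bar>\<Sum>\<^sub>\<infinity>k. A i k * f k\<bar> \<le> (\<Sum>\<^sub>\<infinity>k. \<bar>A i k\<bar>) * C"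
    by (rule abs_infsum_mult_le) (use A f in \<open>auto dest: substochD\<close>)
  also have "\<dots> \<le> 1 * C"
    using substochD[OF A] \<open>0 \<le> C\<close> by (intro mult_right_mono) auto
  finally show ?thesis by simp
qed

text \<open>Both claims are Fubini for the array \<open>a k * B k j * f j\<close>. It is absolutely
  summable because summing over \<open>j\<close> first leaves at most
  \<open>\<bar>a k\<bar> * C\<close>.\<close>

lemma
  fixes a :: "'a \<Rightarrow> real"
  assumes a: "a summable_on UNIV" and B: "substoch B"
  shows summable_kernel_image: "(\<lambda>j. \<Sum>\<^sub>\<infinity>k. a k * B k j) summable_on UNIV"
    and infsum_kernel_image: "(\<And>j. \<bar>f j\<bar> \<le> C) \<Longrightarrow>
      (\<Sum>\<^sub>\<infinity>j. (\<Sum>\<^sub>\<infinity>k. a k * B k j) * f j) = (\<Sum>\<^sub>\<infinity>k. a k * (\<Sum>\<^sub>\<infinity>j. B k j * f j))"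
proof -
  have main: "(\<lambda>(k, j). a k * B k j * f j) summable_on UNIV \<times> UNIV"
    if f: "\<And>j. \<bar>f j\<bar> \<le> C" for f C
  proof -
    have C: "0 \<le> C" using f[of undefined] by linarith
    have "(\<lambda>(k, j). \<bar>a k\<bar> * C * B k j) summable_on UNIV \<times> UNIV"
    proof (rule summable_on_SigmaI)
      show "((\<lambda>y. case (k, y) of (k, j) \<Rightarrow> \<bar>a k\<bar> * C * B k j) has_sum \<bar>a k\<bar> * C * infsum (B k) UNIV) UNIV" for k
        using substochD(2)[OF B] by (auto intro!: has_sum_cmult_right)
      show "(\<lambda>k. \<bar>a k\<bar> * C * infsum (B k) UNIV) summable_on UNIV"
        using summable_abs_real[OF a] substochD[OF B] C
        by (intro summable_mult_bounded[of _ _ _ 1] summable_on_cmult_left)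
           (auto simp: infsum_nonneg)
    qed (use substochD(1)[OF B] C in auto)
    then have "(\<lambda>x. norm (case x of (k, j) \<Rightarrow> a k * B k j * f j)) summable_on UNIV \<times> UNIV"
    proof (rule summable_on_comparison_test)
      fix x :: "'a \<times> 'b"
      obtain k j where x: "x = (k, j)" by fastforce
      have "\<bar>a k\<bar> * B k j * \<bar>f j\<bar> \<le> \<bar>a k\<bar> * B k j * C"
        using f substochD(1)[OF B] by (intro mult_left_mono) auto
      then show "norm (case x of (k, j) \<Rightarrow> a k * B k j * f j) \<le> (case x of (k, j) \<Rightarrow> \<bar>a k\<bar> * C * B k j)"
        using substochD(1)[OF B, of k j] by (simp add: x abs_mult mult_ac)
    qed simp
    then show ?thesis by (rule abs_summable_summable)
  qed
  have "(\<lambda>(k, j). a k * B k j) summable_on UNIV \<times> UNIV"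
    using main[of "\<lambda>_. 1" 1] by simp
  then have "(\<lambda>(j, k). a k * B k j) summable_on UNIV \<times> UNIV"
    by (subst summable_on_swap) (simp add: case_prod_unfold)
  then show "(\<lambda>j. \<Sum>\<^sub>\<infinity>k. a k * B k j) summable_on UNIV"
    using summable_on_Sigma_banach[of "\<lambda>j k. a k * B k j" UNIV "\<lambda>_. UNIV"] by simp
  assume "\<And>j. \<bar>f j\<bar> \<le> C"
  from infsum_swap_banach[OF main[of f, OF this]]
  show "(\<Sum>\<^sub>\<infinity>j. (\<Sum>\<^sub>\<infinity>k. a k * B k j) * f j) = (\<Sum>\<^sub>\<infinity>k. a k * (\<Sum>\<^sub>\<infinity>j. B k j * f j))"
    by (simp add: infsum_cmult_left'[symmetric] infsum_cmult_right'[symmetric] mult.assoc)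
qed

lemma substoch_kcomp:
  assumes "substoch A" "substoch B"
  shows "substoch (kcomp A B)"
  unfolding substoch_def
proof (intro conjI allI)
  show "0 \<le> kcomp A B i j" for i j
    unfolding kcomp_def using assms by (intro infsum_nonneg mult_nonneg_nonneg) (auto dest: substochD)
  show "kcomp A B i summable_on UNIV" for i
    using summable_kernel_image[OF substochD(2)[OF assms(1)] assms(2)] by (simp add: kcomp_def [abs_def])
  have "infsum (kcomp A B i) UNIV = (\<Sum>\<^sub>\<infinity>k. A i k * (\<Sum>\<^sub>\<infinity>j. B k j))" for i
    using infsum_kernel_image[OF substochD(2)[OF assms(1)] assms(2), of "\<lambda>_. 1" 1]
    by (simp add: kcomp_def [abs_def])
  also have "\<dots> i \<le> 1" for i
    using substoch_abs_infsum_le[OF assms(1), of "\<lambda>k. \<Sum>\<^sub>\<infinity>j. B k j" 1 i] substochD[OF assms(2)]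
    by (simp add: infsum_nonneg)
  finally show "infsum (kcomp A B i) UNIV \<le> 1" for i .
qed

lemma kcomp_apply:
  assumes "substoch A" "substoch B" "\<And>j. \<bar>f j\<bar> \<le> C"
  shows "(\<Sum>\<^sub>\<infinity>j. kcomp A B i j * f j) = (\<Sum>\<^sub>\<infinity>k. A i k * (\<Sum>\<^sub>\<infinity>j. B k j * f j))"
  using infsum_kernel_image[OF substochD(2)[OF assms(1)] assms(2,3)] by (simp add: kcomp_def)

lemma kcomp_assoc:
  assumes "substoch A" "substoch B" "substoch C"
  shows "kcomp (kcomp A B) C = kcomp A (kcomp B C)"
proof (intro ext)
  fix i l
  show "kcomp (kcomp A B) C i l = kcomp A (kcomp B C) i l"
    using kcomp_apply[OF assms(1,2), of "\<lambda>j. C j l" 1] substoch_abs_le_1[OF assms(3)]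
    by (simp add: kcomp_def)
qed

lemma kcomp_mono:
  assumes "substoch A" "substoch B" "substoch A'" "substoch B'"
    and "\<And>i j. A i j \<le> A' i j" "\<And>i j. B i j \<le> B' i j"
  shows "kcomp A B i j \<le> kcomp A' B' i j"
  unfolding kcomp_def
  by (intro infsum_mono substoch_summable_mult[of _ _ 1] mult_mono assms substoch_abs_le_1)
     (auto intro: substochD assms)

lemma substoch_id_kernel: "substoch id_kernel"
  by (auto simp: substoch_def id_kernel_def [abs_def])

lemma kcomp_id_left [simp]: "kcomp id_kernel A = A"
  by (simp add: fun_eq_iff kcomp_def id_kernel_def if_distrib[of "\<lambda>x. x * _"] cong: if_cong)

lemma kcomp_ge_finite_sum:
  assumes "substoch A" "substoch B" "finite F"
  shows "(\<Sum>k\<in>F. A i k * B k j) \<le> kcomp A B i j"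
  unfolding kcomp_def
  by (intro finite_sum_le_infsum substoch_summable_mult[of _ _ 1])
     (use assms in \<open>auto simp: substoch_abs_le_1 substoch_le_1 substochD(1)\<close>)

section \<open>The minimal transition function of a q-matrix\<close>

text \<open>Since the diagonal takes part in the row sum, \<open>infsum (Q i) UNIV \<le> 0\<close>
  says that the total jump rate is finite and at most \<open>- Q i i\<close>; the deficit is a
  killing rate.\<close>

definition q_matrix :: "('a \<Rightarrow> 'a \<Rightarrow> real) \<Rightarrow> bool" where
  "q_matrix Q \<longleftrightarrow> (\<forall>i j. i \<noteq> j \<longrightarrow> 0 \<le> Q i j) \<and> (\<forall>i. Q i summable_on UNIV \<and> infsum (Q i) UNIV \<le> 0)"

lemma q_matrixD:
  assumes "q_matrix Q"
  shows "i \<noteq> j \<Longrightarrow> 0 \<le> Q i j" "Q i summable_on UNIV" "infsum (Q i) UNIV \<le> 0"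
  using assms by (auto simp: q_matrix_def)

lemma q_matrix_offdiag:
  assumes "q_matrix Q"
  shows "0 \<le> ((Q i)(i := 0)) j" "(Q i)(i := 0) summable_on UNIV"
    "infsum ((Q i)(i := 0)) UNIV \<le> - Q i i"
  using q_matrixD[OF assms] by (auto simp: summable_fun_upd infsum_fun_upd)

lemma q_matrix_diag_nonpos:
  assumes "q_matrix Q"
  shows "Q i i \<le> 0"
proof -
  have "0 \<le> infsum ((Q i)(i := 0)) UNIV"
    by (rule infsum_nonneg) (rule q_matrix_offdiag[OF assms])
  then show ?thesis using q_matrix_offdiag(3)[OF assms, of i] by linarith
qed

text \<open>For \<open>i \<noteq> j\<close> this is a lower bound for the probability of exactly one jump, from \<open>i\<close> to \<open>j\<close>,
  within time \<open>h\<close>, chosen such that splitting a time interval increases the product of the kernels.\<close>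

definition jump_step :: "('a \<Rightarrow> 'a \<Rightarrow> real) \<Rightarrow> real \<Rightarrow> 'a \<Rightarrow> 'a \<Rightarrow> real" where
  "jump_step Q h i j = (if i = j then exp (h * Q i i) else h * Q i j * exp (h * (Q i i + Q j j)))"

lemma jump_step_nonneg: "q_matrix Q \<Longrightarrow> 0 \<le> h \<Longrightarrow> 0 \<le> jump_step Q h i j"
  by (simp add: jump_step_def q_matrixD(1))

lemma jump_step_0 [simp]: "jump_step Q 0 = id_kernel"
  by (simp add: fun_eq_iff jump_step_def id_kernel_def)

lemma jump_step_le:
  assumes Q: "q_matrix Q" and h: "0 \<le> h"
  shows "jump_step Q h i j \<le> exp (h * Q i i) * (if i = j then 1 else 0) + exp (h * Q i i) * h * ((Q i)(i := 0)) j"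
proof -
  have "exp (h * (Q i i + Q j j)) \<le> exp (h * Q i i)"
    using q_matrix_diag_nonpos[OF Q, of j] h by (simp add: algebra_simps mult_nonneg_nonpos)
  then have "i \<noteq> j \<Longrightarrow> (h * Q i j) * exp (h * (Q i i + Q j j)) \<le> (h * Q i j) * exp (h * Q i i)"
    by (intro mult_left_mono mult_nonneg_nonneg h q_matrixD[OF Q]) auto
  then show ?thesis by (auto simp: jump_step_def mult_ac)
qed

lemma jump_step_apply_le:
  assumes Q: "q_matrix Q" and h: "0 \<le> h" and f: "\<And>j. 0 \<le> f j" "\<And>j. f j \<le> C"
  shows "(\<lambda>j. jump_step Q h i j * f j) summable_on UNIV"
    and "(\<Sum>\<^sub>\<infinity>j. jump_step Q h i j * f j)
       \<le> exp (h * Q i i) * (f i + h * (\<Sum>\<^sub>\<infinity>j. ((Q i)(i := 0)) j * f j))"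
proof -
  let ?g = "\<lambda>j. exp (h * Q i i) * (if i = j then f j else 0) + exp (h * Q i i) * h * (((Q i)(i := 0)) j * f j)"
  have s: "(\<lambda>j. ((Q i)(i := 0)) j * f j) summable_on UNIV"
    by (rule summable_mult_bounded[OF q_matrix_offdiag(2)[OF Q], of _ C]) (use f in auto)
  have sg: "?g summable_on UNIV"
    by (intro summable_on_add summable_on_cmult_right summable_delta s)
  have le: "jump_step Q h i j * f j \<le> ?g j" for j
    using mult_right_mono[OF jump_step_le[OF Q h, of i j] f(1)[of j]]
    by (cases "i = j") (auto simp: algebra_simps)
  show 1: "(\<lambda>j. jump_step Q h i j * f j) summable_on UNIV"
    by (rule summable_on_comparison_test[OF sg le]) (intro mult_nonneg_nonneg jump_step_nonneg[OF Q h] f)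
  have "(\<Sum>\<^sub>\<infinity>j. jump_step Q h i j * f j) \<le> infsum ?g UNIV"
    using le by (intro infsum_mono 1 sg)
  also have "\<dots> = exp (h * Q i i) * (f i + h * (\<Sum>\<^sub>\<infinity>j. ((Q i)(i := 0)) j * f j))"
  proof (subst infsum_add)
    show "(\<lambda>j. exp (h * Q i i) * (if i = j then f j else 0)) summable_on UNIV"
      by (intro summable_on_cmult_right summable_delta)
    show "(\<lambda>j. exp (h * Q i i) * h * (((Q i)(i := 0)) j * f j)) summable_on UNIV"
      by (intro summable_on_cmult_right s)
  qed (simp only: infsum_cmult_right' infsum_delta, simp add: algebra_simps)
  finally show "(\<Sum>\<^sub>\<infinity>j. jump_step Q h i j * f j) \<le> \<dots>" .
qed

text \<open>A row has mass at most \<open>exp (h * Q i i) * (1 - h * Q i i)\<close>, and this is at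
  most 1 by \<open>1 + x \<le> exp x\<close>.\<close>

lemma substoch_jump_step:
  assumes Q: "q_matrix Q" and h: "0 \<le> h"
  shows "substoch (jump_step Q h)"
  unfolding substoch_def
proof (intro conjI allI)
  show "jump_step Q h i summable_on UNIV" for i
    using jump_step_apply_le(1)[OF Q h, of "\<lambda>_. 1" 1 i] by simp
  have "infsum (jump_step Q h i) UNIV \<le> exp (h * Q i i) * (1 + h * infsum ((Q i)(i := 0)) UNIV)" for i
    using jump_step_apply_le(2)[OF Q h, of "\<lambda>_. 1" 1 i] by (simp del: fun_upd_apply)
  also have "\<dots> i \<le> exp (h * Q i i) * (1 + h * (- Q i i))" for i
    by (intro mult_left_mono add_left_mono q_matrix_offdiag[OF Q] h) auto
  also have "\<dots> i \<le> exp (h * Q i i) * exp (- (h * Q i i))" for i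
    using exp_ge_add_one_self[of "- (h * Q i i)"] by (intro mult_left_mono) auto
  also have "\<dots> i = 1" for i by (simp flip: exp_add)
  finally show "infsum (jump_step Q h i) UNIV \<le> 1" for i .
qed (rule jump_step_nonneg[OF Q h])

text \<open>Of the intermediate states only \<open>i\<close> and \<open>j\<close> are kept: the jump
  falls into the second or the first part. In either case one holding factor covers less time than
  in the unsplit kernel, which charges both \<open>i\<close> and \<open>j\<close> for the full time;
  as the diagonal is nonpositive, the product gains.\<close>

lemma jump_step_split:
  assumes Q: "q_matrix Q" and a: "0 \<le> a" and b: "0 \<le> b"
  shows "jump_step Q (a + b) i j \<le> kcomp (jump_step Q a) (jump_step Q b) i j"
proof -
  let ?L = "jump_step Q"
  have le: "(\<Sum>k\<in>{i, j}. ?L a i k * ?L b k j) \<le> kcomp (?L a) (?L b) i j"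
    by (intro kcomp_ge_finite_sum substoch_jump_step Q a b) auto
  show ?thesis
  proof (cases "i = j")
    case True
    then show ?thesis using le by (simp add: jump_step_def algebra_simps exp_add)
  next
    case False
    have e: "a * exp (a * Q i i + b * Q i i + (a * Q j j + b * Q j j)) \<le> a * exp (a * Q i i + a * Q j j + b * Q j j)"
      "b * exp (a * Q i i + b * Q i i + (a * Q j j + b * Q j j)) \<le> b * exp (a * Q i i + b * Q i i + b * Q j j)"
      using q_matrix_diag_nonpos[OF Q, of i] q_matrix_diag_nonpos[OF Q, of j] a b
      by (auto intro!: mult_left_mono simp: mult_nonneg_nonpos)
    have "?L (a + b) i j = Q i j * (a * exp (a * Q i i + b * Q i i + (a * Q j j + b * Q j j))
        + b * exp (a * Q i i + b * Q i i + (a * Q j j + b * Q j j)))"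
      using False by (simp add: jump_step_def algebra_simps)
    also have "\<dots> \<le> Q i j * (a * exp (a * Q i i + a * Q j j + b * Q j j) + b * exp (a * Q i i + b * Q i i + b * Q j j))"
      by (intro mult_left_mono add_mono e q_matrixD[OF Q] False)
    also have "\<dots> = (\<Sum>k\<in>{i, j}. ?L a i k * ?L b k j)"
      using False by (simp add: jump_step_def algebra_simps exp_add)
    finally show ?thesis using le by linarith
  qed
qed

section \<open>Products of one-jump kernels along partitions of a time interval\<close>

fun jump_prod :: "('a \<Rightarrow> 'a \<Rightarrow> real) \<Rightarrow> real list \<Rightarrow> 'a \<Rightarrow> 'a \<Rightarrow> real" where
  "jump_prod Q [] = id_kernel"
| "jump_prod Q (x # xs) = kcomp (jump_step Q x) (jump_prod Q xs)"

text \<open>A partition is the list of its step lengths. Zero steps are allowed, and harmless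
  because \<open>jump_step Q 0\<close> is the identity; coinciding cut points then need no separate
  treatment.\<close>

definition partitions :: "real \<Rightarrow> real list set" where
  "partitions t = {xs. (\<forall>x\<in>set xs. 0 \<le> x) \<and> sum_list xs = t}"

lemma Nil_in_partitions [simp]: "[] \<in> partitions t \<longleftrightarrow> t = 0"
  by (auto simp: partitions_def)

lemma Cons_in_partitions [simp]: "x # xs \<in> partitions t \<longleftrightarrow> 0 \<le> x \<and> xs \<in> partitions (t - x)"
  by (auto simp: partitions_def)

lemma partitions_nonneg: "xs \<in> partitions t \<Longrightarrow> 0 \<le> t"
  by (auto simp: partitions_def intro: sum_list_nonneg)

lemma partitions_append:
  "xs \<in> partitions t \<Longrightarrow> ys \<in> partitions u \<Longrightarrow> xs @ ys \<in> partitions (t + u)"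
  by (auto simp: partitions_def)

context
  fixes Q :: "'a \<Rightarrow> 'a \<Rightarrow> real"
  assumes Q: "q_matrix Q"
begin

lemma substoch_jump_prod: "xs \<in> partitions t \<Longrightarrow> substoch (jump_prod Q xs)"
  by (induction xs arbitrary: t) (auto simp: substoch_id_kernel intro!: substoch_kcomp substoch_jump_step Q)

lemma jump_prod_append:
  "xs \<in> partitions t \<Longrightarrow> ys \<in> partitions u \<Longrightarrow> jump_prod Q (xs @ ys) = kcomp (jump_prod Q xs) (jump_prod Q ys)"
proof (induction xs arbitrary: t)
  case (Cons x xs)
  then have xs: "xs \<in> partitions (t - x)" "0 \<le> x" by auto
  have "jump_prod Q ((x # xs) @ ys) = kcomp (jump_step Q x) (kcomp (jump_prod Q xs) (jump_prod Q ys))"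
    using Cons.IH[OF xs(1) Cons.prems(2)] by simp
  also have "\<dots> = kcomp (jump_prod Q (x # xs)) (jump_prod Q ys)"
    using xs Cons.prems by (simp add: kcomp_assoc substoch_jump_step Q substoch_jump_prod[OF xs(1)]
      substoch_jump_prod[OF Cons.prems(2)])
  finally show ?case .
qed simp

lemma jump_prod_zero: "xs \<in> partitions 0 \<Longrightarrow> jump_prod Q xs = id_kernel"
proof (induction xs)
  case (Cons x xs)
  then have "0 \<le> x" "xs \<in> partitions (- x)" by auto
  with partitions_nonneg[OF this(2)] have "x = 0" "xs \<in> partitions 0" by auto
  then show ?case using Cons by simp
qed simp

lemma jump_prod_Cons_mono:
  assumes "0 \<le> x" "xs \<in> partitions t" "ys \<in> partitions u" "\<And>i j. jump_prod Q xs i j \<le> jump_prod Q ys i j"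
  shows "jump_prod Q (x # xs) i j \<le> jump_prod Q (x # ys) i j"
  using assms by (auto intro!: kcomp_mono substoch_jump_step Q intro: substoch_jump_prod)

lemma jump_prod_split:
  assumes "0 \<le> a" "0 \<le> b" "xs \<in> partitions t"
  shows "jump_prod Q ((a + b) # xs) i j \<le> jump_prod Q (a # b # xs) i j"
proof -
  have s: "substoch (jump_prod Q xs)" by (rule substoch_jump_prod[OF assms(3)])
  have "jump_prod Q ((a + b) # xs) i j \<le> kcomp (kcomp (jump_step Q a) (jump_step Q b)) (jump_prod Q xs) i j"
    using assms s by (auto intro!: kcomp_mono substoch_kcomp substoch_jump_step Q jump_step_split)
  also have "\<dots> = jump_prod Q (a # b # xs) i j"
    using assms s by (simp add: kcomp_assoc substoch_jump_step Q)
  finally show ?thesis .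
qed

text \<open>The shorter first step is taken off both lists, which splits the longer one, and
  splitting only increases the product. The total length of the two lists drops by one each time.
  The products thus form a directed family, and their supremum behaves like a monotone
  limit.\<close>

lemma common_refinement:
  assumes "xs \<in> partitions t" "ys \<in> partitions t"
  shows "\<exists>zs\<in>partitions t. \<forall>i j. jump_prod Q xs i j \<le> jump_prod Q zs i j \<and> jump_prod Q ys i j \<le> jump_prod Q zs i j"
  using assms
proof (induction "length xs + length ys" arbitrary: xs ys t rule: less_induct)
  case less
  consider "xs = []" | "ys = []" | x xs' y ys' where "xs = x # xs'" "ys = y # ys'"
    by (cases xs; cases ys) auto
  then show ?case
  proof cases
    case 1
    then have "t = 0" using less.prems by simp
    then show ?thesis using less.prems jump_prod_zero by (intro bexI[of _ xs]) auto
  next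
    case 2
    then have "t = 0" using less.prems by simp
    then show ?thesis using less.prems jump_prod_zero by (intro bexI[of _ ys]) auto
  next
    case 3
    have step: "\<exists>zs\<in>partitions t. \<forall>i j. jump_prod Q (x # xs') i j \<le> jump_prod Q zs i j
        \<and> jump_prod Q (y # ys') i j \<le> jump_prod Q zs i j"
      if *: "x \<le> y" "x # xs' \<in> partitions t" "y # ys' \<in> partitions t"
        "length xs' + length ys' + 2 = length xs + length ys" for x y xs' ys'
    proof -
      have p: "xs' \<in> partitions (t - x)" "(y - x) # ys' \<in> partitions (t - x)" "0 \<le> x" "ys' \<in> partitions (t - y)"
        using * by auto
      obtain zs where zs: "zs \<in> partitions (t - x)"
        "\<And>i j. jump_prod Q xs' i j \<le> jump_prod Q zs i j"
        "\<And>i j. jump_prod Q ((y - x) # ys') i j \<le> jump_prod Q zs i j"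
        using less.hyps[OF _ p(1,2)] * by auto
      have "jump_prod Q (y # ys') i j \<le> jump_prod Q (x # zs) i j" for i j
      proof -
        have "jump_prod Q (y # ys') i j \<le> jump_prod Q (x # (y - x) # ys') i j"
          using jump_prod_split[of x "y - x" ys' "t - y" i j] p *(1) by simp
        also have "\<dots> \<le> jump_prod Q (x # zs) i j"
          by (rule jump_prod_Cons_mono[OF p(3,2) zs(1,3)])
        finally show ?thesis .
      qed
      moreover have "jump_prod Q (x # xs') i j \<le> jump_prod Q (x # zs) i j" for i j
        by (rule jump_prod_Cons_mono[OF p(3,1) zs(1,2)])
      moreover have "x # zs \<in> partitions t" using zs(1) p by simp
      ultimately show ?thesis by blast
    qed
    show ?thesis
    proof (cases "x \<le> y")
      case True
      then show ?thesis using step[of x y xs' ys'] less.prems 3 by simp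
    next
      case False
      then show ?thesis using step[of y x ys' xs'] less.prems 3 by (simp add: conj_commute)
    qed
  qed
qed

text \<open>Making \<open>t\<close> a cut point splits at most one step, hence does not decrease the
  product.\<close>

lemma partition_cut:
  assumes "zs \<in> partitions (t + u)" "0 \<le> t" "0 \<le> u"
  shows "\<exists>xs\<in>partitions t. \<exists>ys\<in>partitions u. \<forall>i j. jump_prod Q zs i j \<le> jump_prod Q (xs @ ys) i j"
  using assms
proof (induction zs arbitrary: t)
  case Nil
  then have "t = 0" "u = 0" by auto
  then show ?case by (intro bexI[of _ "[]"]) auto
next
  case (Cons z zs)
  then have z: "0 \<le> z" "zs \<in> partitions (t + u - z)" by auto
  show ?case
  proof (cases "z \<le> t")
    case True
    then have "zs \<in> partitions ((t - z) + u)" using z by (simp add: algebra_simps)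
    from Cons.IH[OF this] True Cons.prems obtain xs ys where *: "xs \<in> partitions (t - z)" "ys \<in> partitions u"
      "\<And>i j. jump_prod Q zs i j \<le> jump_prod Q (xs @ ys) i j" by auto
    have "jump_prod Q (z # zs) i j \<le> jump_prod Q ((z # xs) @ ys) i j" for i j
      using jump_prod_Cons_mono[OF z partitions_append[OF *(1,2)] *(3)] by simp
    moreover have "z # xs \<in> partitions t" using * z by simp
    ultimately show ?thesis using *(2) by blast
  next
    case False
    have "jump_prod Q (z # zs) i j \<le> jump_prod Q ([t] @ (z - t) # zs) i j" for i j
      using jump_prod_split[OF \<open>0 \<le> t\<close>, of "z - t" zs, OF _ z(2), of i j] False by simp
    moreover have "[t] \<in> partitions t" "(z - t) # zs \<in> partitions u"
      using Cons.prems z False by (auto simp: algebra_simps)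
    ultimately show ?thesis by blast
  qed
qed

section \<open>The supremum over partitions and its semigroup property\<close>

definition minimal_function :: "real \<Rightarrow> 'a \<Rightarrow> 'a \<Rightarrow> real" where
  "minimal_function t i j = (SUP xs\<in>partitions t. jump_prod Q xs i j)"

lemma jump_prod_le_minimal:
  assumes "xs \<in> partitions t"
  shows "jump_prod Q xs i j \<le> minimal_function t i j"
  unfolding minimal_function_def
proof (rule cSUP_upper[OF assms])
  show "bdd_above ((\<lambda>xs. jump_prod Q xs i j) ` partitions t)"
    by (rule bdd_aboveI[of _ 1]) (auto intro: substoch_le_1 substoch_jump_prod)
qed

lemma minimal_function_le:
  assumes "0 \<le> t" "\<And>xs. xs \<in> partitions t \<Longrightarrow> jump_prod Q xs i j \<le> c"
  shows "minimal_function t i j \<le> c"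
  unfolding minimal_function_def
proof (rule cSUP_least)
  have "[t] \<in> partitions t" using assms(1) by simp
  then show "partitions t \<noteq> {}" by blast
qed (rule assms(2))

lemma jump_step_le_minimal: "0 \<le> t \<Longrightarrow> jump_step Q t i j \<le> minimal_function t i j"
proof -
  assume t: "0 \<le> t"
  have "kcomp (jump_step Q t) id_kernel i j = jump_step Q t i j"
    by (simp add: kcomp_def id_kernel_def if_distrib cong: if_cong)
  then show ?thesis using jump_prod_le_minimal[of "[t]" t i j] t by simp
qed

text \<open>The supremum is taken entry by entry; directedness under refinement gives one partition
  that is nearly optimal for finitely many entries at once. Infinite sums of
  \<open>minimal_function\<close> are then controlled through finite partial sums.\<close>

lemma minimal_function_approx:
  assumes "0 \<le> t" "finite K" "0 < \<epsilon>"
  shows "\<exists>xs\<in>partitions t. \<forall>(i, j)\<in>K. minimal_function t i j - \<epsilon> \<le> jump_prod Q xs i j"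
  using assms(2)
proof induction
  case empty
  have "[t] \<in> partitions t" using assms(1) by simp
  then show ?case by blast
next
  case (insert x K)
  then obtain xs where xs: "xs \<in> partitions t" "\<And>i j. (i, j) \<in> K \<Longrightarrow> minimal_function t i j - \<epsilon> \<le> jump_prod Q xs i j"
    by blast
  obtain i j where x: "x = (i, j)" by fastforce
  have "\<exists>ys\<in>partitions t. minimal_function t i j - \<epsilon> < jump_prod Q ys i j"
    using minimal_function_le[OF assms(1), of i j "minimal_function t i j - \<epsilon>"] assms(3) by force
  then obtain ys where ys: "ys \<in> partitions t" "minimal_function t i j - \<epsilon> < jump_prod Q ys i j" by blast
  obtain zs where zs: "zs \<in> partitions t" "\<And>i j. jump_prod Q xs i j \<le> jump_prod Q zs i j"
    "\<And>i j. jump_prod Q ys i j \<le> jump_prod Q zs i j"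
    using common_refinement[OF xs(1) ys(1)] by blast
  have "minimal_function t k l - \<epsilon> \<le> jump_prod Q zs k l" if "(k, l) \<in> insert x K" for k l
    using that xs(2)[of k l] ys(2) zs(2,3)[of k l] x by fastforce
  then show ?case using zs(1) by blast
qed

lemma minimal_function_nonneg: "0 \<le> t \<Longrightarrow> 0 \<le> minimal_function t i j"
  using jump_step_le_minimal[of t i j] jump_step_nonneg[OF Q, of t i j] by linarith

lemma substoch_minimal_function:
  assumes t: "0 \<le> t"
  shows "substoch (minimal_function t)"
proof -
  have fin: "sum (minimal_function t i) F \<le> 1" if F: "finite F" for i F
  proof (rule field_le_epsilon)
    fix \<epsilon> :: real assume e: "0 < \<epsilon>"
    define \<delta> where "\<delta> = \<epsilon> / (card F + 1)"
    have d: "\<delta> > 0" "card F * \<delta> \<le> \<epsilon>" using e by (auto simp: \<delta>_def field_simps)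
    obtain xs where xs: "xs \<in> partitions t"
      "\<forall>(i, j)\<in>{i} \<times> F. minimal_function t i j - \<delta> \<le> jump_prod Q xs i j"
      using minimal_function_approx[OF t, of "{i} \<times> F" \<delta>] F d by auto
    have "sum (minimal_function t i) F \<le> (\<Sum>j\<in>F. jump_prod Q xs i j + \<delta>)"
      using xs(2) by (intro sum_mono) (auto simp: algebra_simps)
    also have "\<dots> = sum (jump_prod Q xs i) F + card F * \<delta>" by (simp add: sum.distrib)
    also have "\<dots> \<le> 1 + \<epsilon>"
      by (intro add_mono d substoch_finite_sum_le substoch_jump_prod[OF xs(1)] F)
    finally show "sum (minimal_function t i) F \<le> 1 + \<epsilon>" .
  qed
  have "minimal_function t i summable_on UNIV" for i
    using fin minimal_function_nonneg[OF t]
    by (intro nonneg_bdd_above_summable_on bdd_aboveI[of _ 1]) auto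
  with fin show ?thesis
    unfolding substoch_def using minimal_function_nonneg[OF t] by (auto intro: infsum_le_finite_sums)
qed

text \<open>One inequality comes from cutting partitions of \<open>t + u\<close> at
  \<open>t\<close>, the other from concatenating partitions that are nearly optimal for the finitely
  many intermediate states of a partial sum.\<close>

lemma minimal_function_semigroup:
  assumes t: "0 \<le> t" and u: "0 \<le> u"
  shows "minimal_function (t + u) i j = (\<Sum>\<^sub>\<infinity>k. minimal_function t i k * minimal_function u k j)"
proof (rule antisym)
  let ?P = minimal_function
  have sP: "substoch (?P t)" "substoch (?P u)" using t u by (auto intro: substoch_minimal_function)
  show "?P (t + u) i j \<le> (\<Sum>\<^sub>\<infinity>k. ?P t i k * ?P u k j)"
  proof (rule minimal_function_le)
    fix zs assume "zs \<in> partitions (t + u)"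
    from partition_cut[OF this t u] obtain xs ys where *: "xs \<in> partitions t" "ys \<in> partitions u"
      "jump_prod Q zs i j \<le> jump_prod Q (xs @ ys) i j" by blast
    note *(3)
    also have "jump_prod Q (xs @ ys) i j = kcomp (jump_prod Q xs) (jump_prod Q ys) i j"
      by (simp add: jump_prod_append[OF *(1,2)])
    also have "\<dots> \<le> kcomp (?P t) (?P u) i j"
      by (intro kcomp_mono sP substoch_jump_prod[OF *(1)] substoch_jump_prod[OF *(2)] jump_prod_le_minimal *)
    finally show "jump_prod Q zs i j \<le> (\<Sum>\<^sub>\<infinity>k. ?P t i k * ?P u k j)" by (simp add: kcomp_def)
  qed (use t u in simp)
  show "(\<Sum>\<^sub>\<infinity>k. ?P t i k * ?P u k j) \<le> ?P (t + u) i j"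
  proof (rule infsum_le_finite_sums)
    show "(\<lambda>k. ?P t i k * ?P u k j) summable_on UNIV"
      by (rule substoch_summable_mult[OF sP(1)]) (rule substoch_abs_le_1[OF sP(2)])
    fix F :: "'a set" assume F: "finite F"
    show "(\<Sum>k\<in>F. ?P t i k * ?P u k j) \<le> ?P (t + u) i j"
    proof (rule field_le_epsilon)
      fix \<epsilon> :: real assume e: "0 < \<epsilon>"
      define \<delta> where "\<delta> = \<epsilon> / (2 * (card F + 1))"
      have d: "\<delta> > 0" "card F * (2 * \<delta>) \<le> \<epsilon>" using e by (auto simp: \<delta>_def field_simps)
      obtain xs where xs: "xs \<in> partitions t" "\<forall>(i, j)\<in>{i} \<times> F. ?P t i j - \<delta> \<le> jump_prod Q xs i j"
        using minimal_function_approx[OF t, of "{i} \<times> F" \<delta>] F d by auto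
      obtain ys where ys: "ys \<in> partitions u" "\<forall>(i, j)\<in>F \<times> {j}. ?P u i j - \<delta> \<le> jump_prod Q ys i j"
        using minimal_function_approx[OF u, of "F \<times> {j}" \<delta>] F d by auto
      have sx: "substoch (jump_prod Q xs)" and sy: "substoch (jump_prod Q ys)"
        using substoch_jump_prod xs ys by auto
      have "?P t i k * ?P u k j \<le> jump_prod Q xs i k * jump_prod Q ys k j + 2 * \<delta>" if k: "k \<in> F" for k
      proof -
        have "?P t i k * ?P u k j \<le> (jump_prod Q xs i k + \<delta>) * ?P u k j"
          using xs(2) k by (intro mult_right_mono) (auto simp: algebra_simps minimal_function_nonneg u)
        also have "\<dots> \<le> jump_prod Q xs i k * ?P u k j + \<delta>"
          using substoch_le_1[OF sP(2), of k j] d(1) by (simp add: algebra_simps)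
        also have "jump_prod Q xs i k * ?P u k j \<le> jump_prod Q xs i k * (jump_prod Q ys k j + \<delta>)"
          using ys(2) k substochD(1)[OF sx] by (intro mult_left_mono) (auto simp: algebra_simps)
        also have "\<dots> \<le> jump_prod Q xs i k * jump_prod Q ys k j + \<delta>"
          using substoch_le_1[OF sx, of i k] d(1) by (simp add: algebra_simps)
        finally show ?thesis by simp
      qed
      then have "(\<Sum>k\<in>F. ?P t i k * ?P u k j) \<le> (\<Sum>k\<in>F. jump_prod Q xs i k * jump_prod Q ys k j + 2 * \<delta>)"
        by (rule sum_mono)
      also have "\<dots> = (\<Sum>k\<in>F. jump_prod Q xs i k * jump_prod Q ys k j) + card F * (2 * \<delta>)"
        by (simp add: sum.distrib)
      also have "\<dots> \<le> jump_prod Q (xs @ ys) i j + \<epsilon>"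
        unfolding jump_prod_append[OF xs(1) ys(1)] by (intro add_mono d kcomp_ge_finite_sum sx sy F)
      also have "\<dots> \<le> ?P (t + u) i j + \<epsilon>"
        using jump_prod_le_minimal[OF partitions_append[OF xs(1) ys(1)]] by simp
      finally show "(\<Sum>k\<in>F. ?P t i k * ?P u k j) \<le> ?P (t + u) i j + \<epsilon>" .
    qed
  qed
qed

end

section \<open>Transition functions and their derivatives at 0\<close>

lemma
  assumes "transition_function P"
  shows transition_substoch: "0 \<le> t \<Longrightarrow> substoch (P t)"
    and transition_0: "P 0 = id_kernel"
    and transition_add: "0 \<le> t \<Longrightarrow> 0 \<le> u \<Longrightarrow> P (t + u) = kcomp (P t) (P u)"
    and transition_standard: "((\<lambda>t. P t i j) \<longlongrightarrow> id_kernel i j) (at_right 0)"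
proof -
  note D = assms[unfolded transition_function_def]
  show "substoch (P t)" if "0 \<le> t" using D that by (simp add: substoch_def)
  show "P 0 = id_kernel" using D by (simp add: id_kernel_def fun_eq_iff)
  show "P (t + u) = kcomp (P t) (P u)" if "0 \<le> t" "0 \<le> u"
    using D that by (simp add: kcomp_def fun_eq_iff)
  show "((\<lambda>t. P t i j) \<longlongrightarrow> id_kernel i j) (at_right 0)"
    using D by (simp add: id_kernel_def)
qed

lemma filterlim_divide_Suc_at_right_0:
  assumes "0 < t"
  shows "filterlim (\<lambda>m. t / real (Suc m)) (at_right 0) sequentially"
  unfolding filterlim_at
proof
  show "\<forall>\<^sub>F m in sequentially. t / real (Suc m) \<in> {0<..} \<and> t / real (Suc m) \<noteq> 0"
    using assms by (intro always_eventually) simp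
  show "(\<lambda>m. t / real (Suc m)) \<longlonglongrightarrow> 0"
    using tendsto_mult_right_zero[OF LIMSEQ_inverse_real_of_nat, of t] by (simp add: divide_inverse)
qed

context
  fixes P :: "real \<Rightarrow> 'a \<Rightarrow> 'a \<Rightarrow> real"
  assumes P: "transition_function P"
begin

lemma transition_nonneg: "0 \<le> t \<Longrightarrow> 0 \<le> P t i j"
  using substochD(1)[OF transition_substoch[OF P]] .

lemma transition_le_1: "0 \<le> t \<Longrightarrow> P t i j \<le> 1"
  using substoch_le_1[OF transition_substoch[OF P]] .

lemma transition_ge_path:
  assumes "0 \<le> t" "0 \<le> u"
  shows "P t i k * P u k j \<le> P (t + u) i j"
  using kcomp_ge_finite_sum[of "P t" "P u" "{k}" i j] assms
  by (simp add: transition_add[OF P] transition_substoch[OF P])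

lemma transition_ge_two_paths:
  assumes "0 \<le> t" "0 \<le> u" "k \<noteq> l"
  shows "P t i k * P u k j + P t i l * P u l j \<le> P (t + u) i j"
  using kcomp_ge_finite_sum[of "P t" "P u" "{k, l}" i j] assms
  by (simp add: transition_add[OF P] transition_substoch[OF P])

lemma transition_diag_power:
  assumes "0 \<le> h"
  shows "P h i i ^ m \<le> P (real m * h) i i"
proof (induction m)
  case 0
  then show ?case by (simp add: transition_0[OF P] id_kernel_def)
next
  case (Suc m)
  have "P h i i * P h i i ^ m \<le> P h i i * P (real m * h) i i"
    using Suc transition_nonneg assms by (intro mult_left_mono) auto
  also have "\<dots> \<le> P (h + real m * h) i i"
    using assms by (intro transition_ge_path) auto
  finally show ?case by (simp add: algebra_simps)
qed

text \<open>Standardness makes the diagonal positive at short times; staying put in each of many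
  short steps carries this to every time.\<close>

lemma transition_diag_pos:
  assumes "0 \<le> t"
  shows "0 < P t i i"
proof -
  have "((\<lambda>m. P (t / real (Suc m)) i i) \<longlonglongrightarrow> 1)"
  proof (cases "t = 0")
    case True
    then show ?thesis by (simp add: transition_0[OF P] id_kernel_def)
  next
    case False
    then have "filterlim (\<lambda>m. t / real (Suc m)) (at_right 0) sequentially"
      using assms by (intro filterlim_divide_Suc_at_right_0) simp
    then show ?thesis
      using filterlim_compose[OF transition_standard[OF P, of i i]] by (simp add: id_kernel_def)
  qed
  then have "\<forall>\<^sub>F m in sequentially. 0 < P (t / real (Suc m)) i i"
    by (rule order_tendstoD) simp
  then obtain m where "0 < P (t / real (Suc m)) i i" by (auto simp: eventually_sequentially)
  then have "0 < P (t / real (Suc m)) i i ^ Suc m" by (rule zero_less_power)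
  also have "\<dots> \<le> P (real (Suc m) * (t / real (Suc m))) i i"
    using assms by (intro transition_diag_power) simp
  finally show ?thesis by simp
qed

text \<open>The factor 2 counts the loss \<open>1 - P h i i\<close> on the diagonal and the mass off
  it, which is no larger. Estimates of increments over a short time are reduced to the diagonal
  through this bound.\<close>

lemma transition_increment_row:
  assumes "0 \<le> h"
  shows "(\<lambda>k. P h i k - id_kernel i k) summable_on UNIV"
    and "(\<Sum>\<^sub>\<infinity>k. \<bar>P h i k - id_kernel i k\<bar>) \<le> 2 * (1 - P h i i)"
proof -
  note s = transition_substoch[OF P assms]
  have eq: "\<bar>P h i k - id_kernel i k\<bar> = ((P h i)(i := 1 - P h i i)) k" for k
    using substochD(1)[OF s, of i k] substoch_le_1[OF s, of i i] by (auto simp: id_kernel_def)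
  show "(\<lambda>k. P h i k - id_kernel i k) summable_on UNIV"
    using substochD(2)[OF s] substochD(2)[OF substoch_id_kernel] by (rule summable_on_diff_real)
  show "(\<Sum>\<^sub>\<infinity>k. \<bar>P h i k - id_kernel i k\<bar>) \<le> 2 * (1 - P h i i)"
    unfolding eq using substochD[OF s, of i] by (simp add: infsum_fun_upd del: fun_upd_apply)
qed

lemma transition_apply_increment:
  assumes "0 \<le> h" "\<And>k. \<bar>f k\<bar> \<le> C"
  shows "(\<Sum>\<^sub>\<infinity>k. P h i k * f k) - f i = (\<Sum>\<^sub>\<infinity>k. (P h i k - id_kernel i k) * f k)"
    and "\<bar>(\<Sum>\<^sub>\<infinity>k. P h i k * f k) - f i\<bar> \<le> 2 * (1 - P h i i) * C"
proof -
  have C: "0 \<le> C" using assms(2)[of undefined] by linarith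
  have id: "(\<Sum>\<^sub>\<infinity>k. id_kernel i k * f k) = f i"
    by (simp add: id_kernel_def if_distrib[of "\<lambda>x. x * _"] cong: if_cong)
  show eq: "(\<Sum>\<^sub>\<infinity>k. P h i k * f k) - f i = (\<Sum>\<^sub>\<infinity>k. (P h i k - id_kernel i k) * f k)"
    unfolding left_diff_distrib
    by (subst infsum_diff_real)
       (auto simp: id intro!: substoch_summable_mult[of _ _ C] assms transition_substoch[OF P] substoch_id_kernel)
  have "\<bar>\<Sum>\<^sub>\<infinity>k. (P h i k - id_kernel i k) * f k\<bar> \<le> (\<Sum>\<^sub>\<infinity>k. \<bar>P h i k - id_kernel i k\<bar>) * C"
    by (rule abs_infsum_mult_le) (use transition_increment_row(1) assms in auto)
  also have "\<dots> \<le> 2 * (1 - P h i i) * C"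
    by (intro mult_right_mono transition_increment_row assms C)
  finally show "\<bar>(\<Sum>\<^sub>\<infinity>k. P h i k * f k) - f i\<bar> \<le> 2 * (1 - P h i i) * C"
    by (simp add: eq)
qed

text \<open>The increment from \<open>t\<close> to \<open>t + h\<close> is \<open>P h\<close> minus
  the identity applied to a bounded function, hence at most \<open>2 * (1 - P h i i) * C\<close>,
  uniformly in \<open>t\<close>. Stated for general orbits so that it covers both matrix entries and
  generating functions.\<close>

lemma continuous_on_semigroup_orbit:
  assumes f: "\<And>t k. 0 \<le> t \<Longrightarrow> \<bar>f t k\<bar> \<le> C"
    and sg: "\<And>t h. 0 \<le> t \<Longrightarrow> 0 \<le> h \<Longrightarrow> f (t + h) i = (\<Sum>\<^sub>\<infinity>k. P h i k * f t k)"
  shows "continuous_on {0..} (\<lambda>t. f t i)"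
proof -
  have mod: "\<bar>f u i - f t i\<bar> \<le> 2 * (1 - P \<bar>u - t\<bar> i i) * C" if "0 \<le> t" "0 \<le> u" for t u
  proof (cases "t \<le> u")
    case True
    then show ?thesis
      using transition_apply_increment(2)[of "u - t" "f t" C i] f that sg[of t "u - t"] by simp
  next
    case False
    then show ?thesis
      using transition_apply_increment(2)[of "t - u" "f u" C i] f that sg[of u "t - u"] by (simp add: abs_minus_commute)
  qed
  show ?thesis unfolding continuous_on_iff
  proof (intro ballI allI impI)
    fix t e :: real assume t: "t \<in> {0..}" and e: "0 < e"
    have "((\<lambda>h. 2 * (1 - P h i i) * C) \<longlongrightarrow> 2 * (1 - id_kernel i i) * C) (at_right 0)"
      by (intro tendsto_intros transition_standard P)
    then have "((\<lambda>h. 2 * (1 - P h i i) * C) \<longlongrightarrow> 0) (at_right 0)" by (simp add: id_kernel_def)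
    then have "\<forall>\<^sub>F h in at_right 0. 2 * (1 - P h i i) * C < e" using e by (rule order_tendstoD)
    then obtain d where d: "d > 0" "\<And>h. 0 < h \<Longrightarrow> h < d \<Longrightarrow> 2 * (1 - P h i i) * C < e"
      by (auto simp: eventually_at_right_field)
    have "dist (f u i) (f t i) < e" if u: "u \<in> {0..}" "dist u t < d" for u
    proof (cases "u = t")
      case False
      then have "2 * (1 - P \<bar>u - t\<bar> i i) * C < e" using u by (intro d) (auto simp: dist_real_def)
      then show ?thesis using mod[of t u] t u by (auto simp: dist_real_def)
    qed (use e in simp)
    with d(1) show "\<exists>d>0. \<forall>u\<in>{0..}. dist u t < d \<longrightarrow> dist (f u i) (f t i) < e" by blast
  qed
qed

lemma transition_continuous: "continuous_on {0..} (\<lambda>t. P t i j)"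
proof (rule continuous_on_semigroup_orbit[where f = "\<lambda>t k. P t k j" and C = 1])
  show "\<bar>P t k j\<bar> \<le> 1" if "0 \<le> t" for t k
    using substoch_abs_le_1[OF transition_substoch[OF P that]] .
  show "P (t + h) i j = (\<Sum>\<^sub>\<infinity>k. P h i k * P t k j)" if "0 \<le> t" "0 \<le> h" for t h
    using transition_add[OF P that(2,1)] by (simp add: kcomp_def add.commute)
qed

text \<open>There are \<open>m\<close> disjoint scenarios: exactly one of the \<open>m\<close> steps
  leads from \<open>i\<close> to \<open>j\<close>, the process sitting in \<open>i\<close> before
  and in \<open>j\<close> after it. Each of the other \<open>m - 1\<close> steps costs at least the
  factor \<open>exp (h * (a + b))\<close>, whichever of the two states it is spent in.\<close>

lemma transition_offdiag_multiple:
  assumes h: "0 \<le> h" and ij: "i \<noteq> j"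
    and dii: "\<And>t. 0 \<le> t \<Longrightarrow> exp (t * a) \<le> P t i i" and djj: "\<And>t. 0 \<le> t \<Longrightarrow> exp (t * b) \<le> P t j j"
  shows "real m * P h i j * exp ((real m - 1) * h * (a + b)) \<le> P (real m * h) i j"
proof (induction m)
  case 0
  then show ?case using transition_nonneg by simp
next
  case (Suc m)
  have a: "a \<le> 0" using order_trans[OF dii[of 1] transition_le_1] by simp
  have b: "b \<le> 0" using order_trans[OF djj[of 1] transition_le_1] by simp
  have mh: "0 \<le> real m * h" using h by simp
  have "real m * P h i j * exp (real m * h * (a + b)) \<le> real m * P h i j * exp (h * a + (real m - 1) * h * (a + b))"
    using h b transition_nonneg[OF h] by (intro mult_left_mono) (auto simp: algebra_simps mult_nonneg_nonpos mult_nonpos_nonneg)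
  also have "\<dots> = exp (h * a) * (real m * P h i j * exp ((real m - 1) * h * (a + b)))"
    by (simp add: exp_add)
  also have "\<dots> \<le> P h i i * P (real m * h) i j"
    using Suc h transition_nonneg by (intro mult_mono dii) auto
  finally have 1: "real m * P h i j * exp (real m * h * (a + b)) \<le> P h i i * P (real m * h) i j" .
  have "P h i j * exp (real m * h * (a + b)) \<le> P h i j * exp (real m * h * b)"
    using mh a transition_nonneg[OF h] by (intro mult_left_mono) (auto intro: mult_left_mono)
  also have "\<dots> \<le> P h i j * P (real m * h) j j"
    using mh transition_nonneg[OF h] by (intro mult_left_mono djj) auto
  finally have "real (Suc m) * P h i j * exp (real m * h * (a + b)) \<le> P (h + real m * h) i j"
    using 1 transition_ge_two_paths[OF h mh ij, of i j] by (simp add: algebra_simps)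
  then show ?case by (simp add: algebra_simps)
qed

text \<open>For \<open>c < q\<close> the derivative gives \<open>exp (h * c) < P h i i\<close> for
  all small \<open>h > 0\<close>; taking powers extends this to time \<open>t\<close>, and then
  \<open>c\<close> tends to \<open>q\<close>.\<close>

lemma transition_diag_exp:
  assumes "((\<lambda>t. P t i i) has_real_derivative q) (at_right 0)" and t: "0 \<le> t"
  shows "exp (t * q) \<le> P t i i"
proof (cases "t = 0")
  case True
  then show ?thesis by (simp add: transition_0[OF P] id_kernel_def)
next
  case False
  with t have t: "0 < t" by simp
  have *: "exp (t * c) \<le> P t i i" if c: "c < q" for c
  proof -
    have "((\<lambda>t. P t i i - exp (t * c)) has_real_derivative q - c) (at_right 0)"
      by (rule derivative_eq_intros assms(1) refl | simp)+
    from has_real_derivative_pos_inc_right[OF this] c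
    obtain d where d: "d > 0" "\<And>h. 0 < h \<Longrightarrow> h < d \<Longrightarrow> 0 < P h i i - exp (h * c)"
      by (auto simp: transition_0[OF P] id_kernel_def)
    have "\<forall>\<^sub>F m in sequentially. t / real (Suc m) < d"
      using filterlim_divide_Suc_at_right_0[OF t] d(1)
      by (intro order_tendstoD(2)[of _ 0]) (auto simp: filterlim_at)
    then obtain m where m: "t / real (Suc m) < d" by (auto simp: eventually_sequentially)
    have "exp (t * c) = exp (t / real (Suc m) * c) ^ Suc m"
      by (subst exp_of_nat_mult[symmetric]) simp
    also have "\<dots> \<le> P (t / real (Suc m)) i i ^ Suc m"
      using d(2)[of "t / real (Suc m)"] m t by (intro power_mono) auto
    also have "\<dots> \<le> P (real (Suc m) * (t / real (Suc m))) i i"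
      using t by (intro transition_diag_power) simp
    finally show ?thesis by simp
  qed
  have "((\<lambda>c. exp (t * c)) \<longlongrightarrow> exp (t * q)) (at_left q)" by (intro tendsto_intros)
  then show ?thesis
    by (rule tendsto_upperbound) (auto simp: eventually_at_left_field intro!: * exI[of _ "q - 1"])
qed

end

text \<open>A Fekete-type lemma; \<open>m * h\<close> runs through a fine net as \<open>h\<close> tends to 0.\<close>

lemma tendsto_at_right_0_of_multiples:
  fixes f :: "real \<Rightarrow> real"
  assumes cont: "continuous_on {0<..} f" and bound: "\<And>h. 0 < h \<Longrightarrow> B \<le> f h"
    and mult: "\<And>m h. 0 < h \<Longrightarrow> 0 < m \<Longrightarrow> f h \<le> f (real m * h)"
  shows "\<exists>L. (f \<longlongrightarrow> L) (at_right 0)"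
proof
  \<comment> \<open>By \<open>mult\<close> values at small times are bounded by values at their
    multiples, so the limit at 0 can only be the infimum.\<close>
  define L where "L = (INF h\<in>{0<..}. f h)"
  have bdd: "bdd_below (f ` {0<..})" using bound by (intro bdd_belowI[of _ B]) auto
  show "(f \<longlongrightarrow> L) (at_right 0)"
  proof (rule tendstoI)
    fix e :: real assume "0 < e"
    then have "(INF h\<in>{0<..}. f h) < L + e" by (simp add: L_def)
    then obtain t where t: "0 < t" "f t < L + e"
      using cINF_less_iff[OF _ bdd, of "L + e"] by auto
    then have "\<exists>d>0. \<forall>s\<in>{0<..}. dist s t < d \<longrightarrow> dist (f s) (f t) < L + e - f t"
      using cont unfolding continuous_on_iff by auto
    then obtain d where d: "d > 0" "\<And>s. 0 < s \<Longrightarrow> dist s t < d \<Longrightarrow> f s < L + e"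
      by (fastforce simp: dist_real_def)
    have "dist (f h) L < e" if h: "0 < h" "h < min d t" for h
    proof -
      define m where "m = nat \<lfloor>t / h\<rfloor>"
      have m: "real m = of_int \<lfloor>t / h\<rfloor>" using t h by (simp add: m_def)
      have "1 \<le> \<lfloor>t / h\<rfloor>" using t h by (simp add: le_floor_iff)
      then have m0: "0 < m" by (simp add: m_def)
      have "real m \<le> t / h" "t / h < real m + 1" unfolding m by linarith+
      then have "real m * h \<le> t" "t - h < real m * h" using h by (simp_all add: field_simps)
      then have "f (real m * h) < L + e" using h m0 by (intro d) (auto simp: dist_real_def)
      then have "f h < L + e" using mult[OF h(1) m0] by linarith
      moreover have "L \<le> f h" unfolding L_def using h by (intro cINF_lower bdd) auto
      ultimately show ?thesis by (simp add: dist_real_def)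
    qed
    then show "\<forall>\<^sub>F h in at_right 0. dist (f h) L < e"
      unfolding eventually_at_right_field using d t by (intro exI[of _ "min d t"]) auto
  qed
qed

lemma has_real_derivative_at_right_0_iff:
  fixes f :: "real \<Rightarrow> real"
  shows "(f has_real_derivative D) (at_right 0) \<longleftrightarrow> ((\<lambda>h. (f h - f 0) / h) \<longlongrightarrow> D) (at_right 0)"
  by (simp add: has_field_derivative_iff)

text \<open>For a standard transition function the diagonal derivative could be minus infinity; the
  linear bound excludes this. On the diagonal, Bernoulli's inequality applied to
  \<open>P h i i ^ m\<close> shows that the difference quotient does not decrease along multiples of
  \<open>h\<close>.\<close>

lemma Q_function_exists:
  assumes P: "transition_function P"
    and stable: "\<And>i. \<exists>C \<tau>. 0 < \<tau> \<and> (\<forall>h. 0 < h \<longrightarrow> h \<le> \<tau> \<longrightarrow> 1 - P h i i \<le> C * h)"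
  shows "\<exists>Q. Q_function Q P"
proof -
  have cont: "continuous_on {0<..} (\<lambda>t. P t i j)" for i j
    by (rule continuous_on_subset[OF transition_continuous[OF P]]) auto
  have mult_pos: "0 < real m * h \<and> 0 \<le> h" if "0 < h" "0 < m" for m h using that by simp
  have "\<exists>q. ((\<lambda>t. P t i i) has_real_derivative q) (at_right 0)" for i
  proof -
    obtain C \<tau> where C: "0 < \<tau>" "\<And>h. 0 < h \<Longrightarrow> h \<le> \<tau> \<Longrightarrow> 1 - P h i i \<le> C * h"
      using stable[of i] by blast
    define f where "f = (\<lambda>h. (P h i i - 1) / h)"
    have mult: "f h \<le> f (real m * h)" if h: "0 < h" "0 < m" for m h
    proof -
      have "1 + real m * (P h i i - 1) \<le> (1 + (P h i i - 1)) ^ m"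
        by (rule Bernoulli_inequality) (use transition_nonneg[OF P, of h i i] h in simp)
      also have "\<dots> \<le> P (real m * h) i i" using transition_diag_power[OF P, of h i m] h by simp
      finally have "real m * (P h i i - 1) \<le> P (real m * h) i i - 1" by simp
      then have "real m * (P h i i - 1) / (real m * h) \<le> (P (real m * h) i i - 1) / (real m * h)"
        using h by (intro divide_right_mono) auto
      then show ?thesis using h by (simp add: f_def)
    qed
    have "- C \<le> f h" if h: "0 < h" for h
    proof -
      \<comment> \<open>The linear bound is known only up to \<open>\<tau>\<close>, so
        \<open>h\<close> is divided until it applies and \<open>mult\<close> leads back to
        \<open>h\<close>.\<close>
      obtain m where m: "h / \<tau> < real (Suc m)"
        using reals_Archimedean2[of "h / \<tau>"] by (metis less_Suc_eq_le less_le_trans lessI of_nat_less_iff order_less_trans)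
      then have "h / real (Suc m) \<le> \<tau>" using C(1) by (simp add: field_simps)
      then have "1 - P (h / real (Suc m)) i i \<le> C * (h / real (Suc m))" using h by (intro C(2)) auto
      then have "- C \<le> f (h / real (Suc m))" using h by (simp add: f_def field_simps)
      also have "\<dots> \<le> f h" using mult[of "h / real (Suc m)" "Suc m"] h by simp
      finally show ?thesis .
    qed
    moreover have "continuous_on {0<..} f" unfolding f_def by (intro continuous_intros cont) auto
    ultimately obtain L where "(f \<longlongrightarrow> L) (at_right 0)"
      using tendsto_at_right_0_of_multiples[of f "- C"] mult by blast
    then show ?thesis
      unfolding has_real_derivative_at_right_0_iff f_def by (auto simp: transition_0[OF P] id_kernel_def)
  qed
  then obtain q where q: "\<And>i. ((\<lambda>t. P t i i) has_real_derivative q i) (at_right 0)" by metis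
  have "\<exists>r. ((\<lambda>t. P t i j) has_real_derivative r) (at_right 0)" if ij: "i \<noteq> j" for i j
  proof -
    let ?c = "q i + q j"
    \<comment> \<open>The exponential compensates the waiting factor in
      \<open>transition_offdiag_multiple\<close>: the exponents \<open>- m h c\<close> and
      \<open>(m - 1) h c\<close> add up to \<open>- h c\<close>, which is what
      \<open>f h \<le> f (m * h)\<close> requires. It tends to 1 at 0, so the limit of
      \<open>P h i j / h\<close> is not affected.\<close>
    define f where "f = (\<lambda>h. exp (- (h * ?c)) * P h i j / h)"
    have mult: "f h \<le> f (real m * h)" if h: "0 < h" "0 < m" for m h
    proof -
      have "real m * P h i j * exp ((real m - 1) * h * ?c) \<le> P (real m * h) i j"
        using h ij by (intro transition_offdiag_multiple[OF P] transition_diag_exp[OF P] q) auto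
      then have "exp (- (real m * h * ?c)) * (real m * P h i j * exp ((real m - 1) * h * ?c))
          \<le> exp (- (real m * h * ?c)) * P (real m * h) i j"
        by (rule mult_left_mono) simp
      also have "exp (- (real m * h * ?c)) * (real m * P h i j * exp ((real m - 1) * h * ?c))
          = real m * P h i j * exp (- (real m * h * ?c) + (real m - 1) * h * ?c)"
        unfolding exp_add by simp
      also have "- (real m * h * ?c) + (real m - 1) * h * ?c = - (h * ?c)" by (simp add: algebra_simps)
      finally show ?thesis using h by (simp add: f_def field_simps)
    qed
    have "0 \<le> f h" if h: "0 < h" for h
      using h transition_nonneg[OF P, of h i j] by (simp add: f_def)
    moreover have "continuous_on {0<..} f" unfolding f_def by (intro continuous_intros cont) auto
    ultimately obtain L where "(f \<longlongrightarrow> L) (at_right 0)"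
      using tendsto_at_right_0_of_multiples[of f 0] mult by blast
    then have "((\<lambda>h. exp (h * ?c) * f h) \<longlongrightarrow> exp (0 * ?c) * L) (at_right 0)"
      by (intro tendsto_intros)
    moreover have "exp (h * ?c) * f h = P h i j / h" for h
      unfolding f_def times_divide_eq_right mult.assoc[symmetric] exp_minus by simp
    ultimately show ?thesis
      unfolding has_real_derivative_at_right_0_iff using ij by (auto simp: transition_0[OF P] id_kernel_def)
  qed
  with q have "\<forall>i j. \<exists>r. ((\<lambda>t. P t i j) has_real_derivative r) (at_right 0)" by metis
  then obtain Q where "\<And>i j. ((\<lambda>t. P t i j) has_real_derivative Q i j) (at_right 0)" by metis
  with P show ?thesis unfolding Q_function_def by blast
qed

section \<open>Q-functions and the q-matrices they determine\<close>

lemma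
  assumes "Q_function Q P"
  shows Q_function_transition: "transition_function P"
    and Q_function_tendsto: "((\<lambda>h. (P h i j - id_kernel i j) / h) \<longlongrightarrow> Q i j) (at_right 0)"
proof -
  show P: "transition_function P" using assms by (simp add: Q_function_def)
  show "((\<lambda>h. (P h i j - id_kernel i j) / h) \<longlongrightarrow> Q i j) (at_right 0)"
    using assms by (auto simp: Q_function_def has_real_derivative_at_right_0_iff transition_0[OF P])
qed

text \<open>The inequality passes to the limit on finite sets of states. Mass that leaves for
  infinity at a positive rate is seen by no finite set, so even an honest \<open>P\<close> may have
  negative row sums here.\<close>

lemma Q_function_q_matrix:
  assumes PQ: "Q_function Q P"
  shows "q_matrix Q"
proof -
  note P = Q_function_transition[OF PQ]
  have off: "0 \<le> Q i j" if "i \<noteq> j" for i j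
  proof (rule tendsto_lowerbound[OF Q_function_tendsto[OF PQ]])
    show "\<forall>\<^sub>F h in at_right 0. 0 \<le> (P h i j - id_kernel i j) / h"
      using eventually_at_right_less[of 0]
      by eventually_elim (use that transition_nonneg[OF P] in \<open>auto simp: id_kernel_def\<close>)
  qed simp
  have fin: "sum (Q i) F \<le> 0" if F: "finite F" "i \<in> F" for i F
  proof (rule tendsto_upperbound[OF tendsto_sum[OF Q_function_tendsto[OF PQ]]])
    show "\<forall>\<^sub>F h in at_right 0. (\<Sum>j\<in>F. (P h i j - id_kernel i j) / h) \<le> 0"
      using eventually_at_right_less[of 0]
    proof eventually_elim
      case (elim h)
      have "(\<Sum>j\<in>F. P h i j - id_kernel i j) \<le> 0"
        using substoch_finite_sum_le[OF transition_substoch[OF P, of h] F(1), of i] elim F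
        by (simp add: sum_subtractf id_kernel_def)
      then show ?case using elim by (simp add: divide_nonpos_pos flip: sum_divide_distrib)
    qed
  qed simp
  have fin': "sum ((Q i)(i := 0)) F \<le> - Q i i" if F: "finite F" for i F
  proof -
    have "sum ((Q i)(i := 0)) F = sum ((Q i)(i := 0)) (insert i F)"
      using F by (intro sum.mono_neutral_left) auto
    also have "\<dots> = sum (Q i) (F - {i})"
      using F by (subst sum.insert_remove) (auto intro!: sum.cong)
    also have "\<dots> = sum (Q i) (insert i F) - Q i i"
      using F by (simp add: sum.insert_remove)
    finally show ?thesis using fin[of "insert i F" i] F by simp
  qed
  have s: "(Q i)(i := 0) summable_on UNIV" for i
    using fin' off by (intro nonneg_bdd_above_summable_on bdd_aboveI[of _ "- Q i i"]) auto
  have s': "Q i summable_on UNIV" for i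
    using summable_fun_upd[OF s, of i i "Q i i"] by simp
  have "infsum ((Q i)(i := 0)) UNIV \<le> - Q i i" for i
    using fin' by (intro infsum_le_finite_sums s) auto
  then have "infsum (Q i) UNIV \<le> 0" for i
    by (simp add: infsum_fun_upd[OF s'])
  with s' off show ?thesis by (auto simp: q_matrix_def)
qed

section \<open>Minimality\<close>

text \<open>In \<open>transition_offdiag_multiple\<close> time \<open>t\<close> is divided into
  \<open>m + 1\<close> equal steps; \<open>(m + 1) * P (t / (m + 1)) i j\<close> tends to
  \<open>t * Q i j\<close>. The argument uses paths and the derivative at 0 in place of a Kolmogorov
  equation.\<close>

lemma jump_step_le_Q_function:
  assumes PQ: "Q_function Q P" and t: "0 \<le> t"
  shows "jump_step Q t i j \<le> P t i j"
proof -
  note P = Q_function_transition[OF PQ]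
  have diag: "exp (s * Q k k) \<le> P s k k" if "0 \<le> s" for s k
    using PQ that by (intro transition_diag_exp[OF P]) (auto simp: Q_function_def)
  show ?thesis
  proof (cases "i = j \<or> t = 0")
    case True
    then show ?thesis
      using diag[OF t, of i] by (auto simp: jump_step_def transition_0[OF P] id_kernel_def)
  next
    case False
    with t have t: "0 < t" and ij: "i \<noteq> j" by auto
    let ?c = "Q i i + Q j j"
    have c: "?c \<le> 0"
      using q_matrix_diag_nonpos[OF Q_function_q_matrix[OF PQ]] by (simp add: add_nonpos_nonpos)
    let ?h = "\<lambda>m. t / real (Suc m)"
    have "((\<lambda>m. t * ((P (?h m) i j - id_kernel i j) / ?h m) * exp (t * ?c)) \<longlongrightarrow> t * Q i j * exp (t * ?c)) sequentially"
      by (intro tendsto_intros filterlim_compose[OF Q_function_tendsto[OF PQ] filterlim_divide_Suc_at_right_0[OF t]])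
    then have "t * Q i j * exp (t * ?c) \<le> P t i j"
    proof (rule tendsto_upperbound)
      show "\<forall>\<^sub>F m in sequentially. t * ((P (?h m) i j - id_kernel i j) / ?h m) * exp (t * ?c) \<le> P t i j"
      proof (intro always_eventually allI)
        fix m
        let ?h = "t / real (Suc m)"
        have h: "0 \<le> ?h" using t by simp
        have e: "t * ?c \<le> (real (Suc m) - 1) * ?h * ?c"
          using c t by (intro mult_right_mono_neg) (auto simp: field_simps)
        have "t * ((P ?h i j - id_kernel i j) / ?h) * exp (t * ?c) = real (Suc m) * P ?h i j * exp (t * ?c)"
          using t ij by (simp add: id_kernel_def)
        also have "\<dots> \<le> real (Suc m) * P ?h i j * exp ((real (Suc m) - 1) * ?h * ?c)"
          using e transition_nonneg[OF P h] by (intro mult_left_mono) auto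
        also have "\<dots> \<le> P (real (Suc m) * ?h) i j"
          using h ij diag by (intro transition_offdiag_multiple[OF P]) auto
        finally show "t * ((P ?h i j - id_kernel i j) / ?h) * exp (t * ?c) \<le> P t i j" by simp
      qed
    qed simp
    then show ?thesis using ij by (simp add: jump_step_def)
  qed
qed

lemma minimal_function_le_Q_function:
  assumes PQ: "Q_function Q P" and t: "0 \<le> t"
  shows "minimal_function Q t i j \<le> P t i j"
proof (rule minimal_function_le[OF Q_function_q_matrix[OF PQ] t])
  note P = Q_function_transition[OF PQ] and Q = Q_function_q_matrix[OF PQ]
  show "jump_prod Q xs i j \<le> P t i j" if "xs \<in> partitions t" for xs
    using that
  proof (induction xs arbitrary: t i j)
    case Nil
    then show ?case by (simp add: transition_0[OF P])
  next
    case (Cons x xs)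
    then have x: "0 \<le> x" "xs \<in> partitions (t - x)" by auto
    have "kcomp (jump_step Q x) (jump_prod Q xs) i j \<le> kcomp (P x) (P (t - x)) i j"
      using x partitions_nonneg[OF x(2)]
      by (intro kcomp_mono substoch_jump_step Q substoch_jump_prod[OF Q x(2)] transition_substoch[OF P]
          jump_step_le_Q_function[OF PQ] Cons.IH) auto
    also have "\<dots> = P t i j"
      using transition_add[OF P x(1) partitions_nonneg[OF x(2)]] by simp
    finally show ?case by simp
  qed
qed

text \<open>The sum on the right estimates the contribution of the first jump; the exponential factor
  passes from the value of the minimal function at an earlier time to the one at \<open>t\<close>.\<close>

lemma minimal_function_upper_bound:
  assumes Q: "q_matrix Q" and t: "0 \<le> t"
  shows "minimal_function Q t i j \<le> exp (t * Q i i) * id_kernel i j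
    + t * (\<Sum>\<^sub>\<infinity>k. ((Q i)(i := 0)) k * (minimal_function Q t k j * exp (- (t * Q j j))))"
proof -
  let ?P = "minimal_function Q"
  let ?M = "\<Sum>\<^sub>\<infinity>k. ((Q i)(i := 0)) k * (?P t k j * exp (- (t * Q j j)))"
  note sub = substoch_minimal_function[OF Q]
  have summ: "(\<lambda>k. ((Q i)(i := 0)) k * (?P t k j * exp (- (t * Q j j)))) summable_on UNIV"
    by (rule summable_mult_bounded[of _ _ _ "exp (- (t * Q j j))"])
       (use q_matrix_offdiag(2)[OF Q] substoch_abs_le_1[OF sub[OF t]] in \<open>auto simp: abs_mult simp del: fun_upd_apply\<close>)
  have M0: "0 \<le> ?M"
    by (intro infsum_nonneg mult_nonneg_nonneg q_matrix_offdiag(1)[OF Q] minimal_function_nonneg[OF Q t]) auto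
  have earlier: "?P s k j \<le> ?P t k j * exp (- (t * Q j j))" if "0 \<le> s" "s \<le> t" for s k
  proof -
    have "exp (t * Q j j) \<le> exp ((t - s) * Q j j)"
      using q_matrix_diag_nonpos[OF Q, of j] that by (auto intro: mult_right_mono_neg)
    also have "\<dots> \<le> ?P (t - s) j j"
      using jump_step_le_minimal[OF Q, of "t - s" j j] that by (simp add: jump_step_def)
    finally have "?P s k j * exp (t * Q j j) \<le> ?P s k j * ?P (t - s) j j"
      by (intro mult_left_mono minimal_function_nonneg[OF Q] that)
    also have "\<dots> \<le> kcomp (?P s) (?P (t - s)) k j"
      using kcomp_ge_finite_sum[of "?P s" "?P (t - s)" "{j}" k j] sub that by simp
    also have "\<dots> = ?P t k j"
      using minimal_function_semigroup[OF Q, of s "t - s"] that by (simp add: kcomp_def)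
    finally show ?thesis by (simp add: exp_minus field_simps)
  qed
  have "jump_prod Q xs i j \<le> exp (s * Q i i) * id_kernel i j + s * ?M"
    if "xs \<in> partitions s" "s \<le> t" for xs s
    using that
  proof (induction xs arbitrary: s)
    case Nil
    then show ?case by simp
  next
    case (Cons x xs)
    then have x: "0 \<le> x" "xs \<in> partitions (s - x)" by auto
    note sx = partitions_nonneg[OF x(2)]
    have sY: "substoch (jump_prod Q xs)" by (rule substoch_jump_prod[OF Q x(2)])
    have "jump_prod Q (x # xs) i j \<le> exp (x * Q i i) *
        (jump_prod Q xs i j + x * (\<Sum>\<^sub>\<infinity>k. ((Q i)(i := 0)) k * jump_prod Q xs k j))"
      using jump_step_apply_le(2)[OF Q x(1), of "\<lambda>k. jump_prod Q xs k j" 1 i] sY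
      by (simp add: kcomp_def substoch_le_1 substochD(1))
    also have "(\<Sum>\<^sub>\<infinity>k. ((Q i)(i := 0)) k * jump_prod Q xs k j) \<le> ?M"
    proof (rule infsum_mono[OF _ summ])
      show "(\<lambda>k. ((Q i)(i := 0)) k * jump_prod Q xs k j) summable_on UNIV"
        by (rule summable_mult_bounded[OF q_matrix_offdiag(2)[OF Q]]) (rule substoch_abs_le_1[OF sY])
      show "((Q i)(i := 0)) k * jump_prod Q xs k j \<le> ((Q i)(i := 0)) k * (?P t k j * exp (- (t * Q j j)))" for k
        using jump_prod_le_minimal[OF Q x(2), of k j] earlier[of "s - x" k] x(1) sx Cons.prems
        by (intro mult_left_mono q_matrix_offdiag(1)[OF Q]) auto
    qed
    also have "jump_prod Q xs i j \<le> exp ((s - x) * Q i i) * id_kernel i j + (s - x) * ?M"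
      using Cons.IH[OF x(2)] Cons.prems x(1) by simp
    finally have "jump_prod Q (x # xs) i j \<le> exp (x * Q i i) *
        (exp ((s - x) * Q i i) * id_kernel i j + (s - x) * ?M + x * ?M)"
      using x(1) by (simp add: mult_left_mono)
    also have "\<dots> = exp (s * Q i i) * id_kernel i j + exp (x * Q i i) * (s * ?M)"
      by (simp add: algebra_simps exp_add[symmetric] flip: exp_diff)
    also have "exp (x * Q i i) * (s * ?M) \<le> 1 * (s * ?M)"
      using x(1) sx M0 q_matrix_diag_nonpos[OF Q, of i] by (intro mult_right_mono) (auto simp: mult_nonneg_nonpos)
    finally show ?case by simp
  qed
  then show ?thesis using minimal_function_le[OF Q t] by blast
qed

text \<open>The difference quotient at 0 is squeezed between that of \<open>jump_step\<close> and
  that of the upper bound. The bound involves values of the function itself at time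
  \<open>t\<close>; these tend to the identity by standardness, which is therefore proved
  first.\<close>

lemma Q_function_minimal_function:
  assumes Q: "q_matrix Q"
  shows "Q_function Q (minimal_function Q)"
proof -
  let ?P = "minimal_function Q"
  note sub = substoch_minimal_function[OF Q]
  have zero: "?P 0 = id_kernel"
  proof (intro ext)
    fix i j
    show "?P 0 i j = id_kernel i j"
      using minimal_function_le[OF Q, of 0 i j "id_kernel i j"] jump_step_le_minimal[OF Q, of 0 i j]
      by (auto simp: jump_prod_zero[OF Q])
  qed
  have diag: "((\<lambda>t. ?P t i i) \<longlongrightarrow> 1) (at_right 0)" for i
  proof (rule tendsto_sandwich)
    show "\<forall>\<^sub>F t in at_right 0. exp (t * Q i i) \<le> ?P t i i"
      using eventually_at_right_less[of 0]
      by eventually_elim (use jump_step_le_minimal[OF Q, of _ i i] in \<open>simp add: jump_step_def\<close>)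
    show "\<forall>\<^sub>F t in at_right 0. ?P t i i \<le> 1"
      using eventually_at_right_less[of 0] by eventually_elim (intro substoch_le_1 sub less_imp_le)
    have "((\<lambda>t. exp (t * Q i i)) \<longlongrightarrow> exp (0 * Q i i)) (at_right 0)" by (intro tendsto_intros)
    then show "((\<lambda>t. exp (t * Q i i)) \<longlongrightarrow> 1) (at_right 0)" by simp
  qed simp
  have standard: "((\<lambda>t. ?P t i j) \<longlongrightarrow> id_kernel i j) (at_right 0)" for i j
  proof (cases "i = j")
    case False
    have "((\<lambda>t. ?P t i j) \<longlongrightarrow> 0) (at_right 0)"
    proof (rule tendsto_sandwich)
      show "\<forall>\<^sub>F t in at_right 0. 0 \<le> ?P t i j"
        using eventually_at_right_less[of 0] by eventually_elim (auto intro: minimal_function_nonneg Q)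
      show "\<forall>\<^sub>F t in at_right 0. ?P t i j \<le> 1 - ?P t i i"
        using eventually_at_right_less[of 0]
        by eventually_elim (use substoch_pair_le_1[OF sub False] in \<open>force simp: algebra_simps\<close>)
      show "((\<lambda>t. 1 - ?P t i i) \<longlongrightarrow> 0) (at_right 0)"
        using tendsto_diff[OF tendsto_const[of 1] diag[of i]] by simp
    qed simp
    with False show ?thesis by (simp add: id_kernel_def)
  qed (use diag in \<open>simp add: id_kernel_def\<close>)
  have trans: "transition_function ?P"
    unfolding transition_function_def
    using sub zero standard minimal_function_semigroup[OF Q]
    by (auto simp: substoch_def id_kernel_def)
  have deriv: "((\<lambda>h. (?P h i j - id_kernel i j) / h) \<longlongrightarrow> Q i j) (at_right 0)" for i j
  proof (rule tendsto_sandwich)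
    let ?L = "\<lambda>t. (exp (t * Q i i) - 1) / t * id_kernel i j"
    let ?M = "\<lambda>t. \<Sum>\<^sub>\<infinity>k. ((Q i)(i := 0)) k * (?P t k j * exp (- (t * Q j j)))"
    have "((\<lambda>t. exp (t * Q i i)) has_real_derivative Q i i) (at_right 0)"
      by (rule derivative_eq_intros refl | simp)+
    then have e: "((\<lambda>t. (exp (t * Q i i) - 1) / t) \<longlongrightarrow> Q i i) (at_right 0)"
      by (simp add: has_real_derivative_at_right_0_iff)
    have eb: "\<forall>\<^sub>F t in at_right 0. exp (- (t * Q j j)) < 2"
    proof (rule order_tendstoD)
      show "((\<lambda>t. exp (- (t * Q j j))) \<longlongrightarrow> exp (- (0 * Q j j))) (at_right 0)" by (intro tendsto_intros)
    qed simp
    have "((\<lambda>t. ?P t k j * exp (- (t * Q j j))) \<longlongrightarrow> id_kernel k j * exp (- (0 * Q j j))) (at_right 0)" for k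
      by (intro tendsto_intros standard)
    then have lim: "((\<lambda>t. ?P t k j * exp (- (t * Q j j))) \<longlongrightarrow> id_kernel k j) (at_right 0)" for k by simp
    have "(?M \<longlongrightarrow> (\<Sum>\<^sub>\<infinity>k. ((Q i)(i := 0)) k * id_kernel k j)) (at_right 0)"
    proof (rule tendsto_infsum_mult_dominated[OF q_matrix_offdiag(2)[OF Q] _ _ lim])
      show "\<forall>\<^sub>F t in at_right 0. \<forall>k. \<bar>?P t k j * exp (- (t * Q j j))\<bar> \<le> 2"
        using eb eventually_at_right_less[of 0]
      proof eventually_elim
        case (elim t)
        show ?case
        proof
          fix k
          have "\<bar>?P t k j\<bar> * exp (- (t * Q j j)) \<le> 1 * 2"
            using elim by (intro mult_mono substoch_abs_le_1 sub) auto
          then show "\<bar>?P t k j * exp (- (t * Q j j))\<bar> \<le> 2" by (simp add: abs_mult)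
        qed
      qed
    qed (simp add: id_kernel_def)
    also have "(\<Sum>\<^sub>\<infinity>k. ((Q i)(i := 0)) k * id_kernel k j) = (\<Sum>\<^sub>\<infinity>k. if k = j then ((Q i)(i := 0)) k else 0)"
      by (intro infsum_cong) (auto simp: id_kernel_def)
    also have "\<dots> = ((Q i)(i := 0)) j" by (rule infsum_delta)
    finally have M: "(?M \<longlongrightarrow> ((Q i)(i := 0)) j) (at_right 0)" .
    have Qij: "Q i i * id_kernel i j + ((Q i)(i := 0)) j = Q i j" by (auto simp: id_kernel_def)
    have upper: "((\<lambda>t. ?L t + ?M t) \<longlongrightarrow> Q i j) (at_right 0)"
      unfolding Qij[symmetric] by (intro tendsto_intros e M)
    show "\<forall>\<^sub>F t in at_right 0. (?P t i j - id_kernel i j) / t \<le> ?L t + ?M t"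
      using eventually_at_right_less[of 0]
    proof eventually_elim
      case (elim t)
      then show ?case
        using minimal_function_upper_bound[OF Q, of t i j] by (simp add: field_simps del: fun_upd_apply)
    qed
    show "\<forall>\<^sub>F t in at_right 0. (jump_step Q t i j - id_kernel i j) / t \<le> (?P t i j - id_kernel i j) / t"
      using eventually_at_right_less[of 0]
    proof eventually_elim
      case (elim t)
      then show ?case by (intro divide_right_mono diff_right_mono jump_step_le_minimal[OF Q]) auto
    qed
    show "((\<lambda>t. (jump_step Q t i j - id_kernel i j) / t) \<longlongrightarrow> Q i j) (at_right 0)"
    proof (cases "i = j")
      case True
      then show ?thesis using e by (simp add: jump_step_def id_kernel_def)
    next
      case False
      have "((\<lambda>t. Q i j * exp (t * (Q i i + Q j j))) \<longlongrightarrow> Q i j * exp (0 * (Q i i + Q j j))) (at_right 0)"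
        by (intro tendsto_intros)
      then have "((\<lambda>t. Q i j * exp (t * (Q i i + Q j j))) \<longlongrightarrow> Q i j) (at_right 0)" by simp
      moreover have "\<forall>\<^sub>F t in at_right 0. Q i j * exp (t * (Q i i + Q j j)) = (jump_step Q t i j - id_kernel i j) / t"
        using eventually_at_right_less[of 0]
        by eventually_elim (use False in \<open>auto simp: jump_step_def id_kernel_def\<close>)
      ultimately show ?thesis by (rule Lim_transform_eventually)
    qed
    show "((\<lambda>t. ?L t + ?M t) \<longlongrightarrow> Q i j) (at_right 0)" by (rule upper)
  qed
  with trans zero show ?thesis
    by (auto simp: Q_function_def has_real_derivative_at_right_0_iff)
qed

lemma Feller_minimal_minimal_function: "q_matrix Q \<Longrightarrow> Feller_minimal Q (minimal_function Q)"
  by (simp add: Feller_minimal_def Q_function_minimal_function minimal_function_le_Q_function)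

lemma Feller_minimal_eq:
  assumes "Feller_minimal Q P" "0 \<le> t"
  shows "P t = minimal_function Q t"
proof (intro ext antisym)
  have PQ: "Q_function Q P" using assms by (simp add: Feller_minimal_def)
  show "P t i j \<le> minimal_function Q t i j" for i j
    using assms Q_function_minimal_function[OF Q_function_q_matrix[OF PQ]] by (simp add: Feller_minimal_def)
  show "minimal_function Q t i j \<le> P t i j" for i j
    by (rule minimal_function_le_Q_function[OF PQ assms(2)])
qed

lemma Q_function_eq_minimal_imp_Feller_minimal:
  assumes "Q_function Q P" "\<And>t. 0 \<le> t \<Longrightarrow> P t = minimal_function Q t"
  shows "Feller_minimal Q P"
  using assms by (simp add: Feller_minimal_def minimal_function_le_Q_function)

lemma minimal_function_absorbing:
  assumes Q: "q_matrix Q" and i: "\<And>j. j \<noteq> i \<Longrightarrow> Q i j = 0" and t: "0 \<le> t" and j: "j \<noteq> i"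
  shows "minimal_function Q t i j = 0"
proof -
  have "jump_prod Q xs i j = 0" if "xs \<in> partitions s" for xs s
    using that
  proof (induction xs arbitrary: s)
    case Nil
    then show ?case using j by (simp add: id_kernel_def)
  next
    case (Cons x xs)
    then have "jump_step Q x i k * jump_prod Q xs k j = 0" for k
      using i[of k] by (cases "k = i") (auto simp: jump_step_def)
    then have "(\<lambda>k. jump_step Q x i k * jump_prod Q xs k j) = (\<lambda>_. 0)" by (rule ext)
    then show ?case by (simp only: jump_prod.simps kcomp_def infsum_0_simp)
  qed
  then show ?thesis
    using minimal_function_le[OF Q t, of i j 0] minimal_function_nonneg[OF Q t, of i j] by (simp add: antisym)
qed

section \<open>Multi-indices and monomials\<close>

definition msize :: "nat ^ 'n::finite \<Rightarrow> nat" where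
  "msize j = (\<Sum>k\<in>UNIV. j $ k)"

text \<open>At points with nonnegative coordinates a generating function is monotone in the entries
  of its row, and for \<open>\<rho> < 1\<close> the monomials are dominated by a geometric sequence
  in \<open>msize\<close>.\<close>

definition corner_box :: "real \<Rightarrow> (real ^ 'n::finite) set" where
  "corner_box \<rho> = {s. \<forall>k. 0 \<le> s $ k \<and> s $ k \<le> \<rho>}"

text \<open>The simplifier rewrites \<open>1 :: nat\<close> to \<open>Suc 0\<close>, also inside \<^term>\<open>unit_index k\<close>.\<close>

lemma unit_index_nth [simp]: "axis k (Suc 0) $ l = (if l = k then 1 else 0)"
  by (auto simp: axis_def)

lemma msize_add [simp]: "msize (i + j) = msize i + msize j"
  by (simp add: msize_def sum.distrib)

lemma msize_0 [simp]: "msize 0 = 0"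
  by (simp add: msize_def)

lemma msize_unit [simp]: "msize (axis k (Suc 0)) = 1"
  by (simp add: msize_def)

lemma component_le_msize: "j $ k \<le> msize j"
  unfolding msize_def by (rule member_le_sum) auto

lemma finite_msize_le: "finite {j :: nat ^ 'n::finite. msize j \<le> N}"
proof -
  have "{j :: nat ^ 'n. msize j \<le> N} \<subseteq> vec_lambda ` (UNIV \<rightarrow>\<^sub>E {..N})"
  proof
    fix j :: "nat ^ 'n" assume "j \<in> {j. msize j \<le> N}"
    then have "($) j \<in> UNIV \<rightarrow>\<^sub>E {..N}" using component_le_msize[of j] by (auto intro: order_trans)
    then show "j \<in> vec_lambda ` (UNIV \<rightarrow>\<^sub>E {..N})" by (intro image_eqI[of _ _ "($) j"]) auto
  qed
  then show ?thesis by (rule finite_subset) (intro finite_imageI finite_PiE; simp)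
qed

lemma multi_index_minus_unit: "0 < i $ k \<Longrightarrow> i - unit_index k + unit_index k = (i :: nat ^ 'n::finite)"
  by (auto simp: vec_eq_iff)

lemma multi_index_induct [case_names zero add_unit]:
  fixes i :: "nat ^ 'n::finite"
  assumes "P 0" "\<And>i k. P i \<Longrightarrow> P (i + unit_index k)"
  shows "P i"
proof (induction "msize i" arbitrary: i)
  case 0
  then have "i = 0" using component_le_msize[of i] by (simp add: vec_eq_iff)
  then show ?case using assms(1) by simp
next
  case (Suc N)
  have "\<exists>k. 0 < i $ k"
  proof (rule ccontr)
    assume "\<not> (\<exists>k. 0 < i $ k)"
    then have "i = 0" by (simp add: vec_eq_iff)
    with Suc(2) show False by simp
  qed
  then obtain k where k: "0 < i $ k" by blast
  have "msize (i - unit_index k + unit_index k) = Suc N"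
    using Suc(2) by (simp only: multi_index_minus_unit[OF k])
  then have "P (i - unit_index k)" by (intro Suc(1)) simp
  then show ?case using assms(2) multi_index_minus_unit[OF k] by metis
qed

lemma mono_pow_0 [simp]: "mono_pow s 0 = 1"
  by (simp add: mono_pow_def)

lemma mono_pow_add: "mono_pow s (i + j) = mono_pow s i * mono_pow s j"
  by (simp add: mono_pow_def power_add prod.distrib)

lemma mono_pow_unit [simp]: "mono_pow s (axis k (Suc 0)) = s $ k"
proof -
  have "mono_pow s (axis k (Suc 0)) = (\<Prod>l\<in>UNIV. if l = k then s $ l else 1)"
    unfolding mono_pow_def by (intro prod.cong) auto
  then show ?thesis by simp
qed

lemma mono_pow_at_0: "mono_pow 0 j = (if j = 0 then 1 else 0)"
proof (induction j rule: multi_index_induct)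
  case (add_unit i k)
  have "i + unit_index k \<noteq> 0" by (auto simp: vec_eq_iff intro!: exI[of _ k])
  then show ?case by (simp add: mono_pow_add)
qed simp

lemma mono_pow_unit_cube:
  assumes "s \<in> unit_cube"
  shows "\<bar>mono_pow s j\<bar> \<le> 1"
proof -
  have "\<bar>s $ k\<bar> \<le> 1" for k
  proof -
    have "-1 \<le> s $ k \<and> s $ k \<le> 1" using assms by (simp add: unit_cube_def)
    then show ?thesis by linarith
  qed
  then have "(\<Prod>k\<in>UNIV. \<bar>s $ k\<bar> ^ (j $ k)) \<le> 1"
    by (intro prod_le_1) (simp add: power_le_one)
  then show ?thesis by (simp add: mono_pow_def abs_prod power_abs)
qed

lemma corner_box_mono:
  assumes "\<rho> \<le> \<rho>'"
  shows "corner_box \<rho> \<subseteq> corner_box \<rho>'"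
proof
  fix s :: "real ^ 'n" assume s: "s \<in> corner_box \<rho>"
  have "0 \<le> s $ k \<and> s $ k \<le> \<rho>'" for k
  proof -
    have "0 \<le> s $ k \<and> s $ k \<le> \<rho>" using s by (simp add: corner_box_def)
    with assms show ?thesis by linarith
  qed
  then show "s \<in> corner_box \<rho>'" by (simp add: corner_box_def)
qed

lemma corner_box_subset_unit_cube:
  assumes "\<rho> \<le> 1"
  shows "corner_box \<rho> \<subseteq> unit_cube"
proof -
  have "corner_box 1 \<subseteq> unit_cube"
  proof
    fix s :: "real ^ 'n" assume s: "s \<in> corner_box 1"
    have "-1 \<le> s $ k \<and> s $ k \<le> 1" for k
    proof -
      have "0 \<le> s $ k \<and> s $ k \<le> 1" using s by (simp add: corner_box_def)
      then show ?thesis by linarith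
    qed
    then show "s \<in> unit_cube" by (simp add: unit_cube_def)
  qed
  with corner_box_mono[OF assms] show ?thesis by blast
qed

lemma mono_pow_corner_box:
  assumes "s \<in> corner_box \<rho>"
  shows "0 \<le> mono_pow s j" "mono_pow s j \<le> \<rho> ^ msize j"
proof -
  have s: "0 \<le> s $ k" "s $ k \<le> \<rho>" for k using assms by (auto simp: corner_box_def)
  show "0 \<le> mono_pow s j" unfolding mono_pow_def using s by (intro prod_nonneg) auto
  show "mono_pow s j \<le> \<rho> ^ msize j"
    unfolding mono_pow_def msize_def power_sum using s by (intro prod_mono) (auto intro: power_mono)
qed

text \<open>The constant does not depend on the degree: multiplying by one more coordinate turns a
  bound \<open>L\<close> into \<open>\<delta> + \<rho> * L\<close>, and
  \<open>\<delta> / (1 - \<rho>)\<close> is the fixed point of this recursion.\<close>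

lemma mono_pow_Lipschitz:
  assumes x: "x \<in> corner_box \<rho>" and y: "y \<in> corner_box \<rho>" and \<rho>: "\<rho> < 1"
    and d: "\<And>k. \<bar>x $ k - y $ k\<bar> \<le> \<delta>"
  shows "\<bar>mono_pow x j - mono_pow y j\<bar> \<le> \<delta> / (1 - \<rho>)"
proof (induction j rule: multi_index_induct)
  case zero
  have "0 \<le> \<delta>" using d[of undefined] by linarith
  then show ?case using \<rho> by simp
next
  case (add_unit j k)
  have x1: "\<bar>mono_pow x j\<bar> \<le> 1"
    using x \<rho> corner_box_subset_unit_cube[of \<rho>] by (intro mono_pow_unit_cube) auto
  have yk: "\<bar>y $ k\<bar> \<le> \<rho>" using y by (simp add: corner_box_def)
  have "mono_pow x (j + unit_index k) - mono_pow y (j + unit_index k)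
      = mono_pow x j * (x $ k - y $ k) + (mono_pow x j - mono_pow y j) * y $ k"
    by (simp add: mono_pow_add algebra_simps)
  also have "\<bar>\<dots>\<bar> \<le> \<bar>mono_pow x j\<bar> * \<bar>x $ k - y $ k\<bar> + \<bar>mono_pow x j - mono_pow y j\<bar> * \<bar>y $ k\<bar>"
    by (simp add: abs_mult[symmetric] abs_triangle_ineq)
  also have "\<dots> \<le> 1 * \<delta> + \<delta> / (1 - \<rho>) * \<rho>"
    by (intro add_mono mult_mono add_unit x1 d yk) (use d[of k] \<rho> in auto)
  also have "\<dots> = \<delta> / (1 - \<rho>)" using \<rho> by (simp add: field_simps)
  finally show ?case .
qed

lemma power_less_eventually:
  fixes \<rho> \<epsilon> :: real
  assumes "0 \<le> \<rho>" "\<rho> < 1" "0 < \<epsilon>"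
  obtains N where "\<And>m. N \<le> m \<Longrightarrow> \<rho> ^ m \<le> \<epsilon>"
proof -
  obtain N where N: "\<rho> ^ N < \<epsilon>" using real_arch_pow_inv[OF assms(3,2)] by blast
  show thesis
  proof
    fix m assume "N \<le> m"
    then have "\<rho> ^ m \<le> \<rho> ^ N" using assms by (intro power_decreasing) auto
    with N show "\<rho> ^ m \<le> \<epsilon>" by linarith
  qed
qed

lemma vanishes_at_infinity_power:
  fixes sz :: "'a \<Rightarrow> nat"
  assumes "0 \<le> \<rho>" "\<rho> < 1" and fin: "\<And>N. finite {x. sz x \<le> N}"
  shows "vanishes_at_infinity (\<lambda>x. \<rho> ^ sz x)"
  unfolding vanishes_at_infinity_def
proof (intro allI impI)
  fix \<epsilon> :: real assume "0 < \<epsilon>"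
  then obtain N where N: "\<And>m. N \<le> m \<Longrightarrow> \<rho> ^ m \<le> \<epsilon>" using power_less_eventually assms by metis
  have "sz x \<le> N" if "\<epsilon> < \<bar>\<rho> ^ sz x\<bar>" for x
    using N[of "sz x"] that assms(1) by (cases "sz x \<le> N") auto
  then have "{x. \<epsilon> < \<bar>\<rho> ^ sz x\<bar>} \<subseteq> {x. sz x \<le> N}" by auto
  then show "finite {x. \<epsilon> < \<bar>\<rho> ^ sz x\<bar>}" using fin by (rule finite_subset)
qed

section \<open>Recovering coefficients from values near the origin\<close>

text \<open>By unique factorization a multi-index becomes a single natural number, which orders the
  monomials linearly with finitely many below each.\<close>

lemma prime_weights:
  obtains N :: "nat ^ 'n::finite \<Rightarrow> nat" and p :: "'n \<Rightarrow> nat"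
  where "inj N" "\<And>j. 1 \<le> N j" "\<And>k. 2 \<le> p k" "\<And>j. N j = (\<Prod>k\<in>UNIV. p k ^ (j $ k))"
proof -
  obtain B :: "nat set" where B: "B \<subseteq> {q. prime q}" "finite B" "card B = CARD('n)"
    using infinite_arbitrarily_large[OF primes_infinite] by blast
  obtain p :: "'n \<Rightarrow> nat" where "bij_betw p UNIV B"
    using finite_same_card_bij[of "UNIV :: 'n set" B] B by auto
  then have p: "inj p" "range p \<subseteq> {q. prime q}" using B(1) by (auto simp: bij_betw_def)
  have pr: "prime (p k)" for k using p by auto
  define N where "N = (\<lambda>j :: nat ^ 'n. \<Prod>k\<in>UNIV. p k ^ (j $ k))"
  have "inj N"
  proof (rule injI)
    fix i j assume eq: "N i = N j"
    have mult: "multiplicity (p k) (N j) = j $ k" for j k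
    proof -
      have "N j = (\<Prod>q\<in>range p. q ^ (j $ inv p q))"
        unfolding N_def using p by (subst prod.reindex) (auto simp: inv_f_f)
      moreover have "multiplicity (p k) (\<Prod>q\<in>range p. q ^ (j $ inv p q)) = (if p k \<in> range p then j $ inv p (p k) else 0)"
        by (rule multiplicity_prod_prime_powers) (use pr in auto)
      ultimately show ?thesis using p by (simp add: inv_f_f)
    qed
    then show "i = j" using eq by (metis vec_eq_iff)
  qed
  moreover have "1 \<le> N j" for j
    unfolding N_def using prime_gt_0_nat[OF pr] by (simp add: Suc_le_eq prod_pos)
  ultimately show thesis using that[of N p] prime_ge_2_nat[OF pr] by (simp add: N_def)
qed

text \<open>On the points \<open>s$k = p k powr - m\<close>, for distinct primes \<open>p k\<close>, a power series becomes a Dirichlet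
  series in \<open>m\<close>; its coefficients are peeled off in the order of their frequencies.\<close>

lemma coefficient_bound:
  fixes i :: "nat ^ 'n::finite"
  assumes "0 < \<epsilon>"
  shows "\<exists>K\<ge>0. \<forall>c M. c summable_on UNIV \<longrightarrow>
    (\<forall>s\<in>corner_box (1 / 2). \<bar>\<Sum>\<^sub>\<infinity>j. c j * mono_pow s j\<bar> \<le> M) \<longrightarrow>
    \<bar>c i\<bar> \<le> K * M + \<epsilon> * (\<Sum>\<^sub>\<infinity>j. \<bar>c j\<bar>)"
proof -
  obtain N :: "nat ^ 'n \<Rightarrow> nat" and p where N: "inj N" "\<And>j. 1 \<le> N j" "\<And>k. 2 \<le> p k"
    "\<And>j. N j = (\<Prod>k\<in>UNIV. p k ^ (j $ k))" using prime_weights by blast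
  let ?A = "\<lambda>c M. c summable_on UNIV \<and> (\<forall>s\<in>corner_box (1 / 2). \<bar>\<Sum>\<^sub>\<infinity>j. c j * mono_pow s j\<bar> \<le> M)"
  \<comment> \<open>The error \<open>\<epsilon>\<close> is quantified inside the induction because
    coefficients of smaller frequency are needed with a much smaller error.\<close>
  have "\<forall>\<epsilon>>0. \<exists>K\<ge>0. \<forall>c M. ?A c M \<longrightarrow> \<bar>c i\<bar> \<le> K * M + \<epsilon> * (\<Sum>\<^sub>\<infinity>j. \<bar>c j\<bar>)"
  proof (induction "N i" arbitrary: i rule: less_induct)
    case less
    show ?case
    proof (intro allI impI)
      fix \<epsilon> :: real assume e: "0 < \<epsilon>"
      define L where "L = {l. N l < N i}"
      have L: "finite L" unfolding L_def using finite_vimageI[OF finite_lessThan N(1)] by (simp add: vimage_def)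
      have Ni: "0 < real (N i)" using N(2)[of i] by simp
      have "real (N i) / (real (N i) + 1) < 1" "0 \<le> real (N i) / (real (N i) + 1)" using Ni by simp_all
      then obtain m0 where m0: "\<And>m. m0 \<le> m \<Longrightarrow> (real (N i) / (real (N i) + 1)) ^ m \<le> \<epsilon> / 2"
        using power_less_eventually[of "real (N i) / (real (N i) + 1)" "\<epsilon> / 2"] e by auto
      \<comment> \<open>At least 1, so that the point \<open>s\<close> lies in the box; at least
        \<open>m0\<close>, so that the larger frequencies, after multiplication by \<open>W\<close>,
        contribute at most \<open>\<epsilon> / 2\<close> times the total.\<close>
      define m where "m = Suc m0"
      define W where "W = real (N i) ^ m"
      have W: "0 < W" using Ni by (simp add: W_def)
      \<comment> \<open>Solving for \<open>c i\<close> multiplies by \<open>W\<close>, and with it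
        the errors of the \<open>card L\<close> coefficients of smaller frequency; together these
        stay below the other \<open>\<epsilon> / 2\<close>.\<close>
      define \<delta> where "\<delta> = \<epsilon> / (2 * W * (card L + 1))"
      have \<delta>: "0 < \<delta>" "W * card L * \<delta> \<le> \<epsilon> / 2"
      proof -
        show "0 < \<delta>" unfolding \<delta>_def using e W by (intro divide_pos_pos mult_pos_pos) auto
        have "W * card L * \<delta> = \<epsilon> / 2 * (card L / (card L + 1))" using W by (simp add: \<delta>_def)
        also have "\<dots> \<le> \<epsilon> / 2 * 1" using e by (intro mult_left_mono) auto
        finally show "W * card L * \<delta> \<le> \<epsilon> / 2" by simp
      qed
      have "\<forall>l\<in>L. \<exists>K\<ge>0. \<forall>c M. ?A c M \<longrightarrow> \<bar>c l\<bar> \<le> K * M + \<delta> * (\<Sum>\<^sub>\<infinity>j. \<bar>c j\<bar>)"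
        using less \<delta>(1) by (auto simp: L_def)
      from bchoice[OF this] obtain K where
        K': "\<forall>l\<in>L. 0 \<le> K l \<and> (\<forall>c M. ?A c M \<longrightarrow> \<bar>c l\<bar> \<le> K l * M + \<delta> * (\<Sum>\<^sub>\<infinity>j. \<bar>c j\<bar>))" by blast
      have K: "0 \<le> K l" "\<And>c M. ?A c M \<Longrightarrow> \<bar>c l\<bar> \<le> K l * M + \<delta> * (\<Sum>\<^sub>\<infinity>j. \<bar>c j\<bar>)" if "l \<in> L" for l
        using bspec[OF K' that] by blast+
      define s :: "real ^ 'n" where "s = (\<chi> k. (1 / real (p k)) ^ m)"
      have s: "s \<in> corner_box (1 / 2)"
      proof -
        have "(1 / real (p k)) ^ m \<le> (1 / 2) ^ 1" for k
        proof -
          have "(1 / real (p k)) ^ m \<le> (1 / 2) ^ m" using N(3)[of k] by (intro power_mono) (auto simp: field_simps)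
          also have "\<dots> \<le> (1 / 2) ^ 1" by (intro power_decreasing) (auto simp: m_def)
          finally show ?thesis .
        qed
        then show ?thesis by (simp add: s_def corner_box_def)
      qed
      have sj: "mono_pow s j = (1 / real (N j)) ^ m" for j
      proof -
        have "mono_pow s j = (\<Prod>k\<in>UNIV. ((1 / real (p k)) ^ (j $ k)) ^ m)"
          unfolding mono_pow_def s_def by (simp add: mult.commute flip: power_mult)
        also have "\<dots> = (\<Prod>k\<in>UNIV. (1 / real (p k)) ^ (j $ k)) ^ m" by (rule prod_power_distrib[symmetric])
        also have "(\<Prod>k\<in>UNIV. (1 / real (p k)) ^ (j $ k)) = 1 / real (N j)"
          by (simp add: N(4) power_divide prod_dividef)
        finally show ?thesis .
      qed
      have "\<bar>c i\<bar> \<le> W * (1 + (\<Sum>l\<in>L. K l)) * M + \<epsilon> * (\<Sum>\<^sub>\<infinity>j. \<bar>c j\<bar>)" if A: "?A c M" for c M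
      proof -
        let ?S = "\<Sum>\<^sub>\<infinity>j. \<bar>c j\<bar>" and ?B = "- insert i L"
        have c: "c summable_on UNIV" using A by blast
        have cB: "c summable_on ?B" using c by (rule summable_on_subset_banach) simp
        have S0: "0 \<le> ?S" by (rule infsum_nonneg) simp
        have cs: "(\<lambda>j. c j * mono_pow s j) summable_on X" for X
          by (rule summable_on_subset_banach[of _ UNIV], rule summable_mult_bounded[OF c, of _ 1])
             (use s mono_pow_unit_cube corner_box_subset_unit_cube[of "1/2"] in auto)
        have "(\<Sum>\<^sub>\<infinity>j. c j * mono_pow s j) = (\<Sum>\<^sub>\<infinity>j\<in>insert i L \<union> ?B. c j * mono_pow s j)" by simp
        also have "\<dots> = (\<Sum>j\<in>insert i L. c j * mono_pow s j) + (\<Sum>\<^sub>\<infinity>j\<in>?B. c j * mono_pow s j)"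
          using L by (subst infsum_Un_disjoint) (auto intro: cs simp del: infsum_finite simp: infsum_finite[symmetric])
        also have "(\<Sum>j\<in>insert i L. c j * mono_pow s j) = c i / W + (\<Sum>j\<in>L. c j * mono_pow s j)"
          using L by (subst sum.insert) (auto simp: L_def sj W_def power_divide)
        finally have "c i / W = (\<Sum>\<^sub>\<infinity>j. c j * mono_pow s j) - (\<Sum>j\<in>L. c j * mono_pow s j)
            - (\<Sum>\<^sub>\<infinity>j\<in>?B. c j * mono_pow s j)" by simp
        moreover have "\<bar>\<Sum>\<^sub>\<infinity>j. c j * mono_pow s j\<bar> \<le> M" using A s by blast
        moreover have "\<bar>\<Sum>j\<in>L. c j * mono_pow s j\<bar> \<le> (\<Sum>l\<in>L. K l * M + \<delta> * ?S)"
        proof (rule order_trans[OF sum_abs], rule sum_mono)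
          fix l assume l: "l \<in> L"
          have "\<bar>c l * mono_pow s l\<bar> \<le> \<bar>c l\<bar> * 1"
            unfolding abs_mult using s mono_pow_unit_cube corner_box_subset_unit_cube[of "1/2"]
            by (intro mult_left_mono) auto
          then show "\<bar>c l * mono_pow s l\<bar> \<le> K l * M + \<delta> * ?S" using K(2)[OF l A] by simp
        qed
        moreover have "\<bar>\<Sum>\<^sub>\<infinity>j\<in>?B. c j * mono_pow s j\<bar> \<le> ?S * (1 / (real (N i) + 1)) ^ m"
        proof -
          have "\<bar>mono_pow s j\<bar> \<le> (1 / (real (N i) + 1)) ^ m" if "j \<in> ?B" for j
          proof -
            have "N j \<noteq> N i" "\<not> N j < N i" using that N(1) by (auto simp: L_def dest: injD)
            then have "real (N i) + 1 \<le> real (N j)" by linarith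
            then show ?thesis unfolding sj using Ni by (auto simp: power_abs intro!: power_mono divide_left_mono)
          qed
          then have "\<bar>\<Sum>\<^sub>\<infinity>j\<in>?B. c j * mono_pow s j\<bar> \<le> (\<Sum>\<^sub>\<infinity>j\<in>?B. \<bar>c j\<bar>) * (1 / (real (N i) + 1)) ^ m"
            by (rule abs_infsum_mult_le[OF cB])
          also have "\<dots> \<le> ?S * (1 / (real (N i) + 1)) ^ m"
            using summable_abs_real[OF c] summable_abs_real[OF cB]
            by (intro mult_right_mono infsum_mono2) auto
          finally show ?thesis .
        qed
        ultimately have "\<bar>c i / W\<bar> \<le> M + (\<Sum>l\<in>L. K l * M + \<delta> * ?S) + ?S * (1 / (real (N i) + 1)) ^ m"
          by linarith
        then have "W * \<bar>c i / W\<bar> \<le> W * (M + (\<Sum>l\<in>L. K l * M + \<delta> * ?S) + ?S * (1 / (real (N i) + 1)) ^ m)"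
          using W by (intro mult_left_mono) auto
        also have "W * \<bar>c i / W\<bar> = \<bar>c i\<bar>" using W by simp
        also have "(\<Sum>l\<in>L. K l * M + \<delta> * ?S) = (\<Sum>l\<in>L. K l) * M + card L * \<delta> * ?S"
          by (simp add: sum.distrib sum_distrib_right)
        also have "W * (M + ((\<Sum>l\<in>L. K l) * M + card L * \<delta> * ?S) + ?S * (1 / (real (N i) + 1)) ^ m)
            = W * (1 + (\<Sum>l\<in>L. K l)) * M + (W * card L * \<delta>) * ?S + (real (N i) / (real (N i) + 1)) ^ m * ?S"
          by (simp add: algebra_simps W_def power_divide)
        also have "\<dots> \<le> W * (1 + (\<Sum>l\<in>L. K l)) * M + \<epsilon> / 2 * ?S + \<epsilon> / 2 * ?S"
          by (intro order_refl add_mono mult_right_mono \<delta> m0 S0) (auto simp: m_def)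
        finally show ?thesis by simp
      qed
      moreover have "0 \<le> W * (1 + (\<Sum>l\<in>L. K l))" using W K(1) by (simp add: sum_nonneg add_nonneg_nonneg)
      ultimately show "\<exists>K\<ge>0. \<forall>c M. ?A c M \<longrightarrow> \<bar>c i\<bar> \<le> K * M + \<epsilon> * (\<Sum>\<^sub>\<infinity>j. \<bar>c j\<bar>)" by blast
    qed
  qed
  from this[rule_format, OF assms] show ?thesis by (simp only: conj_imp_eq_imp_imp imp_conjL)
qed

text \<open>The difference of the two series has sup bound \<open>M = 0\<close>, so
  \<open>coefficient_bound\<close> leaves only an arbitrarily small multiple of the total
  mass.\<close>

lemma power_series_eqD:
  fixes c d :: "nat ^ 'n::finite \<Rightarrow> real"
  assumes c: "c summable_on UNIV" and d: "d summable_on UNIV"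
    and eq: "\<And>s. s \<in> corner_box (1 / 2) \<Longrightarrow> (\<Sum>\<^sub>\<infinity>j. c j * mono_pow s j) = (\<Sum>\<^sub>\<infinity>j. d j * mono_pow s j)"
  shows "c = d"
proof
  fix i
  let ?c = "\<lambda>j. c j - d j" and ?S = "\<Sum>\<^sub>\<infinity>j. \<bar>c j - d j\<bar>"
  have s: "?c summable_on UNIV" using c d by (rule summable_on_diff_real)
  have 0: "(\<Sum>\<^sub>\<infinity>j. ?c j * mono_pow s j) = 0" if "s \<in> corner_box (1 / 2)" for s
  proof -
    have "(\<lambda>j. e j * mono_pow s j) summable_on UNIV" if "e summable_on UNIV" for e
      by (rule summable_mult_bounded[OF that, of _ 1])
         (use \<open>s \<in> corner_box (1 / 2)\<close> mono_pow_unit_cube corner_box_subset_unit_cube[of "1/2"] in auto)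
    then show ?thesis using eq[OF that] c d by (simp add: left_diff_distrib infsum_diff_real)
  qed
  have S: "0 \<le> ?S" by (rule infsum_nonneg) simp
  have "\<bar>c i - d i\<bar> \<le> 0 + \<epsilon>" if "0 < \<epsilon>" for \<epsilon>
  proof -
    have "0 < \<epsilon> / (?S + 1)" using that S by simp
    from coefficient_bound[OF this, of i] obtain K where
      K: "\<And>c M. c summable_on UNIV \<Longrightarrow> (\<forall>s\<in>corner_box (1 / 2). \<bar>\<Sum>\<^sub>\<infinity>j. c j * mono_pow s j\<bar> \<le> M) \<Longrightarrow>
        \<bar>c i\<bar> \<le> K * M + \<epsilon> / (?S + 1) * (\<Sum>\<^sub>\<infinity>j. \<bar>c j\<bar>)" by blast
    have "\<bar>c i - d i\<bar> \<le> K * 0 + \<epsilon> / (?S + 1) * ?S" by (rule K[OF s]) (simp add: 0)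
    also have "\<dots> \<le> \<epsilon>" using that S by (simp add: field_simps)
    finally show ?thesis by simp
  qed
  then have "\<bar>c i - d i\<bar> \<le> 0" by (rule field_le_epsilon)
  then show "c i = d i" by simp
qed

section \<open>Absolutely convergent power series on the cube\<close>

text \<open>Carries identities from \<open>corner_box (1 / 2)\<close>, where they are proved, to the
  whole cube. Summability of the coefficients themselves gives convergence up to the
  boundary.\<close>

definition cube_series :: "(real ^ 'n::finite \<Rightarrow> real) \<Rightarrow> bool" where
  "cube_series f \<longleftrightarrow> (\<exists>c. c summable_on UNIV \<and> (\<forall>s\<in>unit_cube. f s = (\<Sum>\<^sub>\<infinity>j. c j * mono_pow s j)))"

lemma cube_series_eq:
  assumes "cube_series f" "cube_series g" "\<And>s. s \<in> corner_box (1 / 2) \<Longrightarrow> f s = g s" "s \<in> unit_cube"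
  shows "f s = g s"
proof -
  obtain c where c: "c summable_on UNIV" "\<forall>s\<in>unit_cube. f s = (\<Sum>\<^sub>\<infinity>j. c j * mono_pow s j)"
    using assms(1) by (auto simp: cube_series_def)
  obtain d where d: "d summable_on UNIV" "\<forall>s\<in>unit_cube. g s = (\<Sum>\<^sub>\<infinity>j. d j * mono_pow s j)"
    using assms(2) by (auto simp: cube_series_def)
  have "c = d"
    by (rule power_series_eqD[OF c(1) d(1)]) (use assms(3) c(2) d(2) corner_box_subset_unit_cube[of "1/2"] in force)
  with c d assms(4) show ?thesis by simp
qed

lemma cube_series_1: "cube_series (\<lambda>_. 1)"
proof -
  have "(\<Sum>\<^sub>\<infinity>j. (if j = 0 then 1 else 0) * mono_pow s j) = 1" for s :: "real ^ 'n"
    by (simp add: if_distrib[of "\<lambda>x. x * _"] cong: if_cong)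
  then show ?thesis unfolding cube_series_def
    by (intro exI[of _ "\<lambda>j. if j = 0 then 1 else 0"]) auto
qed

lemma summable_on_product_real:
  fixes a :: "'a \<Rightarrow> real" and b :: "'b \<Rightarrow> real"
  assumes "a summable_on UNIV" "b summable_on UNIV"
  shows "(\<lambda>(j, k). a j * b k) summable_on UNIV \<times> UNIV"
proof (rule abs_summable_summable)
  have "(\<lambda>(j, k). \<bar>a j\<bar> * \<bar>b k\<bar>) summable_on UNIV \<times> UNIV"
  proof (rule summable_on_SigmaI)
    show "((\<lambda>k. case (j, k) of (j, k) \<Rightarrow> \<bar>a j\<bar> * \<bar>b k\<bar>) has_sum \<bar>a j\<bar> * (\<Sum>\<^sub>\<infinity>k. \<bar>b k\<bar>)) UNIV" for j
      using summable_abs_real[OF assms(2)] by (auto intro!: has_sum_cmult_right)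
    show "(\<lambda>j. \<bar>a j\<bar> * (\<Sum>\<^sub>\<infinity>k. \<bar>b k\<bar>)) summable_on UNIV"
      using summable_abs_real[OF assms(1)] by (rule summable_on_cmult_left)
  qed auto
  then show "(\<lambda>x. norm (case x of (j, k) \<Rightarrow> a j * b k)) summable_on UNIV \<times> UNIV"
    by (simp add: split_def abs_mult)
qed

text \<open>The Cauchy product: the double sum over pairs \<open>(j, k)\<close> is regrouped by the
  value of \<open>j + k\<close>.\<close>

lemma cube_series_mult:
  fixes f g :: "real ^ 'n::finite \<Rightarrow> real"
  assumes "cube_series f" "cube_series g"
  shows "cube_series (\<lambda>s. f s * g s)"
proof -
  obtain c where c: "c summable_on UNIV" "\<forall>s\<in>unit_cube. f s = (\<Sum>\<^sub>\<infinity>j. c j * mono_pow s j)"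
    using assms(1) by (auto simp: cube_series_def)
  obtain d where d: "d summable_on UNIV" "\<forall>s\<in>unit_cube. g s = (\<Sum>\<^sub>\<infinity>j. d j * mono_pow s j)"
    using assms(2) by (auto simp: cube_series_def)
  define B where "B = (\<lambda>l :: nat ^ 'n. {p. fst p + snd p = l})"
  define e where "e = (\<lambda>l. \<Sum>\<^sub>\<infinity>p\<in>B l. c (fst p) * d (snd p))"
  have bij: "bij_betw snd (Sigma UNIV B) UNIV"
    by (rule bij_betwI[where g = "\<lambda>p. (fst p + snd p, p)"]) (auto simp: B_def)
  have main: "((\<lambda>l. e l * mono_pow s l) has_sum (f s * g s)) UNIV" if s: "s \<in> unit_cube" for s
  proof -
    let ?h = "\<lambda>(j, k). (c j * mono_pow s j) * (d k * mono_pow s k)"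
    have summ: "(\<lambda>j. a j * mono_pow s j) summable_on UNIV" if "a summable_on UNIV" for a
      by (rule summable_mult_bounded[OF that, of _ 1]) (rule mono_pow_unit_cube[OF s])
    have "?h summable_on UNIV \<times> UNIV"
      by (rule summable_on_product_real; rule summ) (rule c d)+
    moreover have "infsum ?h (UNIV \<times> UNIV) = f s * g s"
    proof -
      have "infsum ?h (UNIV \<times> UNIV) = (\<Sum>\<^sub>\<infinity>j. \<Sum>\<^sub>\<infinity>k. (c j * mono_pow s j) * (d k * mono_pow s k))"
        using infsum_Sigma'_banach[OF \<open>?h summable_on UNIV \<times> UNIV\<close>] by simp
      also have "\<dots> = f s * g s"
        using c d s by (simp add: infsum_cmult_right' infsum_cmult_left')
      finally show ?thesis .
    qed
    ultimately have "(?h has_sum (f s * g s)) UNIV" by (simp add: has_sum_iff)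
    then have hs: "((\<lambda>x. ?h (snd x)) has_sum (f s * g s)) (Sigma UNIV B)"
      using has_sum_reindex_bij_betw[OF bij, of ?h "f s * g s"] by simp
    have hB: "((\<lambda>p. ?h p) has_sum e l * mono_pow s l) (B l)" for l
    proof -
      have "(\<lambda>p. ?h p) summable_on B l"
        using \<open>(?h has_sum (f s * g s)) UNIV\<close> by (meson has_sum_imp_summable summable_on_subset_banach subset_UNIV)
      moreover have "infsum ?h (B l) = (\<Sum>\<^sub>\<infinity>p\<in>B l. (c (fst p) * d (snd p)) * mono_pow s l)"
        by (rule infsum_cong) (auto simp: B_def mono_pow_add)
      ultimately show ?thesis by (simp add: has_sum_iff e_def infsum_cmult_left')
    qed
    show ?thesis by (rule has_sum_SigmaD[OF hs]) (use hB in simp)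
  qed
  have "e summable_on UNIV"
  proof -
    \<comment> \<open>At the point with all coordinates 1 every monomial is 1, so convergence there
      is summability of the new coefficients.\<close>
    have "(\<chi> k. 1) \<in> (unit_cube :: (real ^ 'n) set)" by (simp add: unit_cube_def)
    from main[OF this] have "((\<lambda>l. e l * mono_pow (\<chi> k. 1) l) summable_on UNIV)" by (rule has_sum_imp_summable)
    then show ?thesis by (simp add: mono_pow_def)
  qed
  with main show ?thesis unfolding cube_series_def by (intro exI[of _ e]) (auto simp: infsumI[symmetric])
qed

lemma cube_series_power: "cube_series f \<Longrightarrow> cube_series (\<lambda>s. f s ^ m)"
  by (induction m) (simp_all add: cube_series_1 cube_series_mult)

lemma cube_series_prod:
  assumes "finite A" "\<And>k. k \<in> A \<Longrightarrow> cube_series (f k)"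
  shows "cube_series (\<lambda>s. \<Prod>k\<in>A. f k s)"
  using assms by (induction rule: finite_induct) (simp_all add: cube_series_1 cube_series_mult)

section \<open>Backward equation and maximum principle\<close>

lemma at_left_eq_filtermap: "at_left t = filtermap (\<lambda>h. t - h) (at_right (0 :: real))"
proof -
  have "at_left t = filtermap uminus (at_right (- t))" by (rule at_left_minus)
  also have "at_right (- t) = filtermap (\<lambda>x. x + - t) (at_right 0)" by (rule at_right_to_0)
  finally show ?thesis by (simp add: filtermap_filtermap)
qed

text \<open>Without domination by \<open>g\<close>, this fails when \<open>P\<close> lets mass escape to infinity at a positive rate.\<close>

lemma Q_function_apply_tendsto:
  assumes PQ: "Q_function Q P" and g: "vanishes_at_infinity g"
    and fg: "\<forall>\<^sub>F h in at_right 0. \<forall>k. \<bar>f h k\<bar> \<le> g k" and f0g: "\<And>k. \<bar>f0 k\<bar> \<le> g k"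
    and lim: "\<And>k. ((\<lambda>h. f h k) \<longlongrightarrow> f0 k) (at_right 0)"
  shows "((\<lambda>h. ((\<Sum>\<^sub>\<infinity>k. P h i k * f h k) - f h i) / h) \<longlongrightarrow> (\<Sum>\<^sub>\<infinity>k. Q i k * f0 k)) (at_right 0)"
proof -
  note P = Q_function_transition[OF PQ]
  obtain G where G: "\<And>k. \<bar>g k\<bar> \<le> G" using vanishes_at_infinity_bounded[OF g] by blast
  let ?d = "\<lambda>h k. (P h i k - id_kernel i k) / h"
  note ev = eventually_at_right_less[of "0 :: real"]
  have "((\<lambda>h. \<Sum>\<^sub>\<infinity>k. ?d h k * f h k) \<longlongrightarrow> (\<Sum>\<^sub>\<infinity>k. Q i k * f0 k)) (at_right 0)"
  proof (rule tendsto_infsum_mult_vanishing[OF Q_function_tendsto[OF PQ] q_matrixD(2)[OF Q_function_q_matrix[OF PQ]]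
        _ _ lim g fg f0g])
    show "\<forall>\<^sub>F h in at_right 0. ?d h summable_on UNIV"
      using ev
    proof eventually_elim
      case (elim h)
      then have "(\<lambda>k. (P h i k - id_kernel i k) * inverse h) summable_on UNIV"
        by (intro summable_on_cmult_left transition_increment_row P) auto
      then show ?case by (simp add: divide_inverse)
    qed
    have "((\<lambda>h. -2 * ?d h i) \<longlongrightarrow> -2 * Q i i) (at_right 0)"
      by (intro tendsto_intros Q_function_tendsto[OF PQ])
    then have "\<forall>\<^sub>F h in at_right 0. -2 * ?d h i < -2 * Q i i + 1" by (rule order_tendstoD) simp
    then show "\<forall>\<^sub>F h in at_right 0. \<forall>B. finite B \<longrightarrow> (\<Sum>k\<in>B. \<bar>?d h k\<bar>) \<le> -2 * Q i i + 1"
      using ev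
    proof eventually_elim
      case (elim h)
      show ?case
      proof (intro allI impI)
        fix B :: "'a set" assume B: "finite B"
        have "(\<Sum>k\<in>B. \<bar>P h i k - id_kernel i k\<bar>) \<le> (\<Sum>\<^sub>\<infinity>k. \<bar>P h i k - id_kernel i k\<bar>)"
          using elim by (intro finite_sum_le_infsum summable_abs_real transition_increment_row P B) auto
        also have "\<dots> \<le> 2 * (1 - P h i i)" using elim by (intro transition_increment_row P) auto
        finally have "(\<Sum>k\<in>B. \<bar>P h i k - id_kernel i k\<bar>) / h \<le> 2 * (1 - P h i i) / h"
          using elim by (intro divide_right_mono) auto
        also have "\<dots> = -2 * ?d h i" by (simp add: id_kernel_def field_simps)
        also have "\<dots> \<le> -2 * Q i i + 1" using elim by simp
        finally show "(\<Sum>k\<in>B. \<bar>?d h k\<bar>) \<le> -2 * Q i i + 1"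
          using elim by (simp add: sum_divide_distrib abs_divide)
      qed
    qed
  qed
  moreover have "\<forall>\<^sub>F h in at_right 0. (\<Sum>\<^sub>\<infinity>k. ?d h k * f h k) = ((\<Sum>\<^sub>\<infinity>k. P h i k * f h k) - f h i) / h"
    using ev fg
  proof eventually_elim
    case (elim h)
    have fG: "\<bar>f h k\<bar> \<le> G" for k using elim(2) G[of k] by (meson abs_ge_self order_trans)
    have "(\<Sum>\<^sub>\<infinity>k. ?d h k * f h k) = (\<Sum>\<^sub>\<infinity>k. (P h i k - id_kernel i k) * f h k) / h"
      by (simp add: divide_inverse mult_ac infsum_cmult_left' infsum_cmult_right')
    also have "(\<Sum>\<^sub>\<infinity>k. (P h i k - id_kernel i k) * f h k) = (\<Sum>\<^sub>\<infinity>k. P h i k * f h k) - f h i"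
      using transition_apply_increment(1)[OF P, of h "f h" G i] fG elim by simp
    finally show ?case .
  qed
  ultimately show ?thesis by (rule Lim_transform_eventually)
qed

text \<open>Writing \<open>f t\<close> as \<open>P h\<close> applied to \<open>f (t - h)\<close>
  turns the left difference quotient into the quotient of \<open>Q_function_apply_tendsto\<close>,
  taken along the moving function \<open>f (t - h)\<close>. A left derivative is all that the
  maximum principle uses.\<close>

lemma backward_left_derivative:
  assumes PQ: "Q_function Q P" and t: "0 < t"
    and sg: "\<And>h. 0 < h \<Longrightarrow> h \<le> t \<Longrightarrow> f t i = (\<Sum>\<^sub>\<infinity>k. P h i k * f (t - h) k)"
    and g: "vanishes_at_infinity g" and fg: "\<And>u k. 0 \<le> u \<Longrightarrow> u \<le> t \<Longrightarrow> \<bar>f u k\<bar> \<le> g k"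
    and cont: "\<And>k. ((\<lambda>h. f (t - h) k) \<longlongrightarrow> f t k) (at_right 0)"
  shows "((\<lambda>u. f u i) has_real_derivative (\<Sum>\<^sub>\<infinity>k. Q i k * f t k)) (at_left t)"
proof -
  have ev: "\<forall>\<^sub>F h in at_right 0. 0 < h \<and> h < t"
    using t by (auto simp: eventually_at_right_field)
  have "((\<lambda>h. ((\<Sum>\<^sub>\<infinity>k. P h i k * f (t - h) k) - f (t - h) i) / h) \<longlongrightarrow> (\<Sum>\<^sub>\<infinity>k. Q i k * f t k)) (at_right 0)"
  proof (rule Q_function_apply_tendsto[OF PQ g _ _ cont])
    show "\<forall>\<^sub>F h in at_right 0. \<forall>k. \<bar>f (t - h) k\<bar> \<le> g k"
      using ev by eventually_elim (auto intro: fg)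
    show "\<bar>f t k\<bar> \<le> g k" for k using t by (intro fg) auto
  qed
  moreover have "\<forall>\<^sub>F h in at_right 0.
      ((\<Sum>\<^sub>\<infinity>k. P h i k * f (t - h) k) - f (t - h) i) / h = (f (t - h) i - f t i) / (t - h - t)"
    using ev
  proof eventually_elim
    case (elim h)
    then have "f t i = (\<Sum>\<^sub>\<infinity>k. P h i k * f (t - h) k)" by (intro sg) auto
    with elim show ?case by (simp add: field_simps)
  qed
  ultimately have "((\<lambda>h. (f (t - h) i - f t i) / (t - h - t)) \<longlongrightarrow> (\<Sum>\<^sub>\<infinity>k. Q i k * f t k)) (at_right 0)"
    by (rule Lim_transform_eventually)
  then show ?thesis
    unfolding has_field_derivative_iff unfolding at_left_eq_filtermap filterlim_filtermap .
qed

text \<open>Subtracting \<open>c * t\<close> makes a positive maximum contradictory: where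
  \<open>v t x - c * t\<close> is maximal, the left derivative of \<open>v\<close> is at least
  \<open>c > 0\<close>. Vanishing at infinity confines the search to finitely many \<open>x\<close>,
  where continuity on a compact interval gives a maximum.\<close>

lemma maximum_principle:
  fixes v :: "real \<Rightarrow> 'x \<Rightarrow> real"
  assumes cont: "\<And>x. continuous_on {0..T} (\<lambda>t. v t x)"
    and init: "\<And>x. v 0 x \<le> 0"
    and g: "vanishes_at_infinity g" and vg: "\<And>t x. 0 \<le> t \<Longrightarrow> t \<le> T \<Longrightarrow> v t x \<le> g x"
    and max: "\<And>t x. 0 < t \<Longrightarrow> t \<le> T \<Longrightarrow> 0 < v t x \<Longrightarrow> (\<And>y. v t y \<le> v t x) \<Longrightarrow>
      \<exists>D\<le>0. ((\<lambda>t. v t x) has_real_derivative D) (at_left t)"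
    and t1: "0 \<le> t1" "t1 \<le> T"
  shows "v t1 x1 \<le> 0"
proof (rule ccontr)
  assume "\<not> v t1 x1 \<le> 0"
  then have pos: "0 < v t1 x1" by simp
  \<comment> \<open>Chosen such that the tilt costs at most half of \<open>v t1 x1\<close>;
    \<open>T + 1\<close> keeps the denominator positive.\<close>
  define c where "c = v t1 x1 / (2 * (T + 1))"
  have T: "0 \<le> T" using t1 by simp
  have c: "0 < c" using pos T by (simp add: c_def)
  have lt: "c * t1 \<le> v t1 x1 / 2"
  proof -
    have "c * t1 \<le> c * (T + 1)" using c t1 by (intro mult_left_mono) auto
    also have "\<dots> = v t1 x1 / 2" using T by (simp add: c_def field_simps)
    finally show ?thesis .
  qed
  define w where "w = (\<lambda>t x. v t x - c * t)"
  have w1: "v t1 x1 / 2 \<le> w t1 x1" using lt by (simp add: w_def)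
  \<comment> \<open>The maximal value will be at least \<open>v t1 x1 / 2\<close>, whereas outside
    \<open>A\<close> the function stays below \<open>v t1 x1 / 4\<close> at all times. Hence a
    maximum over \<open>A\<close> is one over all states.\<close>
  define A where "A = insert x1 {x. v t1 x1 / 4 < \<bar>g x\<bar>}"
  have "finite {x. v t1 x1 / 4 < \<bar>g x\<bar>}"
    using g[unfolded vanishes_at_infinity_def, rule_format, of "v t1 x1 / 4"] pos by simp
  then have A: "finite A" "x1 \<in> A" by (simp_all add: A_def)
  have "\<exists>t\<in>{0..T}. \<forall>s\<in>{0..T}. w s x \<le> w t x" for x
    using T by (intro continuous_attains_sup) (auto simp: w_def intro!: continuous_intros cont)
  then obtain \<tau> where \<tau>: "\<And>x. \<tau> x \<in> {0..T}" "\<And>x s. s \<in> {0..T} \<Longrightarrow> w s x \<le> w (\<tau> x) x" by metis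
  define x0 where "x0 = (ARG_MAX (\<lambda>x. w (\<tau> x) x) x. x \<in> A)"
  have x0: "x0 \<in> A" "\<And>x. x \<in> A \<Longrightarrow> w (\<tau> x) x \<le> w (\<tau> x0) x0"
  proof -
    let ?M = "Max ((\<lambda>x. w (\<tau> x) x) ` A)"
    have "?M \<in> (\<lambda>x. w (\<tau> x) x) ` A" using A by (intro Max_in) auto
    then obtain y where y: "y \<in> A" "w (\<tau> y) y = ?M" by force
    have "is_arg_max (\<lambda>x. w (\<tau> x) x) (\<lambda>x. x \<in> A) y"
      using y A by (auto simp: is_arg_max_linorder)
    then have "is_arg_max (\<lambda>x. w (\<tau> x) x) (\<lambda>x. x \<in> A) x0"
      unfolding x0_def arg_max_def by (rule someI)
    then show "x0 \<in> A" "\<And>x. x \<in> A \<Longrightarrow> w (\<tau> x) x \<le> w (\<tau> x0) x0"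
      by (auto simp: is_arg_max_linorder)
  qed
  define t0 where "t0 = \<tau> x0"
  have t0: "0 \<le> t0" "t0 \<le> T" using \<tau>(1)[of x0] by (auto simp: t0_def)
  have "w t1 x1 \<le> w (\<tau> x1) x1" using t1 by (intro \<tau>(2)) auto
  then have w0: "v t1 x1 / 2 \<le> w t0 x0" using x0(2)[OF A(2)] w1 by (simp add: t0_def)
  moreover have "0 \<le> c * t0" using c t0 by simp
  ultimately have v0: "v t1 x1 / 2 \<le> v t0 x0" unfolding w_def by linarith
  have "t0 \<noteq> 0" using v0 init[of x0] pos by force
  with t0 have t0': "0 < t0" by simp
  have "v t0 y \<le> v t0 x0" for y
  proof (cases "y \<in> A")
    case True
    have "w t0 y \<le> w (\<tau> y) y" using t0 by (intro \<tau>(2)) auto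
    also have "\<dots> \<le> w t0 x0" using x0(2)[OF True] by (simp add: t0_def)
    finally show ?thesis by (simp add: w_def)
  next
    case False
    then have "\<bar>g y\<bar> \<le> v t1 x1 / 4" by (auto simp: A_def)
    then have "v t0 y \<le> v t1 x1 / 4" using vg[OF t0, of y] by linarith
    then show ?thesis using v0 pos by linarith
  qed
  then obtain D where D: "D \<le> 0" "((\<lambda>t. v t x0) has_real_derivative D) (at_left t0)"
    using max[OF t0' t0(2), of x0] v0 pos by auto
  have "c \<le> D"
  proof (rule tendsto_lowerbound)
    show "((\<lambda>t. (v t x0 - v t0 x0) / (t - t0)) \<longlongrightarrow> D) (at_left t0)"
      using D(2) by (simp add: has_field_derivative_iff)
    have "\<forall>\<^sub>F t in at_left t0. 0 < t \<and> t < t0"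
      using t0' by (auto simp: eventually_at_left_field)
    then show "\<forall>\<^sub>F t in at_left t0. c \<le> (v t x0 - v t0 x0) / (t - t0)"
    proof eventually_elim
      case (elim t)
      have "w t x0 \<le> w t0 x0" unfolding t0_def using elim t0 by (intro \<tau>(2)) (auto simp: t0_def)
      then have "c * (t0 - t) \<le> v t0 x0 - v t x0" by (simp add: w_def algebra_simps)
      then have "c \<le> (v t0 x0 - v t x0) / (t0 - t)" using elim by (simp add: pos_le_divide_eq)
      also have "\<dots> = (v t x0 - v t0 x0) / (t - t0)" by (metis minus_diff_eq minus_divide_divide)
      finally show ?case .
    qed
  qed (simp add: trivial_limit_at_left_real)
  with D(1) c show False by simp
qed

text \<open>The positive maximum principle for generators; the sign of the maximal value takes care
  of the killing deficit.\<close>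

lemma q_matrix_apply_at_max:
  assumes Q: "q_matrix Q" and f: "\<And>j. \<bar>f j\<bar> \<le> C" and max: "\<And>j. f j \<le> f i" and pos: "0 \<le> f i"
  shows "(\<Sum>\<^sub>\<infinity>j. Q i j * f j) \<le> 0"
proof -
  have "(\<Sum>\<^sub>\<infinity>j. Q i j * f j) \<le> (\<Sum>\<^sub>\<infinity>j. Q i j * f i)"
  proof (rule infsum_mono)
    show "(\<lambda>j. Q i j * f j) summable_on UNIV"
      by (rule summable_mult_bounded[OF q_matrixD(2)[OF Q] f])
    show "(\<lambda>j. Q i j * f i) summable_on UNIV"
      by (rule summable_on_cmult_left[OF q_matrixD(2)[OF Q]])
    show "Q i j * f j \<le> Q i j * f i" for j
      using q_matrixD(1)[OF Q, of i j] max by (cases "i = j") (auto intro: mult_left_mono)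
  qed
  also have "\<dots> = infsum (Q i) UNIV * f i" by (rule infsum_cmult_left')
  also have "\<dots> \<le> 0" using q_matrixD(3)[OF Q] pos by (rule mult_nonpos_nonneg)
  finally show ?thesis .
qed

section \<open>Generating functions\<close>

context
  fixes P :: "real \<Rightarrow> nat ^ 'n::finite \<Rightarrow> nat ^ 'n \<Rightarrow> real"
  assumes P: "transition_function P"
begin

lemma gen_fun_summable:
  assumes "0 \<le> t" "s \<in> unit_cube"
  shows "(\<lambda>j. P t i j * mono_pow s j) summable_on UNIV"
  by (rule substoch_summable_mult[OF transition_substoch[OF P]]) (use assms mono_pow_unit_cube in auto)

lemma gen_fun_abs_le_1:
  assumes "0 \<le> t" "s \<in> unit_cube"
  shows "\<bar>gen_fun P i t s\<bar> \<le> 1"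
  unfolding gen_fun_def
  by (rule substoch_abs_infsum_le[OF transition_substoch[OF P]]) (use assms mono_pow_unit_cube in auto)

lemma gen_fun_0: "gen_fun P i 0 s = mono_pow s i"
  unfolding gen_fun_def transition_0[OF P]
  by (simp add: id_kernel_def if_distrib[of "\<lambda>x. x * _"] cong: if_cong)

lemma gen_fun_add:
  assumes "0 \<le> t" "0 \<le> u" "s \<in> unit_cube"
  shows "gen_fun P i (t + u) s = (\<Sum>\<^sub>\<infinity>k. P t i k * gen_fun P k u s)"
  unfolding gen_fun_def transition_add[OF P assms(1,2)]
  by (rule kcomp_apply) (use assms mono_pow_unit_cube in \<open>auto intro: transition_substoch[OF P]\<close>)

lemma gen_fun_continuous:
  assumes "s \<in> unit_cube"
  shows "continuous_on {0..} (\<lambda>t. gen_fun P i t s)"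
proof (rule continuous_on_semigroup_orbit[OF P, of "\<lambda>t k. gen_fun P k t s" 1])
  show "gen_fun P i (t + h) s = (\<Sum>\<^sub>\<infinity>k. P h i k * gen_fun P k t s)" if "0 \<le> t" "0 \<le> h" for t h
    using gen_fun_add[OF that(2,1) assms] by (simp add: add.commute)
qed (use gen_fun_abs_le_1 assms in auto)

lemma gen_fun_ge_diag:
  assumes "0 \<le> t" "s \<in> corner_box 1"
  shows "P t i i * mono_pow s i \<le> gen_fun P i t s"
proof -
  have "(\<Sum>j\<in>{i}. P t i j * mono_pow s j) \<le> gen_fun P i t s"
    unfolding gen_fun_def using assms corner_box_subset_unit_cube[of 1]
    by (intro finite_sum_le_infsum gen_fun_summable)
       (auto intro!: mult_nonneg_nonneg transition_nonneg[OF P] mono_pow_corner_box)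
  then show ?thesis by simp
qed

lemma gen_fun_nonneg:
  assumes "0 \<le> t" "s \<in> corner_box 1"
  shows "0 \<le> gen_fun P i t s"
  using gen_fun_ge_diag[OF assms, of i] transition_nonneg[OF P assms(1), of i i]
    mono_pow_corner_box(1)[OF assms(2), of i] by (meson mult_nonneg_nonneg order_trans)

lemma gen_fun_at_0: "gen_fun P i t 0 = P t i 0"
  unfolding gen_fun_def mono_pow_at_0 by (simp add: if_distrib[of "\<lambda>x. _ * x"] cong: if_cong)

lemma gen_fun_cube_series:
  assumes "0 \<le> t"
  shows "cube_series (gen_fun P i t)"
  unfolding cube_series_def gen_fun_def
  using substochD(2)[OF transition_substoch[OF P assms]] by blast

lemma gen_fun_eqD:
  assumes R: "transition_function R" and t: "0 \<le> t"
    and eq: "\<And>i s. s \<in> corner_box (1 / 2) \<Longrightarrow> gen_fun P i t s = gen_fun R i t s"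
  shows "P t = R t"
proof
  fix i
  show "P t i = R t i"
    by (rule power_series_eqD[OF substochD(2)[OF transition_substoch[OF P t]]
          substochD(2)[OF transition_substoch[OF R t]]])
       (use eq in \<open>simp add: gen_fun_def\<close>)
qed

end

lemma gen_fun_left_derivative:
  fixes P :: "real \<Rightarrow> nat ^ 'n::finite \<Rightarrow> nat ^ 'n \<Rightarrow> real"
  assumes PQ: "Q_function Q P" and s: "s \<in> unit_cube" and t: "0 < t"
    and g: "vanishes_at_infinity g" and fg: "\<And>u k. 0 \<le> u \<Longrightarrow> u \<le> t \<Longrightarrow> \<bar>gen_fun P k u s\<bar> \<le> g k"
  shows "((\<lambda>u. gen_fun P i u s) has_real_derivative (\<Sum>\<^sub>\<infinity>k. Q i k * gen_fun P k t s)) (at_left t)"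
proof (rule backward_left_derivative[where f = "\<lambda>u k. gen_fun P k u s", OF PQ t _ g fg])
  note P = Q_function_transition[OF PQ]
  show "gen_fun P i t s = (\<Sum>\<^sub>\<infinity>k. P h i k * gen_fun P k (t - h) s)" if "0 < h" "h \<le> t" for h
    using gen_fun_add[OF P, of h "t - h" s i] that s by simp
  show "((\<lambda>h. gen_fun P k (t - h) s) \<longlongrightarrow> gen_fun P k t s) (at_right 0)" for k
  proof -
    have c: "isCont (\<lambda>t. gen_fun P k t s) t"
      using continuous_on_interior[OF gen_fun_continuous[OF P s]] t by simp
    have "((\<lambda>h. t - h) \<longlongrightarrow> t - 0) (at_right 0)" by (intro tendsto_intros)
    then have "((\<lambda>h. t - h) \<longlongrightarrow> t) (at_right 0)" by simp
    then show ?thesis by (rule isCont_tendsto_compose[OF c])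
  qed
qed

section \<open>Branching q-matrices with immigration\<close>

text \<open>The degenerate case of identically vanishing off-diagonal rates is allowed here.\<close>

definition weak_rates_at :: "'a \<Rightarrow> ('a \<Rightarrow> real) \<Rightarrow> bool" where
  "weak_rates_at x c \<longleftrightarrow> (\<forall>j. j \<noteq> x \<longrightarrow> 0 \<le> c j) \<and> c summable_on UNIV \<and> infsum c UNIV \<le> 0"

definition bi_matrix :: "(nat ^ 'n::finite \<Rightarrow> real) \<Rightarrow> ('n \<Rightarrow> nat ^ 'n \<Rightarrow> real) \<Rightarrow> nat ^ 'n \<Rightarrow> nat ^ 'n \<Rightarrow> real" where
  "bi_matrix a b i j = branching_rate b i j + coeff_diff a j i"

lemma weak_rates_atD:
  assumes "weak_rates_at x c"
  shows "j \<noteq> x \<Longrightarrow> 0 \<le> c j" "c summable_on UNIV" "infsum c UNIV \<le> 0"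
  using assms by (auto simp: weak_rates_at_def)

lemma weak_rates_at_0: "weak_rates_at x (\<lambda>_. 0)"
  by (simp add: weak_rates_at_def)

lemma infsum_remove1:
  fixes c :: "'a \<Rightarrow> real"
  assumes "c summable_on - {x}"
  shows "infsum c UNIV = c x + infsum c (- {x})" "c summable_on UNIV"
proof -
  have "insert x (- {x}) = UNIV" by auto
  then show "infsum c UNIV = c x + infsum c (- {x})" "c summable_on UNIV"
    using infsum_insert[OF assms, of x] summable_on_insert_iff[of c x "- {x}"] assms by auto
qed

lemma rates_at_imp_weak: "rates_at x c \<Longrightarrow> weak_rates_at x c"
  using infsum_remove1[of c x] by (auto simp: rates_at_def weak_rates_at_def)

lemma weak_rates_at_imp_rates_at:
  assumes c: "weak_rates_at x c" and j: "j \<noteq> x" "c j \<noteq> 0"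
  shows "rates_at x c"
proof -
  have s: "c summable_on - {x}"
    using weak_rates_atD(2)[OF c] by (rule summable_on_subset_banach) simp
  have "sum c {j} \<le> infsum c (- {x})"
    using j weak_rates_atD(1)[OF c] by (intro finite_sum_le_infsum s) auto
  moreover have "0 < c j" using weak_rates_atD(1)[OF c j(1)] j(2) by linarith
  ultimately show ?thesis
    using infsum_remove1(1)[OF s] s weak_rates_atD[OF c] by (auto simp: rates_at_def)
qed

lemma weak_rates_diag_nonpos:
  assumes "weak_rates_at x c"
  shows "c x \<le> 0"
proof -
  have "sum c {x} \<le> infsum c UNIV"
    using weak_rates_atD[OF assms] by (intro finite_sum_le_infsum) auto
  then show ?thesis using weak_rates_atD(3)[OF assms] by simp
qed

text \<open>Away from \<open>x\<close> the rates are nonnegative and \<open>f\<close> may be raised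
  to \<open>C\<close>; as the total rate is at most 0, only the correction at \<open>x\<close>
  remains. It will be applied to powers of \<open>\<rho>\<close>, with \<open>C\<close> the value at
  the smallest population a jump can reach.\<close>

lemma weak_rates_at_tail_le:
  assumes c: "weak_rates_at x c" and f: "\<And>j. 0 \<le> f j" "\<And>j. f j \<le> C"
  shows "(\<Sum>\<^sub>\<infinity>l. c l * f l) \<le> c x * (f x - C)"
proof -
  note cs = weak_rates_atD[OF c]
  have C: "0 \<le> C" using f order_trans by blast
  have s: "(\<lambda>l. c l * f l) summable_on UNIV" "(\<lambda>l. c l * C) summable_on UNIV"
    using f C by (auto intro!: summable_mult_bounded[OF cs(2), of _ C])
  have "(\<Sum>\<^sub>\<infinity>l. c l * f l) \<le> (\<Sum>\<^sub>\<infinity>l. c l * C + (if l = x then c l * (f l - C) else 0))"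
  proof (intro infsum_mono s summable_on_add summable_delta)
    show "c l * f l \<le> c l * C + (if l = x then c l * (f l - C) else 0)" for l
      using mult_left_mono[OF f(2)[of l] cs(1)[of l]] by (cases "l = x") (auto simp: algebra_simps)
  qed
  also have "\<dots> = infsum c UNIV * C + c x * (f x - C)"
    by (subst infsum_add) (auto simp: s infsum_cmult_left')
  also have "\<dots> \<le> c x * (f x - C)"
    using mult_nonpos_nonneg[OF cs(3) C] by simp
  finally show ?thesis .
qed

lemma multi_index_le_iff: "i \<le> j \<longleftrightarrow> (\<exists>l. j = i + (l :: nat ^ 'n::finite))"
proof
  assume "i \<le> j"
  then have "j = i + (j - i)" by (simp add: vec_eq_iff less_eq_vec_def)
  then show "\<exists>l. j = i + l" by blast
qed (auto simp: less_eq_vec_def)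

lemma coeff_diff_add [simp]: "coeff_diff c (i + l) i = c l"
proof -
  have "i + l - i = l" by (simp add: vec_eq_iff)
  then show ?thesis by (auto simp: coeff_diff_def multi_index_le_iff)
qed

lemma coeff_diff_eq_0: "(\<And>l. j \<noteq> i + l) \<Longrightarrow> coeff_diff c j i = 0"
  by (auto simp: coeff_diff_def multi_index_le_iff)

lemma has_sum_finite_sum:
  fixes f :: "'k \<Rightarrow> 'a \<Rightarrow> real"
  assumes "finite K" "\<And>k. k \<in> K \<Longrightarrow> (f k has_sum S k) A"
  shows "((\<lambda>x. \<Sum>k\<in>K. f k x) has_sum (\<Sum>k\<in>K. S k)) A"
  using assms by (induction rule: finite_induct) (simp_all add: has_sum_add)

lemma has_sum_coeff_diff:
  assumes "((\<lambda>l. c l * f (i + l)) has_sum S) UNIV"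
  shows "((\<lambda>j. coeff_diff c j i * f j) has_sum S) UNIV"
proof -
  have inj: "inj ((+) i)" by (simp add: inj_def)
  have "((\<lambda>j. coeff_diff c j i * f j) has_sum S) (range ((+) i))"
    using assms by (subst has_sum_reindex[OF inj]) (simp add: o_def)
  then show ?thesis
    by (rule has_sum_cong_neutral[THEN iffD1, rotated -1]) (auto intro!: coeff_diff_eq_0)
qed

text \<open>The unit vector changes sides, and truncated subtraction is exact there because
  component \<open>k\<close> is positive. If it is 0, the term carries the factor 0 in
  \<open>branching_rate\<close>.\<close>

lemma branching_coeff_diff:
  assumes "0 < i $ k"
  shows "coeff_diff c (j + unit_index k) i = coeff_diff c j (i - unit_index k)"
proof -
  define i' where "i' = i - unit_index k"
  have i: "i = i' + unit_index k" by (simp add: i'_def multi_index_minus_unit[OF assms, simplified])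
  show ?thesis
  proof (cases "\<exists>l. j = i' + l")
    case True
    then obtain l where l: "j = i' + l" by blast
    have "j + unit_index k = i + l" by (simp add: i l add_ac)
    then show ?thesis by (simp only: coeff_diff_add i'_def[symmetric] l)
  next
    case False
    have "j + unit_index k \<noteq> i + l" for l
    proof
      assume "j + unit_index k = i + l"
      then have "j + unit_index k = (i' + l) + unit_index k" by (simp only: i add_ac)
      then have "j = i' + l" by (simp only: add_right_cancel)
      with False show False by blast
    qed
    then have "coeff_diff c (j + unit_index k) i = 0" by (rule coeff_diff_eq_0)
    moreover have "coeff_diff c j i' = 0" using False by (intro coeff_diff_eq_0) blast
    ultimately show ?thesis by (simp only: i'_def)
  qed
qed

lemma bi_matrix_apply:
  fixes a :: "nat ^ 'n::finite \<Rightarrow> real"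
  assumes a: "a summable_on UNIV" and b: "\<And>k. b k summable_on UNIV" and f: "\<And>j. \<bar>f j\<bar> \<le> C"
  shows "((\<lambda>j. bi_matrix a b i j * f j) has_sum
    (\<Sum>\<^sub>\<infinity>l. a l * f (i + l)) + (\<Sum>k\<in>UNIV. real (i $ k) * (\<Sum>\<^sub>\<infinity>l. b k l * f (i - unit_index k + l)))) UNIV"
proof -
  have s: "((\<lambda>l. c l * f (j + l)) has_sum (\<Sum>\<^sub>\<infinity>l. c l * f (j + l))) UNIV" if "c summable_on UNIV" for c j
    using summable_mult_bounded[OF that, of "\<lambda>l. f (j + l)" C] f by simp
  have k: "((\<lambda>j. real (i $ k) * coeff_diff (b k) (j + unit_index k) i * f j) has_sum
      real (i $ k) * (\<Sum>\<^sub>\<infinity>l. b k l * f (i - unit_index k + l))) UNIV" for k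
  proof (cases "i $ k = 0")
    case False
    then show ?thesis
      unfolding mult.assoc branching_coeff_diff[OF False[unfolded neq0_conv]]
      by (intro has_sum_cmult_right has_sum_coeff_diff s b)
  qed simp
  have "((\<lambda>j. coeff_diff a j i * f j + (\<Sum>k\<in>UNIV. real (i $ k) * coeff_diff (b k) (j + unit_index k) i * f j)) has_sum
    (\<Sum>\<^sub>\<infinity>l. a l * f (i + l)) + (\<Sum>k\<in>UNIV. real (i $ k) * (\<Sum>\<^sub>\<infinity>l. b k l * f (i - unit_index k + l)))) UNIV"
    by (intro has_sum_add has_sum_coeff_diff s a has_sum_finite_sum k) auto
  then show ?thesis
    by (simp add: bi_matrix_def branching_rate_def distrib_right sum_distrib_right add.commute)
qed

context
  fixes a :: "nat ^ 'n::finite \<Rightarrow> real" and b :: "'n \<Rightarrow> nat ^ 'n \<Rightarrow> real"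
  assumes a: "weak_rates_at 0 a" and b: "\<And>k. weak_rates_at (unit_index k) (b k)"
begin

lemma bi_matrix_diag: "bi_matrix a b i i = a 0 + (\<Sum>k\<in>UNIV. real (i $ k) * b k (unit_index k))"
proof -
  have "coeff_diff a i i = a 0" using coeff_diff_add[of a i 0] by simp
  then show ?thesis
    by (simp add: bi_matrix_def branching_rate_def)
qed

lemma q_matrix_bi_matrix: "q_matrix (bi_matrix a b)"
  unfolding q_matrix_def
proof (intro conjI allI impI)
  fix i
  have *: "(bi_matrix a b i has_sum infsum a UNIV + (\<Sum>k\<in>UNIV. real (i $ k) * infsum (b k) UNIV)) UNIV"
    using bi_matrix_apply[OF weak_rates_atD(2)[OF a] weak_rates_atD(2)[OF b], where f = "\<lambda>_. 1" and C = 1 and i = i] by simp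
  then show "bi_matrix a b i summable_on UNIV" by (rule has_sum_imp_summable)
  have "infsum (bi_matrix a b i) UNIV = infsum a UNIV + (\<Sum>k\<in>UNIV. real (i $ k) * infsum (b k) UNIV)"
    using * by (rule infsumI)
  also have "\<dots> \<le> 0"
    by (intro add_nonpos_nonpos sum_nonpos mult_nonneg_nonpos weak_rates_atD[OF a] weak_rates_atD[OF b]) auto
  finally show "infsum (bi_matrix a b i) UNIV \<le> 0" .
  fix j :: "nat ^ 'n" assume ij: "i \<noteq> j"
  have "0 \<le> coeff_diff a j i"
    using ij weak_rates_atD(1)[OF a] by (auto simp: coeff_diff_def multi_index_le_iff)
  moreover have "0 \<le> coeff_diff (b k) (j + unit_index k) i" for k
  proof (cases "\<exists>l. j + unit_index k = i + l")
    case True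
    then obtain l where l: "j + unit_index k = i + l" by blast
    with ij have "l \<noteq> unit_index k" by auto
    then show ?thesis unfolding l coeff_diff_add by (rule weak_rates_atD(1)[OF b])
  qed (simp add: coeff_diff_eq_0)
  ultimately show "0 \<le> bi_matrix a b i j"
    unfolding bi_matrix_def branching_rate_def by (intro add_nonneg_nonneg sum_nonneg mult_nonneg_nonneg) auto
qed

end

text \<open>Independence of individuals at the level of rates: the branching rates are linear in the
  population and the immigration is charged to the first summand. The case distinctions are due to
  truncated subtraction, which is exact precisely where the factor in front is nonzero.\<close>

lemma bi_matrix_apply_add:
  fixes a :: "nat ^ 'n::finite \<Rightarrow> real"
  assumes a: "weak_rates_at 0 a" and b: "\<And>k. weak_rates_at (unit_index k) (b k)" and f: "\<And>j. \<bar>f j\<bar> \<le> C"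
  shows "(\<Sum>\<^sub>\<infinity>j. bi_matrix a b (i + i') j * f j)
    = (\<Sum>\<^sub>\<infinity>j. bi_matrix a b i j * f (j + i')) + (\<Sum>\<^sub>\<infinity>j. bi_matrix (\<lambda>_. 0) b i' j * f (i + j))"
proof -
  note app = infsumI[OF bi_matrix_apply[OF weak_rates_atD(2) weak_rates_atD(2)[OF b]]]
  have k: "real ((i + i') $ k) * (\<Sum>\<^sub>\<infinity>l. b k l * f (i + i' - unit_index k + l))
     = real (i $ k) * (\<Sum>\<^sub>\<infinity>l. b k l * f (i - unit_index k + l + i'))
     + real (i' $ k) * (\<Sum>\<^sub>\<infinity>l. b k l * f (i + (i' - unit_index k + l)))" for k
  proof -
    have 1: "i + i' - unit_index k + l = i - unit_index k + l + i'" if "0 < i $ k" for l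
      using that by (auto simp: vec_eq_iff)
    have 2: "i + i' - unit_index k + l = i + (i' - unit_index k + l)" if "0 < i' $ k" for l
      using that by (auto simp: vec_eq_iff)
    show ?thesis
    proof (cases "0 < i $ k")
      case True
      show ?thesis
      proof (cases "0 < i' $ k")
        case True': True
        show ?thesis
          unfolding 1[OF True, symmetric] 2[OF True', symmetric] by (simp add: distrib_right)
      next
        case False
        show ?thesis unfolding 1[OF True, symmetric] using False by simp
      qed
    next
      case False
      show ?thesis
      proof (cases "0 < i' $ k")
        case True
        show ?thesis unfolding 2[OF True, symmetric] using False by simp
      next
        case False': False
        show ?thesis using False False' by simp
      qed
    qed
  qed
  have "(\<Sum>\<^sub>\<infinity>j. bi_matrix a b (i + i') j * f j) = (\<Sum>\<^sub>\<infinity>l. a l * f (i + i' + l)) +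
     (\<Sum>k\<in>UNIV. real ((i + i') $ k) * (\<Sum>\<^sub>\<infinity>l. b k l * f (i + i' - unit_index k + l)))"
    by (rule app[OF a f])
  also have "\<dots> = (\<Sum>\<^sub>\<infinity>l. a l * f (i + l + i'))
      + (\<Sum>k\<in>UNIV. real (i $ k) * (\<Sum>\<^sub>\<infinity>l. b k l * f (i - unit_index k + l + i')))
      + (\<Sum>k\<in>UNIV. real (i' $ k) * (\<Sum>\<^sub>\<infinity>l. b k l * f (i + (i' - unit_index k + l))))"
    unfolding k sum.distrib by (simp add: add_ac)
  also have "\<dots> = (\<Sum>\<^sub>\<infinity>j. bi_matrix a b i j * f (j + i')) + (\<Sum>\<^sub>\<infinity>j. bi_matrix (\<lambda>_. 0) b i' j * f (i + j))"
  proof -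
    have "(\<Sum>\<^sub>\<infinity>j. bi_matrix a b i j * f (j + i')) = (\<Sum>\<^sub>\<infinity>l. a l * f (i + l + i'))
      + (\<Sum>k\<in>UNIV. real (i $ k) * (\<Sum>\<^sub>\<infinity>l. b k l * f (i - unit_index k + l + i')))"
      by (rule app[OF a]) (rule f)
    moreover have "(\<Sum>\<^sub>\<infinity>j. bi_matrix (\<lambda>_. 0) b i' j * f (i + j)) = (\<Sum>\<^sub>\<infinity>l. 0 * f (i + (i' + l)))
      + (\<Sum>k\<in>UNIV. real (i' $ k) * (\<Sum>\<^sub>\<infinity>l. b k l * f (i + (i' - unit_index k + l))))"
      by (rule app[OF weak_rates_at_0]) (rule f)
    ultimately show ?thesis by simp
  qed
  finally show ?thesis .
qed

section \<open>Vanishing at infinity of the generating functions of the minimal process\<close>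

lemma power_Suc_tangent:
  fixes \<rho> x :: real
  assumes "0 \<le> \<rho>" "0 \<le> x"
  shows "\<rho> ^ Suc m + real (Suc m) * x * \<rho> ^ m \<le> (\<rho> + x) ^ Suc m"
proof (induction m)
  case (Suc m)
  have "\<rho> ^ Suc (Suc m) + real (Suc (Suc m)) * x * \<rho> ^ Suc m + real (Suc m) * x\<^sup>2 * \<rho> ^ m
      = (\<rho> + x) * (\<rho> ^ Suc m + real (Suc m) * x * \<rho> ^ m)"
    by (simp add: algebra_simps power2_eq_square)
  also have "\<dots> \<le> (\<rho> + x) * (\<rho> + x) ^ Suc m" using assms Suc by (intro mult_left_mono) auto
  finally show ?case using assms by (smt (verit) mult_nonneg_nonneg of_nat_0_le_iff power_Suc zero_le_power zero_le_power2)
qed simp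

text \<open>The right side is the generating function at \<open>\<rho>\<close> of a pure death
  process: \<open>m\<close> individuals survive time \<open>h\<close> independently with probability
  \<open>exp (- (c * h))\<close>. The left side allows at most one death, at total rate
  \<open>\<theta>\<close>; per individual this rate is at most \<open>c\<close>.\<close>

lemma exp_contraction_power:
  fixes \<rho> c h \<theta> :: real
  assumes \<rho>: "0 \<le> \<rho>" "\<rho> \<le> 1" and h: "0 \<le> h" and \<theta>: "0 \<le> \<theta>" "\<theta> \<le> c * real m" and c: "0 \<le> c"
  shows "exp (- (h * \<theta>)) * (\<rho> ^ m + h * \<theta> * \<rho> ^ (m - 1)) \<le> (1 - (1 - \<rho>) * exp (- (c * h))) ^ m"
proof (cases m)
  case 0
  then have "\<theta> = 0" using \<theta> by simp
  then show ?thesis by (simp add: 0)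
next
  case (Suc m')
  define x where "x = h * \<theta> / real m"
  have x0: "0 \<le> x" using h \<theta> by (simp add: x_def)
  have xm: "h * \<theta> = real m * x" using Suc by (simp add: x_def)
  have "h * \<theta> \<le> h * (c * real m)" using h \<theta> by (intro mult_left_mono) auto
  then have xc: "x \<le> c * h" using Suc by (simp add: x_def divide_le_eq mult_ac)
  have "exp (- (h * \<theta>)) * (\<rho> ^ m + h * \<theta> * \<rho> ^ (m - 1)) = exp (- (real m * x)) * (\<rho> ^ m + real m * x * \<rho> ^ (m - 1))"
    by (simp only: xm)
  also have "\<dots> \<le> exp (- (real m * x)) * (\<rho> + x) ^ m"
    using power_Suc_tangent[OF \<rho>(1) x0, of m'] Suc by (intro mult_left_mono) auto
  also have "\<dots> = (exp (- x) * (\<rho> + x)) ^ m"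
    by (simp add: power_mult_distrib exp_of_nat_mult[symmetric])
  also have "\<dots> \<le> (1 - (1 - \<rho>) * exp (- (c * h))) ^ m"
  proof (rule power_mono)
    have "x \<le> exp x - 1" using exp_ge_add_one_self[of x] by linarith
    then have "exp (- x) * (\<rho> + x) \<le> exp (- x) * (\<rho> + exp x - 1)"
      by (intro mult_left_mono) auto
    also have "\<dots> = 1 - (1 - \<rho>) * exp (- x)"
      by (simp add: algebra_simps flip: exp_add)
    also have "\<dots> \<le> 1 - (1 - \<rho>) * exp (- (c * h))"
      using \<rho> xc by (intro diff_left_mono mult_left_mono) auto
    finally show "exp (- x) * (\<rho> + x) \<le> 1 - (1 - \<rho>) * exp (- (c * h))" .
  qed (use \<rho> x0 in auto)
  finally show ?thesis .
qed

lemma minimal_function_apply_le: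
  assumes Q: "q_matrix Q" and t: "0 \<le> t" and f: "\<And>j. 0 \<le> f j" "\<And>j. f j \<le> 1"
    and le: "\<And>xs. xs \<in> partitions t \<Longrightarrow> (\<Sum>\<^sub>\<infinity>j. jump_prod Q xs i j * f j) \<le> c"
  shows "(\<Sum>\<^sub>\<infinity>j. minimal_function Q t i j * f j) \<le> c"
proof (rule infsum_le_finite_sums)
  have fa: "\<bar>f j\<bar> \<le> 1" for j using f[of j] by simp
  show "(\<lambda>j. minimal_function Q t i j * f j) summable_on UNIV"
    by (rule substoch_summable_mult[OF substoch_minimal_function[OF Q t] fa])
  fix F :: "'a set" assume F: "finite F"
  show "(\<Sum>j\<in>F. minimal_function Q t i j * f j) \<le> c"
  proof (rule field_le_epsilon)
    fix \<epsilon> :: real assume e: "0 < \<epsilon>"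
    define \<delta> where "\<delta> = \<epsilon> / (card F + 1)"
    have d: "0 < \<delta>" "card F * \<delta> \<le> \<epsilon>" using e by (auto simp: \<delta>_def field_simps)
    obtain xs where xs: "xs \<in> partitions t" "\<forall>(i, j)\<in>{i} \<times> F. minimal_function Q t i j - \<delta> \<le> jump_prod Q xs i j"
      using minimal_function_approx[OF Q t, of "{i} \<times> F" \<delta>] F d by auto
    note sX = substoch_jump_prod[OF Q xs(1)]
    have "(\<Sum>j\<in>F. minimal_function Q t i j * f j) \<le> (\<Sum>j\<in>F. jump_prod Q xs i j * f j + \<delta>)"
    proof (rule sum_mono)
      fix j assume "j \<in> F"
      then have "minimal_function Q t i j * f j \<le> (jump_prod Q xs i j + \<delta>) * f j"
        using xs(2) f(1) by (intro mult_right_mono) (auto simp: algebra_simps)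
      also have "\<dots> \<le> jump_prod Q xs i j * f j + \<delta>"
        using mult_left_mono[OF f(2)[of j], of \<delta>] d(1) by (simp add: distrib_right)
      finally show "minimal_function Q t i j * f j \<le> jump_prod Q xs i j * f j + \<delta>" .
    qed
    also have "\<dots> = (\<Sum>j\<in>F. jump_prod Q xs i j * f j) + card F * \<delta>" by (simp add: sum.distrib)
    also have "(\<Sum>j\<in>F. jump_prod Q xs i j * f j) \<le> (\<Sum>\<^sub>\<infinity>j. jump_prod Q xs i j * f j)"
      by (intro finite_sum_le_infsum substoch_summable_mult[OF sX fa] F)
         (auto intro: mult_nonneg_nonneg substochD(1)[OF sX] f)
    also have "\<dots> \<le> c" by (rule le[OF xs(1)])
    finally show "(\<Sum>j\<in>F. minimal_function Q t i j * f j) \<le> c + \<epsilon>" using d(2) by simp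
  qed
qed

context
  fixes a :: "nat ^ 'n::finite \<Rightarrow> real" and b :: "'n \<Rightarrow> nat ^ 'n \<Rightarrow> real"
  assumes a: "weak_rates_at 0 a" and b: "\<And>k. weak_rates_at (unit_index k) (b k)"
begin

text \<open>An individual of any type branches at a rate at most this sum over the types, so
  \<open>c = total_rate\<close> is a common death rate for the comparison.\<close>

definition total_rate :: real where
  "total_rate = (\<Sum>k\<in>UNIV. - b k (unit_index k))"

text \<open>Since \<open>\<rho> \<le> 1\<close>, the worst a jump can do is to lower the population
  by one. Immigration cannot do that, so only the branching rates enter the bound.\<close>

lemma jump_step_power_le:
  assumes \<rho>: "0 \<le> \<rho>" "\<rho> \<le> 1" and h: "0 \<le> h"
  shows "(\<Sum>\<^sub>\<infinity>j. jump_step (bi_matrix a b) h i j * \<rho> ^ msize j) \<le> (1 - (1 - \<rho>) * exp (- (total_rate * h))) ^ msize i"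
proof -
  let ?Q = "bi_matrix a b" and ?f = "\<lambda>j :: nat ^ 'n. \<rho> ^ msize j"
  have f: "0 \<le> ?f j" "?f j \<le> 1" "\<bar>?f j\<bar> \<le> 1" for j using \<rho> by (auto simp: power_le_one)
  note Q = q_matrix_bi_matrix[OF a b]
  define \<theta> where "\<theta> = (\<Sum>k\<in>UNIV. real (i $ k) * - b k (unit_index k))"
  have bk: "0 \<le> - b k (unit_index k)" for k using weak_rates_diag_nonpos[OF b, of k] by simp
  have \<theta>: "0 \<le> \<theta>" "\<theta> \<le> total_rate * real (msize i)" "0 \<le> total_rate"
  proof -
    show "0 \<le> \<theta>" unfolding \<theta>_def using bk by (intro sum_nonneg mult_nonneg_nonneg) auto
    show "0 \<le> total_rate" unfolding total_rate_def using bk by (intro sum_nonneg) auto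
    have "\<theta> \<le> (\<Sum>k\<in>UNIV. real (msize i) * - b k (unit_index k))"
      unfolding \<theta>_def using bk component_le_msize by (intro sum_mono mult_right_mono) auto
    then show "\<theta> \<le> total_rate * real (msize i)" by (simp add: total_rate_def sum_distrib_left mult.commute)
  qed
  have a0: "a 0 \<le> 0" by (rule weak_rates_diag_nonpos[OF a])
  have diag: "?Q i i = a 0 - \<theta>" by (simp add: bi_matrix_diag[OF a b] \<theta>_def sum_negf)
  have "(\<Sum>\<^sub>\<infinity>j. ?Q i j * ?f j) = (\<Sum>\<^sub>\<infinity>l. a l * ?f (i + l))
      + (\<Sum>k\<in>UNIV. real (i $ k) * (\<Sum>\<^sub>\<infinity>l. b k l * ?f (i - unit_index k + l)))"
    by (rule infsumI[OF bi_matrix_apply[OF weak_rates_atD(2)[OF a] weak_rates_atD(2)[OF b]]]) (rule f)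
  also have "\<dots> \<le> 0 + (\<Sum>k\<in>UNIV. real (i $ k) * (b k (unit_index k) * (?f i - \<rho> ^ (msize i - 1))))"
  proof (intro add_mono sum_mono)
    have "(\<Sum>\<^sub>\<infinity>l. a l * ?f (i + l)) \<le> a 0 * (?f (i + 0) - ?f i)"
      using \<rho> by (intro weak_rates_at_tail_le[OF a]) (auto intro!: power_decreasing)
    then show "(\<Sum>\<^sub>\<infinity>l. a l * ?f (i + l)) \<le> 0" by simp
    fix k
    show "real (i $ k) * (\<Sum>\<^sub>\<infinity>l. b k l * ?f (i - unit_index k + l))
       \<le> real (i $ k) * (b k (unit_index k) * (?f i - \<rho> ^ (msize i - 1)))"
    proof (cases "i $ k = 0")
      case False
      then have i: "i - unit_index k + unit_index k = i" by (intro multi_index_minus_unit) simp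
      have m: "msize (i - unit_index k) = msize i - 1" using arg_cong[OF i, of msize] by simp
      have "(\<Sum>\<^sub>\<infinity>l. b k l * ?f (i - unit_index k + l))
         \<le> b k (unit_index k) * (?f (i - unit_index k + unit_index k) - \<rho> ^ (msize i - 1))"
        using \<rho> m by (intro weak_rates_at_tail_le[OF b]) (auto intro!: power_decreasing)
      then show ?thesis unfolding i by (intro mult_left_mono) auto
    qed simp
  qed
  also have "\<dots> = \<theta> * (\<rho> ^ (msize i - 1) - ?f i)"
    unfolding \<theta>_def sum_distrib_right add_0_left by (intro sum.cong) (simp_all add: algebra_simps)
  finally have "(\<Sum>\<^sub>\<infinity>j. ?Q i j * ?f j) \<le> \<theta> * (\<rho> ^ (msize i - 1) - ?f i)" .
  moreover have "(\<Sum>\<^sub>\<infinity>j. ((?Q i)(i := 0)) j * ?f j) = (\<Sum>\<^sub>\<infinity>j. ?Q i j * ?f j) - ?Q i i * ?f i"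
  proof -
    have "(\<lambda>j. ((?Q i)(i := 0)) j * ?f j) = (\<lambda>j. ?Q i j * ?f j)(i := 0)" by auto
    moreover have "(\<lambda>j. ?Q i j * ?f j) summable_on UNIV"
      by (rule summable_mult_bounded[OF q_matrixD(2)[OF Q] f(3)])
    ultimately show ?thesis
      using infsum_fun_upd[of "\<lambda>j. ?Q i j * ?f j" i 0] by (simp del: fun_upd_apply)
  qed
  ultimately have off: "(\<Sum>\<^sub>\<infinity>j. ((?Q i)(i := 0)) j * ?f j) \<le> \<theta> * \<rho> ^ (msize i - 1) - a 0 * ?f i"
    by (simp add: diag algebra_simps)
  have "(\<Sum>\<^sub>\<infinity>j. jump_step ?Q h i j * ?f j) \<le> exp (h * ?Q i i) * (?f i + h * (\<Sum>\<^sub>\<infinity>j. ((?Q i)(i := 0)) j * ?f j))"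
    by (rule jump_step_apply_le(2)[OF Q h f(1,2)])
  also have "\<dots> \<le> exp (h * ?Q i i) * (?f i + h * (\<theta> * \<rho> ^ (msize i - 1) - a 0 * ?f i))"
    by (intro mult_left_mono add_left_mono off h) auto
  also have "\<dots> = exp (- (h * \<theta>)) * (exp (h * a 0) * ((1 - h * a 0) * ?f i) + exp (h * a 0) * (h * \<theta> * \<rho> ^ (msize i - 1)))"
    unfolding diag by (simp add: algebra_simps exp_diff exp_minus divide_inverse)
  \<comment> \<open>The immigration rate drops out because
    \<open>1 - h * a 0 \<le> exp (- (h * a 0))\<close>.\<close>
  also have "\<dots> \<le> exp (- (h * \<theta>)) * (1 * ?f i + 1 * (h * \<theta> * \<rho> ^ (msize i - 1)))"
  proof (intro mult_left_mono add_mono mult_right_mono)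
    have "exp (h * a 0) * (1 - h * a 0) \<le> exp (h * a 0) * exp (- (h * a 0))"
      using exp_ge_add_one_self[of "- (h * a 0)"] by (intro mult_left_mono) auto
    then have "exp (h * a 0) * (1 - h * a 0) \<le> 1" by (simp flip: exp_add)
    then show "exp (h * a 0) * ((1 - h * a 0) * ?f i) \<le> 1 * ?f i"
      using mult_right_mono[OF _ f(1)] by (metis mult.assoc)
    show "exp (h * a 0) \<le> 1" using h a0 by (simp add: mult_nonneg_nonpos)
    show "0 \<le> h * \<theta> * \<rho> ^ (msize i - 1)" using h \<theta> \<rho> by simp
  qed auto
  also have "\<dots> \<le> (1 - (1 - \<rho>) * exp (- (total_rate * h))) ^ msize i"
    using exp_contraction_power[OF \<rho> h \<theta>] by simp
  finally show ?thesis .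
qed

text \<open>The maps taking \<open>\<rho>\<close> to
  \<open>1 - (1 - \<rho>) * exp (- (c * h))\<close> form a semigroup in \<open>h\<close>. Iterating
  the one-step bound along a partition therefore gives a bound that depends on the total time only
  and survives the supremum.\<close>

lemma minimal_function_power_le:
  assumes \<rho>: "0 \<le> \<rho>" "\<rho> \<le> 1" and t: "0 \<le> t"
  shows "(\<Sum>\<^sub>\<infinity>j. minimal_function (bi_matrix a b) t i j * \<rho> ^ msize j)
    \<le> (1 - (1 - \<rho>) * exp (- (total_rate * t))) ^ msize i"
proof (rule minimal_function_apply_le[OF q_matrix_bi_matrix[OF a b] t])
  let ?Q = "bi_matrix a b"
  note Q = q_matrix_bi_matrix[OF a b]
  have c: "0 \<le> total_rate"
    unfolding total_rate_def using weak_rates_diag_nonpos[OF b] by (intro sum_nonneg) simp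
  show "(\<Sum>\<^sub>\<infinity>j. jump_prod ?Q xs i j * \<rho> ^ msize j) \<le> (1 - (1 - \<rho>) * exp (- (total_rate * t))) ^ msize i"
    if "xs \<in> partitions t" for xs
    using that
  proof (induction xs arbitrary: t i)
    case Nil
    then show ?case by (simp add: id_kernel_def if_distrib[of "\<lambda>x. x * _"] cong: if_cong)
  next
    case (Cons x xs)
    then have x: "0 \<le> x" "xs \<in> partitions (t - x)" by auto
    note tx = partitions_nonneg[OF x(2)]
    define \<rho>' where "\<rho>' = 1 - (1 - \<rho>) * exp (- (total_rate * (t - x)))"
    have "(1 - \<rho>) * exp (- (total_rate * (t - x))) \<le> 1 * 1"
      using \<rho> c tx by (intro mult_mono) auto
    moreover have "0 \<le> (1 - \<rho>) * exp (- (total_rate * (t - x)))" using \<rho> by simp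
    ultimately have \<rho>': "0 \<le> \<rho>'" "\<rho>' \<le> 1" by (simp_all add: \<rho>'_def)
    have pw: "\<bar>r ^ m\<bar> \<le> 1" if "0 \<le> r" "r \<le> 1" for r :: real and m
      using that by (simp add: power_abs power_le_one)
    note sL = substoch_jump_step[OF Q x(1)] and sX = substoch_jump_prod[OF Q x(2)]
    have "(\<Sum>\<^sub>\<infinity>j. jump_prod ?Q (x # xs) i j * \<rho> ^ msize j)
        = (\<Sum>\<^sub>\<infinity>k. jump_step ?Q x i k * (\<Sum>\<^sub>\<infinity>j. jump_prod ?Q xs k j * \<rho> ^ msize j))"
      unfolding jump_prod.simps by (rule kcomp_apply[OF sL sX pw]) (use \<rho> in auto)
    also have "\<dots> \<le> (\<Sum>\<^sub>\<infinity>k. jump_step ?Q x i k * \<rho>' ^ msize k)"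
    proof (intro infsum_mono mult_left_mono)
      show "(\<lambda>k. jump_step ?Q x i k * (\<Sum>\<^sub>\<infinity>j. jump_prod ?Q xs k j * \<rho> ^ msize j)) summable_on UNIV"
        by (rule substoch_summable_mult[OF sL], rule substoch_abs_infsum_le[OF sX], rule pw) (use \<rho> in auto)
      show "(\<lambda>k. jump_step ?Q x i k * \<rho>' ^ msize k) summable_on UNIV"
        by (rule substoch_summable_mult[OF sL], rule pw) (use \<rho>' in auto)
      show "(\<Sum>\<^sub>\<infinity>j. jump_prod ?Q xs k j * \<rho> ^ msize j) \<le> \<rho>' ^ msize k" for k
        unfolding \<rho>'_def by (rule Cons.IH[OF x(2)])
    qed (rule substochD(1)[OF sL])
    also have "\<dots> \<le> (1 - (1 - \<rho>') * exp (- (total_rate * x))) ^ msize i"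
      by (rule jump_step_power_le[OF \<rho>' x(1)])
    also have "(1 - \<rho>') * exp (- (total_rate * x)) = (1 - \<rho>) * exp (- (total_rate * t))"
      by (simp add: \<rho>'_def algebra_simps flip: exp_add)
    finally show ?case .
  qed
qed (use \<rho> in \<open>auto simp: power_le_one\<close>)

lemma minimal_gen_fun_bound:
  assumes \<rho>: "0 \<le> \<rho>" "\<rho> < 1" and T: "0 \<le> T"
  obtains r where "0 \<le> r" "r < 1"
    "\<And>t s i. 0 \<le> t \<Longrightarrow> t \<le> T \<Longrightarrow> s \<in> corner_box \<rho> \<Longrightarrow> \<bar>gen_fun (minimal_function (bi_matrix a b)) i t s\<bar> \<le> r ^ msize i"
proof
  let ?P = "minimal_function (bi_matrix a b)"
  note P = Q_function_transition[OF Q_function_minimal_function[OF q_matrix_bi_matrix[OF a b]]]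
  have c: "0 \<le> total_rate"
    unfolding total_rate_def using weak_rates_diag_nonpos[OF b] by (intro sum_nonneg) simp
  let ?r = "1 - (1 - \<rho>) * exp (- (total_rate * T))"
  have "(1 - \<rho>) * exp (- (total_rate * T)) \<le> 1 * 1"
    using \<rho> c T by (intro mult_mono) auto
  then show "0 \<le> ?r" by simp
  show "?r < 1" using \<rho> by simp
  fix t :: real and s :: "real ^ 'n" and i assume t: "0 \<le> t" "t \<le> T" and s: "s \<in> corner_box \<rho>"
  have s1: "s \<in> corner_box 1" using s corner_box_mono[of \<rho> 1] \<rho> by auto
  have pw: "\<bar>\<rho> ^ m\<bar> \<le> 1" for m using \<rho> by (simp add: power_abs power_le_one)
  have "gen_fun ?P i t s \<le> (\<Sum>\<^sub>\<infinity>j. ?P t i j * \<rho> ^ msize j)"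
    unfolding gen_fun_def
  proof (intro infsum_mono mult_left_mono)
    show "(\<lambda>j. ?P t i j * mono_pow s j) summable_on UNIV"
      using s1 corner_box_subset_unit_cube[of 1] by (intro gen_fun_summable P t) auto
    show "(\<lambda>j. ?P t i j * \<rho> ^ msize j) summable_on UNIV"
      by (rule substoch_summable_mult[OF transition_substoch[OF P t(1)] pw])
  qed (use mono_pow_corner_box(2)[OF s] transition_nonneg[OF P t(1)] in auto)
  also have "\<dots> \<le> (1 - (1 - \<rho>) * exp (- (total_rate * t))) ^ msize i"
    using \<rho> t by (intro minimal_function_power_le) auto
  also have "\<dots> \<le> ?r ^ msize i"
  proof (rule power_mono)
    show "1 - (1 - \<rho>) * exp (- (total_rate * t)) \<le> ?r"
      using \<rho> c t by (intro diff_left_mono mult_left_mono) (auto intro: mult_left_mono)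
    have "(1 - \<rho>) * exp (- (total_rate * t)) \<le> 1 * 1"
      using \<rho> c t by (intro mult_mono) auto
    then show "0 \<le> 1 - (1 - \<rho>) * exp (- (total_rate * t))" by simp
  qed
  finally show "\<bar>gen_fun ?P i t s\<bar> \<le> ?r ^ msize i"
    using gen_fun_nonneg[OF P t(1) s1] by simp
qed

end

section \<open>The branching property of the minimal process\<close>

lemma infsum_mult_combination:
  fixes q x y :: "'a \<Rightarrow> real"
  assumes q: "q summable_on UNIV" and x: "\<And>j. \<bar>x j\<bar> \<le> C" and y: "\<And>j. \<bar>y j\<bar> \<le> C"
  shows "(\<Sum>\<^sub>\<infinity>j. q j * (\<sigma> * (x j - y j * c))) = \<sigma> * ((\<Sum>\<^sub>\<infinity>j. q j * x j) - (\<Sum>\<^sub>\<infinity>j. q j * y j) * c)"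
proof -
  have s: "(\<lambda>j. q j * x j) summable_on UNIV" "(\<lambda>j. q j * y j * c) summable_on UNIV"
    using summable_mult_bounded[OF q x] summable_mult_bounded[OF q y] by (auto intro: summable_on_cmult_left)
  have "(\<Sum>\<^sub>\<infinity>j. q j * (\<sigma> * (x j - y j * c))) = (\<Sum>\<^sub>\<infinity>j. \<sigma> * (q j * x j - q j * y j * c))"
    by (intro infsum_cong) (simp add: algebra_simps)
  also have "\<dots> = \<sigma> * ((\<Sum>\<^sub>\<infinity>j. q j * x j) - (\<Sum>\<^sub>\<infinity>j. q j * y j) * c)"
    by (simp add: infsum_cmult_right' infsum_diff_real[OF s] infsum_cmult_left')
  finally show ?thesis .
qed

context
  fixes a :: "nat ^ 'n::finite \<Rightarrow> real" and b :: "'n \<Rightarrow> nat ^ 'n \<Rightarrow> real"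
  assumes a: "weak_rates_at 0 a" and b: "\<And>k. weak_rates_at (unit_index k) (b k)"
begin

text \<open>The difference of both sides solves the backward equation on pairs \<open>(i, i')\<close>, because the
  rates at \<open>i + i'\<close> are those at \<open>i\<close> plus the immigration-free ones at \<open>i'\<close>.\<close>

lemma minimal_gen_fun_split:
  assumes t: "0 \<le> t" and s: "s \<in> corner_box (1 / 2)"
  shows "gen_fun (minimal_function (bi_matrix a b)) (i + i') t s
    = gen_fun (minimal_function (bi_matrix a b)) i t s * gen_fun (minimal_function (bi_matrix (\<lambda>_. 0) b)) i' t s"
proof -
  let ?Q = "bi_matrix a b" and ?Q' = "bi_matrix (\<lambda>_. 0) b"
  let ?P = "minimal_function ?Q" and ?P' = "minimal_function ?Q'"
  note Q = q_matrix_bi_matrix[OF a b] and Q' = q_matrix_bi_matrix[OF weak_rates_at_0 b]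
  note PQ = Q_function_minimal_function[OF Q] and PQ' = Q_function_minimal_function[OF Q']
  note P = Q_function_transition[OF PQ] and P' = Q_function_transition[OF PQ']
  let ?F = "\<lambda>u i. gen_fun ?P i u s" and ?F' = "\<lambda>u i. gen_fun ?P' i u s"
  have s1: "s \<in> corner_box 1" using s corner_box_mono[of "1/2" 1] by auto
  have sc: "s \<in> unit_cube" using s1 corner_box_subset_unit_cube[of 1] by auto
  obtain r1 where r1: "0 \<le> r1" "r1 < 1"
    "\<And>u z i. 0 \<le> u \<Longrightarrow> u \<le> t \<Longrightarrow> z \<in> corner_box (1 / 2) \<Longrightarrow> \<bar>gen_fun ?P i u z\<bar> \<le> r1 ^ msize i"
    by (rule minimal_gen_fun_bound[OF a b, of "1/2" t]) (simp_all add: t)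
  obtain r2 where r2: "0 \<le> r2" "r2 < 1"
    "\<And>u z i. 0 \<le> u \<Longrightarrow> u \<le> t \<Longrightarrow> z \<in> corner_box (1 / 2) \<Longrightarrow> \<bar>gen_fun ?P' i u z\<bar> \<le> r2 ^ msize i"
    by (rule minimal_gen_fun_bound[OF weak_rates_at_0 b, of "1/2" t]) (simp_all add: t)
  define r where "r = max r1 r2"
  have r: "0 \<le> r" "r < 1" using r1 r2 by (auto simp: r_def)
  have F: "\<bar>?F u i\<bar> \<le> r ^ msize i" if "0 \<le> u" "u \<le> t" for u i
    using r1(3)[OF that s, of i] power_mono[of r1 r "msize i"] r1(1) by (auto simp: r_def)
  have F': "\<bar>?F' u i\<bar> \<le> r ^ msize i" if "0 \<le> u" "u \<le> t" for u i
    using r2(3)[OF that s, of i] power_mono[of r2 r "msize i"] r2(1) by (auto simp: r_def)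
  have F0: "0 \<le> ?F u i" "0 \<le> ?F' u i" if "0 \<le> u" for u i
    using gen_fun_nonneg[OF P that s1] gen_fun_nonneg[OF P' that s1] by auto
  have van: "vanishes_at_infinity (\<lambda>i :: nat ^ 'n. r ^ msize i)"
    by (rule vanishes_at_infinity_power[OF r finite_msize_le])
  have dF: "((\<lambda>u. ?F u i) has_real_derivative (\<Sum>\<^sub>\<infinity>k. ?Q i k * ?F u k)) (at_left u)" if "0 < u" "u \<le> t" for u i
    using that by (intro gen_fun_left_derivative[OF PQ sc _ van] F) auto
  have dF': "((\<lambda>u. ?F' u i) has_real_derivative (\<Sum>\<^sub>\<infinity>k. ?Q' i k * ?F' u k)) (at_left u)" if "0 < u" "u \<le> t" for u i
    using that by (intro gen_fun_left_derivative[OF PQ' sc _ van] F') auto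
  \<comment> \<open>The sign \<open>\<sigma>\<close> yields both inequalities from a single
    application of the maximum principle.\<close>
  have main: "\<sigma> * (?F t (i + i') - ?F t i * ?F' t i') \<le> 0" if \<sigma>: "\<bar>\<sigma>\<bar> = 1" for \<sigma> :: real and i i'
  proof -
    define v where "v = (\<lambda>u (x :: (nat ^ 'n) \<times> (nat ^ 'n)). \<sigma> * (?F u (fst x + snd x) - ?F u (fst x) * ?F' u (snd x)))"
    define sz where "sz = (\<lambda>x :: (nat ^ 'n) \<times> (nat ^ 'n). msize (fst x) + msize (snd x))"
    have fin: "finite {x. sz x \<le> N}" for N
      by (rule finite_subset[OF _ finite_cartesian_product[OF finite_msize_le[of N] finite_msize_le[of N]]])
         (auto simp: sz_def)
    have vr: "\<bar>v u x\<bar> \<le> r ^ sz x" if u: "0 \<le> u" "u \<le> t" for u x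
    proof -
      have 1: "0 \<le> ?F u (fst x + snd x)" "?F u (fst x + snd x) \<le> r ^ sz x"
        using F0[OF u(1)] F[OF u, of "fst x + snd x"] by (auto simp: sz_def)
      have "?F u (fst x) * ?F' u (snd x) \<le> r ^ msize (fst x) * r ^ msize (snd x)"
        using F[OF u, of "fst x"] F'[OF u, of "snd x"] F0[OF u(1)] r by (intro mult_mono) auto
      then have 2: "?F u (fst x) * ?F' u (snd x) \<le> r ^ sz x" by (simp add: sz_def power_add)
      have 3: "0 \<le> ?F u (fst x) * ?F' u (snd x)" using F0[OF u(1)] by simp
      have "\<bar>v u x\<bar> = \<bar>?F u (fst x + snd x) - ?F u (fst x) * ?F' u (snd x)\<bar>" using \<sigma> by (simp add: v_def abs_mult)
      then show ?thesis using 1 2 3 by linarith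
    qed
    have "v t (i, i') \<le> 0"
    proof (rule maximum_principle[of t v "\<lambda>x. r ^ sz x"])
      show "continuous_on {0..t} (\<lambda>u. v u x)" for x
        unfolding v_def by (intro continuous_intros continuous_on_subset[OF gen_fun_continuous[OF P sc]]
            continuous_on_subset[OF gen_fun_continuous[OF P' sc]]) auto
      show "v 0 x \<le> 0" for x
        by (simp add: v_def gen_fun_0[OF P] gen_fun_0[OF P'] mono_pow_add)
      show "vanishes_at_infinity (\<lambda>x. r ^ sz x)"
        by (rule vanishes_at_infinity_power[OF r fin])
      show "v u x \<le> r ^ sz x" if "0 \<le> u" "u \<le> t" for u x
        using vr[OF that, of x] by simp
      fix u x assume u: "0 < u" "u \<le> t" and pos: "0 < v u x" and max: "\<And>y. v u y \<le> v u x"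
      obtain i i' where x: "x = (i, i')" by fastforce
      have u0: "0 \<le> u" using u by simp
      have F1: "\<bar>?F u j\<bar> \<le> 1" and F1': "\<bar>?F' u j\<bar> \<le> 1" for j
        using gen_fun_abs_le_1[OF P u0 sc] gen_fun_abs_le_1[OF P' u0 sc] by auto
      have v1: "\<bar>v u y\<bar> \<le> 1" for y
        using vr[OF u0 u(2), of y] r power_le_one[of r "sz y"] by linarith
      define D where "D = \<sigma> * ((\<Sum>\<^sub>\<infinity>k. ?Q (i + i') k * ?F u k)
        - ((\<Sum>\<^sub>\<infinity>k. ?Q i k * ?F u k) * ?F' u i' + (\<Sum>\<^sub>\<infinity>k. ?Q' i' k * ?F' u k) * ?F u i))"
      have "((\<lambda>u. v u x) has_real_derivative D) (at_left u)"
        unfolding v_def x D_def fst_conv snd_conv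
        by (intro DERIV_cmult DERIV_diff DERIV_mult dF dF' u)
      \<comment> \<open>The generator on pairs: \<open>?Q\<close> acts on the first component and
        \<open>?Q'\<close> on the second. At a maximum over pairs each of the two sums is at most
        0.\<close>
      moreover have "D = (\<Sum>\<^sub>\<infinity>j. ?Q i j * v u (j, i')) + (\<Sum>\<^sub>\<infinity>j. ?Q' i' j * v u (i, j))"
      proof -
        have 1: "(\<Sum>\<^sub>\<infinity>j. ?Q i j * v u (j, i'))
          = \<sigma> * ((\<Sum>\<^sub>\<infinity>j. ?Q i j * ?F u (j + i')) - (\<Sum>\<^sub>\<infinity>j. ?Q i j * ?F u j) * ?F' u i')"
          unfolding v_def fst_conv snd_conv by (rule infsum_mult_combination[OF q_matrixD(2)[OF Q]]) (rule F1)+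
        have 2: "(\<Sum>\<^sub>\<infinity>j. ?Q' i' j * v u (i, j))
          = \<sigma> * ((\<Sum>\<^sub>\<infinity>j. ?Q' i' j * ?F u (i + j)) - (\<Sum>\<^sub>\<infinity>j. ?Q' i' j * ?F' u j) * ?F u i)"
          unfolding v_def fst_conv snd_conv mult.commute[of "?F u i"]
          by (rule infsum_mult_combination[OF q_matrixD(2)[OF Q']]) (rule F1 F1')+
        show ?thesis
          unfolding 1 2 D_def bi_matrix_apply_add[OF a b F1] by (simp add: algebra_simps)
      qed
      moreover have "(\<Sum>\<^sub>\<infinity>j. ?Q i j * v u (j, i')) \<le> 0"
        using max pos x by (intro q_matrix_apply_at_max[OF Q v1]) auto
      moreover have "(\<Sum>\<^sub>\<infinity>j. ?Q' i' j * v u (i, j)) \<le> 0"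
        using max pos x by (intro q_matrix_apply_at_max[OF Q' v1]) auto
      ultimately show "\<exists>D\<le>0. ((\<lambda>u. v u x) has_real_derivative D) (at_left u)"
        by (intro exI[of _ D]) auto
    qed (use t in auto)
    then show ?thesis by (simp add: v_def)
  qed
  show ?thesis using main[of 1 i i'] main[of "-1" i i'] by simp
qed

text \<open>On \<open>corner_box (1 / 2)\<close> individuals are split off one at a time; both sides
  are power series on the cube, so they agree on all of it.\<close>

lemma minimal_gen_fun_factorizes:
  assumes t: "0 \<le> t" and s: "s \<in> unit_cube"
  shows "gen_fun (minimal_function (bi_matrix a b)) i t s = gen_fun (minimal_function (bi_matrix a b)) 0 t s
    * (\<Prod>k\<in>UNIV. gen_fun (minimal_function (bi_matrix (\<lambda>_. 0) b)) (unit_index k) t s ^ (i $ k))"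
proof (rule cube_series_eq[OF _ _ _ s])
  let ?P = "minimal_function (bi_matrix a b)" and ?P' = "minimal_function (bi_matrix (\<lambda>_. 0) b)"
  note P = Q_function_transition[OF Q_function_minimal_function[OF q_matrix_bi_matrix[OF a b]]]
    and P' = Q_function_transition[OF Q_function_minimal_function[OF q_matrix_bi_matrix[OF weak_rates_at_0 b]]]
  show "cube_series (gen_fun ?P i t)" by (rule gen_fun_cube_series[OF P t])
  show "cube_series (\<lambda>s. gen_fun ?P 0 t s * (\<Prod>k\<in>UNIV. gen_fun ?P' (unit_index k) t s ^ (i $ k)))"
    by (intro cube_series_mult cube_series_prod cube_series_power gen_fun_cube_series P P' t finite)
  fix s :: "real ^ 'n" assume s: "s \<in> corner_box (1 / 2)"
  have prod: "(\<Prod>k\<in>UNIV. gen_fun ?P' (unit_index k) t s ^ (i $ k))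
      = mono_pow (\<chi> k. gen_fun ?P' (unit_index k) t s) i" for i
    by (simp add: mono_pow_def)
  show "gen_fun ?P i t s = gen_fun ?P 0 t s * (\<Prod>k\<in>UNIV. gen_fun ?P' (unit_index k) t s ^ (i $ k))"
    unfolding prod
  proof (induction i rule: multi_index_induct)
    case (add_unit i k)
    have "gen_fun ?P (i + unit_index k) t s = gen_fun ?P i t s * gen_fun ?P' (unit_index k) t s"
      by (rule minimal_gen_fun_split[OF t s])
    then show ?case using add_unit by (simp add: mono_pow_add)
  qed simp
qed

section \<open>Uniqueness\<close>

text \<open>Minimality makes the difference of the generating functions nonnegative, and lets the
  smaller one inherit vanishing at infinity. Both obey the same backward equation, so the maximum
  principle bounds the difference from above by 0. The semigroup property extends equality beyond
  \<open>\<tau>\<close>.\<close>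

lemma Q_function_eq_minimal:
  assumes PQ: "Q_function (bi_matrix a b) P" and \<tau>: "0 < \<tau>"
    and van: "\<And>s. s \<in> corner_box (1 / 2) \<Longrightarrow> \<exists>g. vanishes_at_infinity g \<and>
      (\<forall>t i. 0 \<le> t \<longrightarrow> t \<le> \<tau> \<longrightarrow> \<bar>gen_fun P i t s\<bar> \<le> g i)"
    and t: "0 \<le> t"
  shows "P t = minimal_function (bi_matrix a b) t"
proof -
  let ?Q = "bi_matrix a b"
  let ?M = "minimal_function ?Q"
  note Q = q_matrix_bi_matrix[OF a b]
  note MQ = Q_function_minimal_function[OF Q]
  note M = Q_function_transition[OF MQ] and P = Q_function_transition[OF PQ]
  have short: "P t = ?M t" if t: "0 \<le> t" "t \<le> \<tau>" for t
  proof (rule gen_fun_eqD[OF P M t(1)])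
    fix i and s :: "real ^ 'n" assume s: "s \<in> corner_box (1 / 2)"
    let ?F = "\<lambda>u i. gen_fun P i u s" and ?F' = "\<lambda>u i. gen_fun ?M i u s"
    have s1: "s \<in> corner_box 1" using s corner_box_mono[of "1/2" 1] by auto
    have sc: "s \<in> unit_cube" using s1 corner_box_subset_unit_cube[of 1] by auto
    obtain g where g: "vanishes_at_infinity g" "\<And>u i. 0 \<le> u \<Longrightarrow> u \<le> \<tau> \<Longrightarrow> \<bar>?F u i\<bar> \<le> g i"
      using van[OF s] by blast
    have le: "?F' u i \<le> ?F u i" if "0 \<le> u" for u i
      unfolding gen_fun_def
      using that sc mono_pow_corner_box(1)[OF s1] minimal_function_le_Q_function[OF PQ that]
      by (intro infsum_mono gen_fun_summable M P mult_right_mono) auto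
    have F0': "0 \<le> ?F' u i" if "0 \<le> u" for u i by (rule gen_fun_nonneg[OF M that s1])
    have Fg': "\<bar>?F' u i\<bar> \<le> g i" if "0 \<le> u" "u \<le> \<tau>" for u i
      using F0'[OF that(1), of i] le[OF that(1), of i] g(2)[OF that, of i] by linarith
    have "?F t i - ?F' t i \<le> 0"
    proof (rule maximum_principle[of \<tau> "\<lambda>u i. ?F u i - ?F' u i" g])
      show "continuous_on {0..\<tau>} (\<lambda>u. ?F u i - ?F' u i)" for i
        by (intro continuous_intros continuous_on_subset[OF gen_fun_continuous[OF P sc]]
            continuous_on_subset[OF gen_fun_continuous[OF M sc]]) auto
      show "?F 0 i - ?F' 0 i \<le> 0" for i by (simp add: gen_fun_0[OF P] gen_fun_0[OF M])
      show "?F u i - ?F' u i \<le> g i" if "0 \<le> u" "u \<le> \<tau>" for u i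
        using F0'[OF that(1), of i] g(2)[OF that, of i] by linarith
      fix u i assume u: "0 < u" "u \<le> \<tau>" and pos: "0 < ?F u i - ?F' u i"
        and max: "\<And>j. ?F u j - ?F' u j \<le> ?F u i - ?F' u i"
      have u0: "0 \<le> u" using u by simp
      have F1: "\<bar>?F u j\<bar> \<le> 1" "\<bar>?F' u j\<bar> \<le> 1" for j
        using gen_fun_abs_le_1[OF P u0 sc] gen_fun_abs_le_1[OF M u0 sc] by auto
      let ?D = "(\<Sum>\<^sub>\<infinity>k. ?Q i k * ?F u k) - (\<Sum>\<^sub>\<infinity>k. ?Q i k * ?F' u k)"
      have "((\<lambda>u. ?F u i - ?F' u i) has_real_derivative ?D) (at_left u)"
        using u by (intro DERIV_diff gen_fun_left_derivative[OF PQ sc _ g(1)] gen_fun_left_derivative[OF MQ sc _ g(1)] g(2) Fg') auto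
      moreover have "?D = (\<Sum>\<^sub>\<infinity>k. ?Q i k * (?F u k - ?F' u k))"
        using infsum_mult_combination[OF q_matrixD(2)[OF Q], of "?F u" 1 "?F' u" i 1 1] F1 by simp
      moreover have "\<dots> \<le> 0"
      proof (rule q_matrix_apply_at_max[OF Q])
        show "\<bar>?F u j - ?F' u j\<bar> \<le> 2" for j using F1[of j] by linarith
      qed (use max pos in auto)
      ultimately show "\<exists>D\<le>0. ((\<lambda>u. ?F u i - ?F' u i) has_real_derivative D) (at_left u)"
        by (intro exI[of _ ?D]) simp
    qed (use g t in auto)
    with le[OF t(1), of i] show "?F t i = ?F' t i" by simp
  qed
  have "P t = ?M t" if "0 \<le> t" "t \<le> real m * \<tau>" for m t
    using that
  proof (induction m arbitrary: t)
    case 0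
    then show ?case using short[of 0] \<tau> by simp
  next
    case (Suc m)
    show ?case
    proof (cases "t \<le> \<tau>")
      case False
      then have "P (t - \<tau>) = ?M (t - \<tau>)" using Suc.prems by (intro Suc.IH) (auto simp: algebra_simps)
      moreover have "P \<tau> = ?M \<tau>" using \<tau> by (intro short) auto
      ultimately show ?thesis
        using transition_add[OF P, of \<tau> "t - \<tau>"] transition_add[OF M, of \<tau> "t - \<tau>"] \<tau> False by simp
    qed (use short Suc.prems in auto)
  qed
  moreover obtain m where "t / \<tau> \<le> real m" using real_arch_simple by blast
  ultimately show ?thesis using t \<tau> by (simp add: pos_divide_le_eq)
qed

end

section \<open>The quotient semigroup\<close>

lemma mono_pow_axis: "mono_pow s (axis k m) = (s $ k) ^ m"
proof -
  have "mono_pow s (axis k m) = (\<Prod>l\<in>UNIV. if l = k then (s $ l) ^ m else 1)"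
    unfolding mono_pow_def by (intro prod.cong) (auto simp: axis_def)
  then show ?thesis by simp
qed

lemma archimedean_nonneg:
  fixes x c :: real
  assumes "\<And>m. 0 \<le> real (Suc m) * x + c"
  shows "0 \<le> x"
proof (rule ccontr)
  assume "\<not> 0 \<le> x"
  then have x: "0 < - x" by simp
  obtain m where "c < real m * (- x)" using reals_Archimedean3[OF x] by blast
  then have "real (Suc m) * x + c < 0" using x by (simp add: algebra_simps)
  with assms[of m] show False by linarith
qed

locale quotient_factorization =
  fixes P :: "real \<Rightarrow> nat ^ 'n::finite \<Rightarrow> nat ^ 'n \<Rightarrow> real"
  assumes P: "transition_function P" and quot: "factorizes_by_quotients P"
begin

abbreviation F :: "nat ^ 'n \<Rightarrow> real \<Rightarrow> real ^ 'n \<Rightarrow> real" where "F \<equiv> gen_fun P"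

text \<open>Dividing by the immigration factor should leave the generating functions of the
  immigration-free process started from one individual of each type.\<close>

definition G :: "real \<Rightarrow> real ^ 'n \<Rightarrow> real ^ 'n" where
  "G t s = (\<chi> k. F (unit_index k) t s / F 0 t s)"

lemma F_eq: "0 \<le> t \<Longrightarrow> s \<in> unit_cube \<Longrightarrow> F i t s = F 0 t s * mono_pow (G t s) i"
  unfolding G_def mono_pow_def vec_lambda_beta
  by (rule quot[unfolded factorizes_by_quotients_def, rule_format])

lemma box_cube: "s \<in> corner_box 1 \<Longrightarrow> s \<in> unit_cube"
  using corner_box_subset_unit_cube[of 1] by auto

lemma F0_ge: "0 \<le> t \<Longrightarrow> s \<in> corner_box 1 \<Longrightarrow> P t 0 0 \<le> F 0 t s"
  using gen_fun_ge_diag[OF P, of t s 0] by simp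

lemma F0_pos: "0 \<le> t \<Longrightarrow> s \<in> corner_box 1 \<Longrightarrow> 0 < F 0 t s"
  using F0_ge[of t s] transition_diag_pos[OF P, of t 0] by linarith

lemma F_unit: "0 \<le> t \<Longrightarrow> s \<in> corner_box 1 \<Longrightarrow> F (unit_index k) t s = F 0 t s * G t s $ k"
  using F_eq[OF _ box_cube, of t s "unit_index k"] by simp

text \<open>Otherwise the bounded functions \<open>F (axis k m) t s = F 0 t s * (G t s $ k) ^ m\<close> would grow
  exponentially in \<open>m\<close>.\<close>

lemma G_in_box:
  assumes t: "0 \<le> t" and s: "s \<in> corner_box 1"
  shows "G t s \<in> corner_box 1"
proof -
  have "0 \<le> G t s $ k" for k
    unfolding G_def using gen_fun_nonneg[OF P t s] by simp
  moreover have "G t s $ k \<le> 1" for k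
  proof (rule ccontr)
    assume "\<not> G t s $ k \<le> 1"
    then obtain m where m: "1 / F 0 t s < (G t s $ k) ^ m" using real_arch_pow[of "G t s $ k" "1 / F 0 t s"] by auto
    have "F 0 t s * (G t s $ k) ^ m = F (axis k m) t s"
      using F_eq[OF t box_cube[OF s], of "axis k m"] by (simp add: mono_pow_axis)
    also have "\<dots> \<le> 1" using gen_fun_abs_le_1[OF P t box_cube[OF s], of "axis k m"] by simp
    finally show False using m F0_pos[OF t s] by (simp add: pos_divide_less_eq mult.commute)
  qed
  ultimately show ?thesis by (simp add: corner_box_def)
qed

text \<open>By \<open>F_eq\<close> the function of \<open>k\<close> that \<open>P t\<close> is
  applied to is a constant times a monomial in \<open>G h s\<close>; the semigroup law thus becomes
  substitution of \<open>G h s\<close>.\<close>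

lemma F_add:
  assumes t: "0 \<le> t" and h: "0 \<le> h" and s: "s \<in> corner_box 1"
  shows "F i (t + h) s = F 0 h s * F i t (G h s)"
proof -
  have "F i (t + h) s = (\<Sum>\<^sub>\<infinity>k. P t i k * F k h s)" by (rule gen_fun_add[OF P t h box_cube[OF s]])
  also have "\<dots> = (\<Sum>\<^sub>\<infinity>k. F 0 h s * (P t i k * mono_pow (G h s) k))"
  proof (rule infsum_cong)
    show "P t i k * F k h s = F 0 h s * (P t i k * mono_pow (G h s) k)" for k
      by (subst F_eq[OF h box_cube[OF s]]) simp
  qed
  also have "\<dots> = F 0 h s * F i t (G h s)" by (simp add: gen_fun_def infsum_cmult_right')
  finally show ?thesis .
qed

lemma G_add:
  assumes "0 \<le> t" "0 \<le> h" "s \<in> corner_box 1"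
  shows "G (t + h) s = G t (G h s)"
  using F0_pos[OF assms(2,3)] by (simp add: G_def[of "t + h"] G_def[of t] F_add[OF assms])

lemma G_0: "G 0 s = s"
  by (simp add: G_def gen_fun_0[OF P] vec_eq_iff)

subsection \<open>Linear bounds at small times\<close>

lemma box_le_1: "s \<in> corner_box \<rho> \<Longrightarrow> \<rho> \<le> 1 \<Longrightarrow> s \<in> corner_box 1"
  using corner_box_mono[of \<rho> 1] by blast

lemma F_near_monomial:
  assumes "0 \<le> t" "s \<in> corner_box 1"
  shows "\<bar>F i t s - mono_pow s i\<bar> \<le> 2 * (1 - P t i i)"
  using transition_apply_increment(2)[OF P assms(1), of "mono_pow s" 1 i] mono_pow_unit_cube[OF box_cube[OF assms(2)]]
  by (simp add: gen_fun_def)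

text \<open>The row increment has total variation at most \<open>2 * (1 - P t i i)\<close>, and on
  the box with 3/4 all monomials have Lipschitz constant \<open>1 / (1 - 3 / 4) = 4\<close>; hence
  the 8.\<close>

lemma F_near_monomial_Lipschitz:
  assumes t: "0 \<le> t" and x: "x \<in> corner_box (3 / 4)" and y: "y \<in> corner_box (3 / 4)"
    and d: "\<And>k. \<bar>x $ k - y $ k\<bar> \<le> \<delta>"
  shows "\<bar>(F i t x - F i t y) - (mono_pow x i - mono_pow y i)\<bar> \<le> 8 * (1 - P t i i) * \<delta>"
proof -
  have L: "\<bar>mono_pow x j - mono_pow y j\<bar> \<le> 4 * \<delta>" for j
    using mono_pow_Lipschitz[OF x y _ d, where j = j] by (simp add: mult.commute)
  have c: "x \<in> unit_cube" "y \<in> unit_cube"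
    using box_cube[OF box_le_1[OF x]] box_cube[OF box_le_1[OF y]] by simp_all
  have "(\<Sum>\<^sub>\<infinity>j. P t i j * (mono_pow x j - mono_pow y j)) = F i t x - F i t y"
    using infsum_diff_real[OF gen_fun_summable[OF P t c(1)] gen_fun_summable[OF P t c(2)], of i i]
    by (simp add: gen_fun_def right_diff_distrib)
  then show ?thesis
    using transition_apply_increment(2)[OF P t, of "\<lambda>j. mono_pow x j - mono_pow y j" "4 * \<delta>" i] L
    by (simp add: mult_ac)
qed

text \<open>Only the finitely many states 0 and \<open>unit_index k\<close> are involved, so one
  \<open>\<tau>\<close> serves for all. The value 1/100 is small enough for the margins 3/4 and
  \<open>\<delta> / 2\<close> in the next estimates.\<close>

lemma small_time:
  obtains \<tau> where "0 < \<tau>" "\<And>t. 0 \<le> t \<Longrightarrow> t \<le> \<tau> \<Longrightarrow> 1 - P t 0 0 \<le> 1 / 100"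
    "\<And>t k. 0 \<le> t \<Longrightarrow> t \<le> \<tau> \<Longrightarrow> 1 - P t (unit_index k) (unit_index k) \<le> 1 / 100"
proof -
  have "\<forall>\<^sub>F t in at_right 0. 99 / 100 < P t i i" for i
    by (rule order_tendstoD(1)[OF transition_standard[OF P]]) (simp add: id_kernel_def)
  then have "\<forall>\<^sub>F t in at_right 0. \<forall>i\<in>insert 0 (range unit_index). 99 / 100 < P t i i"
    by (intro eventually_ball_finite) auto
  then obtain d where d: "0 < d" "\<And>t. 0 < t \<Longrightarrow> t < d \<Longrightarrow> \<forall>i\<in>insert 0 (range unit_index). 99 / 100 < P t i i"
    by (auto simp: eventually_at_right_field)
  have *: "1 - P t i i \<le> 1 / 100" if "0 \<le> t" "t \<le> d / 2" "i \<in> insert 0 (range unit_index)" for t i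
  proof (cases "t = 0")
    case True
    then show ?thesis by (simp add: transition_0[OF P] id_kernel_def)
  next
    case False
    then have "99 / 100 < P t i i" using d(2)[of t] d(1) that by auto
    then show ?thesis by simp
  qed
  show thesis
    by (rule that[of "d / 2"]) (use d(1) * in auto)
qed

context
  fixes \<tau> :: real
  assumes \<tau>: "0 < \<tau>" and P00: "\<And>t. 0 \<le> t \<Longrightarrow> t \<le> \<tau> \<Longrightarrow> 1 - P t 0 0 \<le> 1 / 100"
    and Pkk: "\<And>t k. 0 \<le> t \<Longrightarrow> t \<le> \<tau> \<Longrightarrow> 1 - P t (unit_index k) (unit_index k) \<le> 1 / 100"
begin

lemma F0_bounds:
  assumes "0 \<le> t" "t \<le> \<tau>" "s \<in> corner_box 1"
  shows "99 / 100 \<le> F 0 t s" "F 0 t s \<le> 1"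
  using F0_ge[OF assms(1,3)] P00[OF assms(1,2)] gen_fun_abs_le_1[OF P assms(1) box_cube[OF assms(3)], of 0]
  by simp_all

lemma G_near_id:
  assumes t: "0 \<le> t" "t \<le> \<tau>" and s: "s \<in> corner_box (1 / 2)"
  shows "G t s \<in> corner_box (3 / 4)"
proof -
  have s1: "s \<in> corner_box 1" using s by (rule box_le_1) simp
  have g: "0 \<le> G t s $ k" "G t s $ k \<le> 1" for k
    using G_in_box[OF t(1) s1] by (auto simp: corner_box_def)
  have "G t s $ k \<le> 3 / 4" for k
  proof -
    have "F (unit_index k) t s - s $ k \<le> 2 * (1 / 100)"
      using F_near_monomial[OF t(1) s1, of "unit_index k"] Pkk[OF t, of k] by simp
    moreover have "s $ k \<le> 1 / 2" using s by (simp add: corner_box_def)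
    ultimately have 1: "F 0 t s * G t s $ k \<le> 52 / 100"
      unfolding F_unit[OF t(1) s1] by linarith
    have "(99 / 100) * G t s $ k \<le> F 0 t s * G t s $ k"
      by (intro mult_right_mono F0_bounds t s1 g)
    with 1 show ?thesis by simp
  qed
  with g show ?thesis by (simp add: corner_box_def)
qed

text \<open>Multiplying by \<open>F 0 t x\<close> removes the quotient. Errors of
  \<open>8 / 100 * \<delta>\<close> arise from the numerator and from the denominator, and replacing
  \<open>F 0 t x\<close> by 1 costs \<open>1 / 100 * \<delta>\<close>; their sum divided by 99/100
  is below \<open>\<delta> / 2\<close>.\<close>

lemma G_increment_near_id:
  assumes t: "0 \<le> t" "t \<le> \<tau>" and x: "x \<in> corner_box (3 / 4)" and y: "y \<in> corner_box (3 / 4)"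
    and d: "\<And>k. \<bar>x $ k - y $ k\<bar> \<le> \<delta>"
  shows "\<bar>(G t x - G t y) $ k - (x - y) $ k\<bar> \<le> \<delta> / 2"
proof -
  have \<delta>: "0 \<le> \<delta>" using d[of undefined] by linarith
  have x1: "x \<in> corner_box 1" "y \<in> corner_box 1" using x y by (auto intro: box_le_1)
  let ?f = "F 0 t x" and ?D = "x $ k - y $ k" and ?E = "G t x $ k - G t y $ k"
  have f: "99 / 100 \<le> ?f" "?f \<le> 1" using F0_bounds[OF t x1(1)] by auto
  have e1: "\<bar>(F (unit_index k) t x - F (unit_index k) t y) - ?D\<bar> \<le> 8 * (1 / 100) * \<delta>"
  proof -
    have "8 * (1 - P t (unit_index k) (unit_index k)) * \<delta> \<le> 8 * (1 / 100) * \<delta>"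
      using Pkk[OF t, of k] \<delta> by (intro mult_right_mono) simp_all
    with F_near_monomial_Lipschitz[OF t(1) x y d, of "unit_index k"] show ?thesis
      by (simp only: mono_pow_unit[folded One_nat_def])
  qed
  have e0: "\<bar>?f - F 0 t y\<bar> \<le> 8 * (1 / 100) * \<delta>"
  proof -
    have "8 * (1 - P t 0 0) * \<delta> \<le> 8 * (1 / 100) * \<delta>"
      using P00[OF t] \<delta> by (intro mult_right_mono) simp_all
    with F_near_monomial_Lipschitz[OF t(1) x y d, of 0] show ?thesis by simp
  qed
  have "\<bar>G t y $ k * (?f - F 0 t y)\<bar> \<le> 1 * (8 * (1 / 100) * \<delta>)"
    unfolding abs_mult using G_in_box[OF t(1) x1(2)] by (intro mult_mono e0) (auto simp: corner_box_def)
  moreover have "?f * ?E - ?D = ((F (unit_index k) t x - F (unit_index k) t y) - ?D) - G t y $ k * (?f - F 0 t y)"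
    unfolding F_unit[OF t(1) x1(1)] F_unit[OF t(1) x1(2)] by (simp add: algebra_simps)
  ultimately have fE: "\<bar>?f * ?E - ?D\<bar> \<le> 16 / 100 * \<delta>" using e1 by linarith
  have "\<bar>(1 - ?f) * ?D\<bar> \<le> 1 / 100 * \<delta>"
    unfolding abs_mult using f by (intro mult_mono d) auto
  moreover have "?f * (?E - ?D) = (?f * ?E - ?D) + (1 - ?f) * ?D" by (simp add: algebra_simps)
  ultimately have "\<bar>?f * (?E - ?D)\<bar> \<le> 17 / 100 * \<delta>" using fE by linarith
  moreover have "99 / 100 * \<bar>?E - ?D\<bar> \<le> \<bar>?f * (?E - ?D)\<bar>"
    unfolding abs_mult using f by (intro mult_right_mono) auto
  ultimately have "99 / 100 * \<bar>?E - ?D\<bar> \<le> 17 / 100 * \<delta>" by (rule order_trans[rotated])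
  moreover have "e \<le> \<delta> / 2" if "99 / 100 * e \<le> 17 / 100 * \<delta>" for e using that \<delta> by linarith
  ultimately have "\<bar>?E - ?D\<bar> \<le> \<delta> / 2" by blast
  then show ?thesis by simp
qed

text \<open>Since \<open>G t\<close> is a small Lipschitz perturbation of the identity, the \<open>m\<close> steps from \<open>s\<close> to
  \<open>G (m * h) s\<close> all nearly equal the first one, so their sum, which is bounded, controls
  \<open>m\<close> times the first step.\<close>

lemma linear_bounds:
  assumes h: "0 < h" "h \<le> \<tau>" and s: "s \<in> corner_box (1 / 2)"
  shows "\<bar>G h s $ k - s $ k\<bar> \<le> 4 * h / \<tau>" and "1 - F 0 h s \<le> 12 * h / \<tau>"
proof -
  define \<Delta> where "\<Delta> = Max (range (\<lambda>k. \<bar>G h s $ k - s $ k\<bar>))"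
  have \<Delta>: "\<bar>G h s $ k - s $ k\<bar> \<le> \<Delta>" for k unfolding \<Delta>_def by (intro Max_ge) auto
  have "\<Delta> \<in> range (\<lambda>k. \<bar>G h s $ k - s $ k\<bar>)" unfolding \<Delta>_def by (intro Max_in) auto
  \<comment> \<open>The perturbation is controlled in the maximum norm, so the comparison is made in
    the coordinate with the largest first step.\<close>
  then obtain k0 where k0: "\<Delta> = \<bar>G h s $ k0 - s $ k0\<bar>" by blast
  have \<Delta>0: "0 \<le> \<Delta>" by (simp add: k0)
  \<comment> \<open>The number of full steps of length \<open>h\<close> within
    \<open>\<tau>\<close>. It is at least 1, so \<open>\<tau> \<le> 2 * m * h\<close>; this factor 2
    turns \<open>m * \<Delta> \<le> 2\<close> and \<open>m * ?d \<le> 6\<close> into the constants 4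
    and 12.\<close>
  define m where "m = nat \<lfloor>\<tau> / h\<rfloor>"
  have m: "real m = of_int \<lfloor>\<tau> / h\<rfloor>" using h \<tau> by (simp add: m_def)
  have "1 \<le> \<lfloor>\<tau> / h\<rfloor>" using h by (simp add: le_floor_iff)
  then have m1: "1 \<le> real m" by (simp add: m)
  have "real m \<le> \<tau> / h" "\<tau> / h < real m + 1" unfolding m by linarith+
  then have mh: "real m * h \<le> \<tau>" "\<tau> < real m * h + h" using h by (simp_all add: field_simps)
  have "h \<le> real m * h" using m1 h(1) by simp
  then have mh2: "\<tau> \<le> 2 * (real m * h)" using mh(2) by linarith
  have s1: "s \<in> corner_box 1" and s2: "s \<in> corner_box (3 / 4)"
    using s corner_box_mono[of "1/2" "3/4"] by (auto intro: box_le_1)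
  have Gh: "G h s \<in> corner_box (3 / 4)" using h by (intro G_near_id s) auto
  have lh: "0 \<le> real l * h" "real l * h \<le> \<tau>" if "l \<le> m" for l
  proof -
    show "0 \<le> real l * h" using h by simp
    have "real l * h \<le> real m * h" using that h by (intro mult_right_mono) auto
    with mh show "real l * h \<le> \<tau>" by linarith
  qed
  have Suc_l: "real (Suc l) * h = real l * h + h" for l by (simp add: algebra_simps)
  have "\<bar>(\<Sum>l<m. G (real (Suc l) * h) s $ k0 - G (real l * h) s $ k0) - (\<Sum>l<m. G h s $ k0 - s $ k0)\<bar> \<le> (\<Sum>l<m. \<Delta> / 2)"
    unfolding sum_subtractf[symmetric]
  proof (rule order_trans[OF sum_abs], rule sum_mono)
    fix l assume "l \<in> {..<m}"
    then have l: "0 \<le> real l * h" "real l * h \<le> \<tau>" using lh[of l] by auto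
    have "G (real (Suc l) * h) s = G (real l * h) (G h s)"
      unfolding Suc_l using h by (intro G_add l s1) auto
    then show "\<bar>G (real (Suc l) * h) s $ k0 - G (real l * h) s $ k0 - (G h s $ k0 - s $ k0)\<bar> \<le> \<Delta> / 2"
      using G_increment_near_id[OF l Gh s2 \<Delta>, of k0] by simp
  qed
  moreover have "(\<Sum>l<m. G (real (Suc l) * h) s $ k0 - G (real l * h) s $ k0) = G (real m * h) s $ k0 - s $ k0"
    using sum_lessThan_telescope[of "\<lambda>l. G (real l * h) s $ k0" m] by (simp add: G_0)
  ultimately have "\<bar>(G (real m * h) s $ k0 - s $ k0) - real m * (G h s $ k0 - s $ k0)\<bar> \<le> real m * (\<Delta> / 2)"
    by simp
  moreover have "\<bar>G (real m * h) s $ k0 - s $ k0\<bar> \<le> 1"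
  proof -
    have "0 \<le> G (real m * h) s $ k0 \<and> G (real m * h) s $ k0 \<le> 1"
      using G_in_box[OF lh(1)[of m] s1] by (simp add: corner_box_def)
    moreover have "0 \<le> s $ k0 \<and> s $ k0 \<le> 1" using s1 by (simp add: corner_box_def)
    ultimately show ?thesis by linarith
  qed
  moreover have "\<bar>real m * (G h s $ k0 - s $ k0)\<bar> = real m * \<Delta>" by (simp add: k0 abs_mult)
  ultimately have m\<Delta>: "real m * \<Delta> \<le> 2" by linarith
  have mh0: "0 < real m * h" using m1 h by simp
  have "\<Delta> * \<tau> \<le> \<Delta> * (2 * (real m * h))" using mh2 \<Delta>0 by (rule mult_left_mono)
  also have "\<dots> = (real m * \<Delta>) * (2 * h)" by simp
  also have "\<dots> \<le> 2 * (2 * h)" using m\<Delta> h by (intro mult_right_mono) auto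
  finally have "\<Delta> \<le> 4 * h / \<tau>" using \<tau> by (simp add: pos_le_divide_eq)
  then show "\<bar>G h s $ k - s $ k\<bar> \<le> 4 * h / \<tau>" using \<Delta>[of k] by linarith
  let ?d = "1 - F 0 h s"
  have d0: "0 \<le> ?d" using F0_bounds[OF _ h(2) s1] h by simp
  \<comment> \<open>The same telescoping for \<open>F 0\<close>: each step multiplies by
    \<open>F 0 h s\<close>, losing at least \<open>?d / 2\<close>, and moves the argument from
    \<open>s\<close> to \<open>G h s\<close>, which can gain at most \<open>\<Delta>\<close>. The
    total loss is at most 1.\<close>
  have "(\<Sum>l<m. F 0 (real (Suc l) * h) s - F 0 (real l * h) s) \<le> (\<Sum>l<m. - (?d / 2) + \<Delta>)"
  proof (rule sum_mono)
    fix l assume "l \<in> {..<m}"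
    then have l: "0 \<le> real l * h" "real l * h \<le> \<tau>" using lh[of l] by auto
    have Gh1: "G h s \<in> corner_box 1" using Gh by (rule box_le_1) simp
    have "F 0 (real (Suc l) * h) s = F 0 h s * F 0 (real l * h) (G h s)"
      unfolding Suc_l using h by (intro F_add l s1) auto
    then have "F 0 (real (Suc l) * h) s - F 0 (real l * h) s
      = - (?d * F 0 (real l * h) (G h s)) + (F 0 (real l * h) (G h s) - F 0 (real l * h) s)"
      by (simp add: algebra_simps)
    moreover have "?d * (1 / 2) \<le> ?d * F 0 (real l * h) (G h s)"
      using F0_bounds(1)[OF l Gh1] d0 by (intro mult_left_mono) auto
    moreover have "F 0 (real l * h) (G h s) - F 0 (real l * h) s \<le> \<Delta>"
    proof -
      have "8 * (1 - P (real l * h) 0 0) * \<Delta> \<le> 1 * \<Delta>" using P00[OF l] \<Delta>0 by (intro mult_right_mono) auto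
      then show ?thesis using F_near_monomial_Lipschitz[OF l(1) Gh s2 \<Delta>, of 0] by simp
    qed
    ultimately show "F 0 (real (Suc l) * h) s - F 0 (real l * h) s \<le> - (?d / 2) + \<Delta>" by linarith
  qed
  moreover have "(\<Sum>l<m. F 0 (real (Suc l) * h) s - F 0 (real l * h) s) = F 0 (real m * h) s - 1"
    using sum_lessThan_telescope[of "\<lambda>l. F 0 (real l * h) s" m] by (simp add: gen_fun_0[OF P])
  moreover have "0 \<le> F 0 (real m * h) s" using F0_pos[OF lh(1)[of m] s1] by simp
  moreover have "(\<Sum>l<m. - (?d / 2) + \<Delta>) = real m * \<Delta> - real m * ?d / 2" by (simp add: algebra_simps)
  ultimately have md: "real m * ?d \<le> 6" using m\<Delta> by linarith
  have "?d * \<tau> \<le> ?d * (2 * (real m * h))" using mh2 d0 by (rule mult_left_mono)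
  also have "\<dots> = (real m * ?d) * (2 * h)" by simp
  also have "\<dots> \<le> 6 * (2 * h)" using md h by (intro mult_right_mono) auto
  finally show "?d \<le> 12 * h / \<tau>" using \<tau> by (simp add: pos_le_divide_eq)
qed

text \<open>The 28 is 12 from the factor \<open>F 0 h s\<close> plus the Lipschitz constant 4 times
  the bound 4 on the motion of \<open>G\<close>. The bound is the same for all
  \<open>i\<close>.\<close>

lemma F_linear_bound:
  assumes h: "0 < h" "h \<le> \<tau>" and s: "s \<in> corner_box (1 / 2)"
  shows "\<bar>F i h s - mono_pow s i\<bar> \<le> 28 * h / \<tau>"
proof -
  have h0: "0 \<le> h" using h by simp
  have s1: "s \<in> corner_box 1" and s2: "s \<in> corner_box (3 / 4)"
    using s corner_box_mono[of "1/2" "3/4"] by (auto intro: box_le_1)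
  have "\<bar>mono_pow (G h s) i - mono_pow s i\<bar> \<le> (4 * h / \<tau>) / (1 - 3 / 4)"
    by (rule mono_pow_Lipschitz[OF G_near_id[OF h0 h(2) s] s2]) (use linear_bounds(1)[OF h s] in auto)
  moreover have "\<bar>(F 0 h s - 1) * mono_pow (G h s) i\<bar> \<le> 12 * h / \<tau> * 1"
    unfolding abs_mult
    using linear_bounds(2)[OF h s] F0_bounds(2)[OF h0 h(2) s1] mono_pow_unit_cube[OF box_cube[OF G_in_box[OF h0 s1]]] h \<tau>
    by (intro mult_mono) auto
  moreover have "F i h s - mono_pow s i = (F 0 h s - 1) * mono_pow (G h s) i + (mono_pow (G h s) i - mono_pow s i)"
    by (simp add: F_eq[OF h0 box_cube[OF s1], of i] algebra_simps)
  ultimately show ?thesis by simp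
qed

text \<open>The linear bound on generating functions must become one on \<open>1 - P h i i\<close>.
  In \<open>coefficient_bound\<close> the error term is a multiple of the total variation of the row
  increment, itself at most \<open>2 * (1 - P h i i)\<close>; with \<open>\<epsilon> = 1 / 4\<close>
  this is half of the left side and can be absorbed there.\<close>

lemma Q_function_ex: "\<exists>Q. Q_function Q P"
proof (rule Q_function_exists[OF P])
  fix i :: "nat ^ 'n"
  have "(0 :: real) < 1 / 4" by simp
  from coefficient_bound[OF this, of i] obtain K where K: "0 \<le> K"
    "\<And>c M. c summable_on UNIV \<Longrightarrow> (\<forall>s\<in>corner_box (1 / 2). \<bar>\<Sum>\<^sub>\<infinity>j. c j * mono_pow s j\<bar> \<le> M) \<Longrightarrow>
      \<bar>c i\<bar> \<le> K * M + 1 / 4 * (\<Sum>\<^sub>\<infinity>j. \<bar>c j\<bar>)" by blast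
  have "1 - P h i i \<le> 56 * K / \<tau> * h" if h: "0 < h" "h \<le> \<tau>" for h
  proof -
    have h0: "0 \<le> h" using h by simp
    have "\<bar>P h i i - id_kernel i i\<bar> \<le> K * (28 * h / \<tau>) + 1 / 4 * (\<Sum>\<^sub>\<infinity>j. \<bar>P h i j - id_kernel i j\<bar>)"
    proof (rule K(2)[OF transition_increment_row(1)[OF P h0]], rule ballI)
      fix s :: "real ^ 'n" assume s: "s \<in> corner_box (1 / 2)"
      have c: "\<bar>mono_pow s j\<bar> \<le> 1" for j using s by (intro mono_pow_unit_cube box_cube box_le_1[of s "1/2"]) auto
      have "(\<Sum>\<^sub>\<infinity>j. (P h i j - id_kernel i j) * mono_pow s j) = F i h s - mono_pow s i"
        using transition_apply_increment(1)[OF P h0, of "mono_pow s" 1 i] c by (simp add: gen_fun_def)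
      then show "\<bar>\<Sum>\<^sub>\<infinity>j. (P h i j - id_kernel i j) * mono_pow s j\<bar> \<le> 28 * h / \<tau>"
        using F_linear_bound[OF h s] by simp
    qed
    also have "\<dots> \<le> K * (28 * h / \<tau>) + 1 / 4 * (2 * (1 - P h i i))"
      by (intro add_left_mono mult_left_mono transition_increment_row(2)[OF P h0]) auto
    also have "1 / 4 * (2 * (1 - P h i i)) = (1 - P h i i) / 2" by (simp add: field_simps)
    finally have "\<bar>P h i i - id_kernel i i\<bar> \<le> K * (28 * h / \<tau>) + (1 - P h i i) / 2" .
    moreover have "\<bar>P h i i - id_kernel i i\<bar> = 1 - P h i i"
      using transition_le_1[OF P h0, of i i] by (simp add: id_kernel_def)
    ultimately have "1 - P h i i \<le> K * (28 * h / \<tau>) + (1 - P h i i) / 2" by simp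
    then show ?thesis by (simp add: field_simps)
  qed
  then show "\<exists>C \<tau>. 0 < \<tau> \<and> (\<forall>h. 0 < h \<longrightarrow> h \<le> \<tau> \<longrightarrow> 1 - P h i i \<le> C * h)" using \<tau> by blast
qed

lemma F_vanishes:
  assumes s: "s \<in> corner_box (1 / 2)"
  shows "\<exists>g. vanishes_at_infinity g \<and> (\<forall>t i. 0 \<le> t \<longrightarrow> t \<le> \<tau> \<longrightarrow> \<bar>F i t s\<bar> \<le> g i)"
proof (intro exI conjI allI impI)
  show "vanishes_at_infinity (\<lambda>i :: nat ^ 'n. (3 / 4 :: real) ^ msize i)"
    by (rule vanishes_at_infinity_power[OF _ _ finite_msize_le]) auto
  fix t i assume t: "0 \<le> t" "t \<le> \<tau>"
  have s1: "s \<in> corner_box 1" using s by (rule box_le_1) simp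
  have "\<bar>F 0 t s\<bar> * \<bar>mono_pow (G t s) i\<bar> \<le> 1 * (3 / 4) ^ msize i"
    using mono_pow_corner_box[OF G_near_id[OF t s], of i] gen_fun_abs_le_1[OF P t(1) box_cube[OF s1], of 0]
    by (intro mult_mono) auto
  then show "\<bar>F i t s\<bar> \<le> (3 / 4) ^ msize i"
    unfolding F_eq[OF t(1) box_cube[OF s1], of i] by (simp add: abs_mult)
qed

end

subsection \<open>The q-matrix\<close>

context
  fixes Q
  assumes PQ: "Q_function Q P"
begin

definition q_series :: "nat ^ 'n \<Rightarrow> real ^ 'n \<Rightarrow> real" where
  "q_series i s = (\<Sum>\<^sub>\<infinity>j. Q i j * mono_pow s j)"

lemma q_series_derivative:
  assumes s: "s \<in> corner_box (1 / 2)"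
  shows "((\<lambda>t. F i t s) has_real_derivative q_series i s) (at_right 0)"
proof -
  have "((\<lambda>h. ((\<Sum>\<^sub>\<infinity>k. P h i k * mono_pow s k) - mono_pow s i) / h) \<longlongrightarrow> (\<Sum>\<^sub>\<infinity>k. Q i k * mono_pow s k)) (at_right 0)"
  proof (rule Q_function_apply_tendsto[OF PQ, where g = "\<lambda>k. (1 / 2) ^ msize k"])
    show "vanishes_at_infinity (\<lambda>k :: nat ^ 'n. (1 / 2 :: real) ^ msize k)"
      by (rule vanishes_at_infinity_power[OF _ _ finite_msize_le]) auto
  qed (use mono_pow_corner_box[OF s] in auto)
  then show ?thesis
    unfolding has_real_derivative_at_right_0_iff gen_fun_0[OF P] unfolding q_series_def gen_fun_def .
qed

text \<open>Differentiates \<open>F 0 * F (i + unit_index k) = F i * F (unit_index k)\<close> at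
  time 0, a consequence of the factorization free of quotients and powers.\<close>

lemma q_series_add_unit:
  assumes s: "s \<in> corner_box (1 / 2)"
  shows "q_series (i + unit_index k) s
    = s $ k * q_series i s + mono_pow s i * (q_series (unit_index k) s - s $ k * q_series 0 s)"
proof -
  have s1: "s \<in> corner_box 1" using s by (rule box_le_1) simp
  have eq: "F 0 t s * F (i + unit_index k) t s = F i t s * F (unit_index k) t s" if "0 \<le> t" for t
    unfolding F_eq[OF that box_cube[OF s1], of "i + unit_index k"] F_eq[OF that box_cube[OF s1], of i]
      F_unit[OF that s1] by (simp add: mono_pow_add)
  have 1: "((\<lambda>t. F 0 t s * F (i + unit_index k) t s) has_real_derivative
      q_series 0 s * mono_pow s (i + unit_index k) + q_series (i + unit_index k) s * 1) (at_right 0)"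
    using DERIV_mult[OF q_series_derivative[OF s, of 0] q_series_derivative[OF s, of "i + unit_index k"]]
    by (simp add: gen_fun_0[OF P])
  have 2: "((\<lambda>t. F i t s * F (unit_index k) t s) has_real_derivative
      q_series i s * s $ k + q_series (unit_index k) s * mono_pow s i) (at_right 0)"
    using DERIV_mult[OF q_series_derivative[OF s, of i] q_series_derivative[OF s, of "unit_index k"]]
    by (simp add: gen_fun_0[OF P])
  have ev: "\<forall>\<^sub>F t in at_right 0. (F 0 t s * F (i + unit_index k) t s - F 0 0 s * F (i + unit_index k) 0 s) / t
      = (F i t s * F (unit_index k) t s - F i 0 s * F (unit_index k) 0 s) / t"
    using eventually_at_right_less[of 0] by eventually_elim (simp only: eq less_imp_le order_refl)
  have "q_series i s * s $ k + q_series (unit_index k) s * mono_pow s i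
      = q_series 0 s * mono_pow s (i + unit_index k) + q_series (i + unit_index k) s * 1"
    by (rule tendsto_unique[OF trivial_limit_at_right_real 2[unfolded has_real_derivative_at_right_0_iff]
          Lim_transform_eventually[OF 1[unfolded has_real_derivative_at_right_0_iff] ev]])
  then show ?thesis by (simp add: mono_pow_add algebra_simps)
qed

definition imm_rate :: "nat ^ 'n \<Rightarrow> real" where "imm_rate = Q 0"

text \<open>What is left of the row at \<open>unit_index k\<close> once immigration, shifted by the
  individual present, is removed.\<close>

definition br_rate :: "'n \<Rightarrow> nat ^ 'n \<Rightarrow> real" where
  "br_rate k j = Q (unit_index k) j - coeff_diff (Q 0) j (unit_index k)"

lemma Qs: "Q i summable_on UNIV"
  by (rule q_matrixD(2)[OF Q_function_q_matrix[OF PQ]])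

lemma Qs_mono_pow:
  assumes "s \<in> corner_box (1 / 2)" "c summable_on UNIV"
  shows "(\<lambda>j. c j * mono_pow s j) summable_on UNIV"
  by (rule summable_mult_bounded[OF assms(2), of _ 1])
     (use assms(1) in \<open>auto intro!: mono_pow_unit_cube box_cube intro: box_le_1\<close>)

lemma br_rate_summable: "br_rate k summable_on UNIV"
proof -
  have "((\<lambda>j. coeff_diff (Q 0) j (unit_index k) * 1) has_sum infsum (Q 0) UNIV) UNIV"
    by (rule has_sum_coeff_diff) (simp add: Qs)
  then have "(\<lambda>j. coeff_diff (Q 0) j (unit_index k)) summable_on UNIV" by (auto dest: has_sum_imp_summable)
  then show ?thesis unfolding br_rate_def [abs_def] by (intro summable_on_diff_real Qs)
qed

lemma br_rate_series:
  assumes s: "s \<in> corner_box (1 / 2)"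
  shows "(\<Sum>\<^sub>\<infinity>j. br_rate k j * mono_pow s j) = q_series (unit_index k) s - s $ k * q_series 0 s"
proof -
  have "((\<lambda>l. Q 0 l * mono_pow s (unit_index k + l)) has_sum s $ k * q_series 0 s) UNIV"
    using has_sum_cmult_right[OF has_sum_infsum[OF Qs_mono_pow[OF s Qs[of 0]]], of "s $ k"]
    by (simp add: q_series_def mono_pow_add mult_ac)
  then have h: "((\<lambda>j. coeff_diff (Q 0) j (unit_index k) * mono_pow s j) has_sum s $ k * q_series 0 s) UNIV"
    by (rule has_sum_coeff_diff)
  then show ?thesis
    unfolding br_rate_def left_diff_distrib
    by (subst infsum_diff_real[OF Qs_mono_pow[OF s Qs]]) (auto simp: q_series_def infsumI dest: has_sum_imp_summable)
qed

text \<open>The closed form \<open>R\<close> satisfies the recursion of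
  \<open>q_series_add_unit\<close> and has the same value at \<open>i = 0\<close>.\<close>

lemma q_series_bi_matrix:
  assumes s: "s \<in> corner_box (1 / 2)"
  shows "q_series i s = (\<Sum>\<^sub>\<infinity>j. bi_matrix imm_rate br_rate i j * mono_pow s j)"
proof -
  define R where "R = (\<lambda>i. mono_pow s i * q_series 0 s
    + (\<Sum>k\<in>UNIV. real (i $ k) * (mono_pow s (i - unit_index k) * (\<Sum>\<^sub>\<infinity>j. br_rate k j * mono_pow s j))))"
  have c: "\<bar>mono_pow s j\<bar> \<le> 1" for j using s by (intro mono_pow_unit_cube box_cube box_le_1[of s "1/2"]) auto
  have shift: "(\<Sum>\<^sub>\<infinity>l. c l * mono_pow s (i + l)) = mono_pow s i * (\<Sum>\<^sub>\<infinity>l. c l * mono_pow s l)" for c i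
    by (simp add: mono_pow_add infsum_cmult_right'[symmetric] mult_ac)
  have "(\<Sum>\<^sub>\<infinity>j. bi_matrix imm_rate br_rate i j * mono_pow s j) = R i" for i
    using infsumI[OF bi_matrix_apply[of imm_rate br_rate "mono_pow s" 1 i]] c br_rate_summable Qs
    by (simp add: R_def shift imm_rate_def q_series_def)
  moreover have "q_series i s = R i"
  proof (induction i rule: multi_index_induct)
    case (add_unit i k)
    let ?u = "\<lambda>l. \<Sum>\<^sub>\<infinity>j. br_rate l j * mono_pow s j"
    have step: "real ((i + unit_index k) $ l) * (mono_pow s (i + unit_index k - unit_index l) * ?u l)
       = s $ k * (real (i $ l) * (mono_pow s (i - unit_index l) * ?u l)) + (if l = k then mono_pow s i * ?u l else 0)" for l
    proof -
      have 1: "i + unit_index k - unit_index l = i - unit_index l + unit_index k" if "0 < i $ l"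
        using that by (auto simp: vec_eq_iff)
      have 2: "i + unit_index k - unit_index k = i" by (simp add: vec_eq_iff)
      show ?thesis
      proof (cases "l = k")
        case True
        show ?thesis
        proof (cases "0 < i $ k")
          case i: True
          have "mono_pow s i = mono_pow s (i - unit_index k) * s $ k"
            using mono_pow_add[of s "i - unit_index k" "unit_index k"] multi_index_minus_unit[OF i] by simp
          then show ?thesis using True 2 by (simp add: algebra_simps)
        next
          case False
          then show ?thesis using True 2 by simp
        qed
      next
        case False
        then show ?thesis using 1 by (cases "0 < i $ l") (simp_all add: mono_pow_add)
      qed
    qed
    have "R (i + unit_index k) = s $ k * R i + mono_pow s i * ?u k"
      unfolding R_def step sum.distrib sum_distrib_left[symmetric]
      by (simp add: mono_pow_add algebra_simps)
    then show ?case
      using add_unit q_series_add_unit[OF s, of i k] br_rate_series[OF s, of k] by simp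
  qed (simp add: R_def)
  ultimately show ?thesis by simp
qed

lemma Q_eq_bi_matrix: "Q = bi_matrix imm_rate br_rate"
proof
  fix i
  have "bi_matrix imm_rate br_rate i summable_on UNIV"
    using has_sum_imp_summable[OF bi_matrix_apply[of imm_rate br_rate "\<lambda>_. 1" 1 i]] br_rate_summable Qs
    by (simp add: imm_rate_def)
  then show "Q i = bi_matrix imm_rate br_rate i"
    by (rule power_series_eqD[OF Qs]) (use q_series_bi_matrix in \<open>simp add: q_series_def\<close>)
qed

lemma weak_imm_rate: "weak_rates_at 0 imm_rate"
  using q_matrixD[OF Q_function_q_matrix[OF PQ]] by (auto simp: weak_rates_at_def imm_rate_def)

text \<open>The signs are read off the rows \<open>Q (axis k m)\<close> as \<open>m\<close> tends to infinity, where the branching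
  rates dominate the immigration rates.\<close>

lemma weak_br_rate: "weak_rates_at (unit_index k) (br_rate k)"
proof -
  note Q = Q_function_q_matrix[OF PQ]
  have sum: "(\<Sum>l\<in>UNIV. real (axis k m $ l) * f l) = real m * f k" for m :: nat and f
  proof -
    have "(\<Sum>l\<in>UNIV. real (axis k m $ l) * f l) = (\<Sum>l\<in>UNIV. if l = k then real m * f l else 0)"
      by (intro sum.cong) (auto simp: axis_def)
    then show ?thesis by simp
  qed
  have "0 \<le> br_rate k j" if j: "j \<noteq> unit_index k" for j
  proof (rule archimedean_nonneg)
    fix m :: nat
    define i where "i = axis k m"
    have i: "axis k (Suc m) = i + unit_index k" by (auto simp: vec_eq_iff i_def axis_def)
    have "i + j \<noteq> i + unit_index k" using j by simp
    then have "0 \<le> Q (axis k (Suc m)) (i + j)" unfolding i by (intro q_matrixD(1)[OF Q]) simp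
    also have "\<dots> = real (Suc m) * coeff_diff (br_rate k) (i + j + unit_index k) (i + unit_index k)
        + coeff_diff imm_rate (i + j) (i + unit_index k)"
      by (subst Q_eq_bi_matrix) (simp only: bi_matrix_def branching_rate_def sum i[symmetric])
    also have "i + j + unit_index k = (i + unit_index k) + j" by (simp add: add_ac)
    also have "coeff_diff imm_rate (i + j) (i + unit_index k) = coeff_diff imm_rate j (unit_index k)"
    proof (cases "\<exists>l. j = unit_index k + l")
      case True
      then obtain l where l: "j = unit_index k + l" by blast
      have "i + j = (i + unit_index k) + l" by (simp only: l add_ac)
      then show ?thesis by (simp only: coeff_diff_add l)
    next
      case False
      have "i + j \<noteq> (i + unit_index k) + l" for l
      proof
        assume "i + j = (i + unit_index k) + l"
        then have "i + j = i + (unit_index k + l)" by (simp only: add.assoc)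
        then show False using False by (simp only: add_left_cancel) blast
      qed
      then have "coeff_diff imm_rate (i + j) (i + unit_index k) = 0" by (rule coeff_diff_eq_0)
      moreover have "coeff_diff imm_rate j (unit_index k) = 0" by (rule coeff_diff_eq_0) (use False in blast)
      ultimately show ?thesis by simp
    qed
    finally show "0 \<le> real (Suc m) * br_rate k j + coeff_diff imm_rate j (unit_index k)"
      by (simp only: coeff_diff_add)
  qed
  moreover have "0 \<le> - infsum (br_rate k) UNIV"
  proof (rule archimedean_nonneg)
    fix m :: nat
    have "(bi_matrix imm_rate br_rate (axis k (Suc m)) has_sum
        infsum imm_rate UNIV + real (Suc m) * infsum (br_rate k) UNIV) UNIV"
      using bi_matrix_apply[of imm_rate br_rate "\<lambda>_. 1" 1 "axis k (Suc m)"] br_rate_summable Qs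
      by (simp add: imm_rate_def sum)
    then have "infsum (Q (axis k (Suc m))) UNIV = infsum imm_rate UNIV + real (Suc m) * infsum (br_rate k) UNIV"
      by (subst Q_eq_bi_matrix) (rule infsumI)
    then show "0 \<le> real (Suc m) * - infsum (br_rate k) UNIV + - infsum imm_rate UNIV"
      using q_matrixD(3)[OF Q, of "axis k (Suc m)"] by simp
  qed
  ultimately show ?thesis by (simp add: weak_rates_at_def br_rate_summable)
qed

end

text \<open>Having the right q-matrix does not make a Q-function minimal; the vanishing at infinity
  that the quotient form provides does. The rates may still be degenerate.\<close>

theorem quotients_imp_minimal:
  obtains a b where "weak_rates_at 0 a" "\<And>k. weak_rates_at (unit_index k) (b k)"
    "Q_function (bi_matrix a b) P" "\<And>t. 0 \<le> t \<Longrightarrow> P t = minimal_function (bi_matrix a b) t"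
proof -
  obtain \<tau> where \<tau>: "0 < \<tau>" "\<And>t. 0 \<le> t \<Longrightarrow> t \<le> \<tau> \<Longrightarrow> 1 - P t 0 0 \<le> 1 / 100"
    "\<And>t k. 0 \<le> t \<Longrightarrow> t \<le> \<tau> \<Longrightarrow> 1 - P t (unit_index k) (unit_index k) \<le> 1 / 100"
    by (rule small_time) blast
  obtain Q where Q: "Q_function Q P" using Q_function_ex[OF \<tau>] by blast
  define a b where "a = imm_rate Q" and "b = br_rate Q"
  have wa: "weak_rates_at 0 a" and wb: "weak_rates_at (unit_index k) (b k)" for k
    unfolding a_def b_def by (rule weak_imm_rate[OF Q], rule weak_br_rate[OF Q])
  have PQ: "Q_function (bi_matrix a b) P"
    using Q Q_eq_bi_matrix[OF Q] by (simp add: a_def b_def)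
  show thesis
    by (rule that[OF wa wb PQ Q_function_eq_minimal[OF wa wb PQ \<tau>(1) F_vanishes[OF \<tau>]]])
qed

end

section \<open>The equivalences\<close>

lemma bi_matrix_no_immigration: "bi_matrix (\<lambda>_. 0) b i j = branching_rate b i j"
  by (simp add: bi_matrix_def coeff_diff_def)

lemma branching_rate_unit: "branching_rate b (unit_index k) j = b k j"
proof -
  have "coeff_diff (b k) (j + unit_index k) (unit_index k) = b k j"
    by (subst add.commute) (rule coeff_diff_add)
  then show ?thesis
    unfolding branching_rate_def by (simp add: if_distrib[of "\<lambda>x. x * _"] if_distrib[of real] cong: if_cong)
qed

lemma branching_rate_0: "branching_rate b 0 j = 0"
  by (simp add: branching_rate_def)

lemma branching_q_matrix_bi_matrix:
  assumes "\<And>k. rates_at (unit_index k) (b k)"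
  shows "branching_q_matrix (bi_matrix (\<lambda>_. 0) b)"
  unfolding branching_q_matrix_def
  using assms by (intro exI[of _ b]) (simp add: bi_matrix_no_immigration branching_rate_0)

lemma minimal_imp_factorizes_by_branching:
  assumes a: "weak_rates_at 0 a" and b: "\<And>k. rates_at (unit_index k) (b k)"
    and eq: "\<And>t. 0 \<le> t \<Longrightarrow> P t = minimal_function (bi_matrix a b) t"
  shows "factorizes_by_branching P"
  unfolding factorizes_by_branching_def
proof (intro exI conjI allI impI ballI)
  note wb = rates_at_imp_weak[OF b]
  show "branching_q_matrix (bi_matrix (\<lambda>_. 0) b)" by (rule branching_q_matrix_bi_matrix[OF b])
  show "Feller_minimal (bi_matrix (\<lambda>_. 0) b) (minimal_function (bi_matrix (\<lambda>_. 0) b))"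
    by (intro Feller_minimal_minimal_function q_matrix_bi_matrix weak_rates_at_0 wb)
  fix i and t :: real and s :: "real ^ 'a" assume t: "0 \<le> t" and s: "s \<in> unit_cube"
  have "gen_fun P i t s = gen_fun (minimal_function (bi_matrix a b)) i t s" for i
    by (simp add: gen_fun_def eq[OF t])
  then show "gen_fun P i t s = gen_fun P 0 t s
      * (\<Prod>k\<in>UNIV. gen_fun (minimal_function (bi_matrix (\<lambda>_. 0) b)) (unit_index k) t s ^ (i $ k))"
    by (simp only: minimal_gen_fun_factorizes[OF a wb t s, where i = i])
qed

lemma factorizes_by_branching_imp_quotients:
  fixes P :: "real \<Rightarrow> nat ^ 'n::finite \<Rightarrow> nat ^ 'n \<Rightarrow> real"
  assumes "factorizes_by_branching P"
  shows "factorizes_by_quotients P"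
proof -
  obtain P' where P': "\<And>i t s. 0 \<le> t \<Longrightarrow> s \<in> unit_cube \<Longrightarrow>
      gen_fun P i t s = gen_fun P 0 t s * (\<Prod>k\<in>UNIV. gen_fun P' (unit_index k) t s ^ (i $ k))"
    using assms unfolding factorizes_by_branching_def by blast
  show ?thesis
    unfolding factorizes_by_quotients_def
  proof (intro allI impI ballI)
    fix i and t :: real and s :: "real ^ 'n" assume ts: "0 \<le> t" "s \<in> unit_cube"
    show "gen_fun P i t s = gen_fun P 0 t s *
        (\<Prod>k\<in>UNIV. (gen_fun P (unit_index k) t s / gen_fun P 0 t s) ^ (i $ k))"
    proof (cases "gen_fun P 0 t s = 0")
      \<comment> \<open>With total division both sides are 0 here.\<close>
      case True
      then show ?thesis using P'[OF ts, of i] by simp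
    next
      case False
      have "gen_fun P (unit_index k) t s / gen_fun P 0 t s = gen_fun P' (unit_index k) t s" for k
      proof -
        have "(\<Prod>l\<in>UNIV. gen_fun P' (unit_index l) t s ^ (unit_index k $ l)) = gen_fun P' (unit_index k) t s"
          using mono_pow_axis[of "\<chi> l. gen_fun P' (unit_index l) t s" k 1] by (simp add: mono_pow_def)
        then show ?thesis using P'[OF ts, of "unit_index k"] False
          by (simp only: nonzero_mult_div_cancel_left not_False_eq_True)
      qed
      then show ?thesis using P'[OF ts, of i] by simp
    qed
  qed
qed

text \<open>Translates the condition in \<open>branching_nondegenerate\<close>: shifting a row by
  \<open>unit_index k\<close> multiplies its generating function by \<open>s $ k\<close>.\<close>

lemma gen_fun_proportional:
  fixes P :: "real \<Rightarrow> nat ^ 'n::finite \<Rightarrow> nat ^ 'n \<Rightarrow> real"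
  assumes P: "transition_function P" and t: "0 \<le> t"
  shows "(\<forall>j. P t (unit_index k) j = c * coeff_diff (P t 0) j (unit_index k)) \<longleftrightarrow>
    (\<forall>s\<in>corner_box (1 / 2). gen_fun P (unit_index k) t s = gen_fun P 0 t s * (c * s $ k))"
proof -
  let ?d = "\<lambda>j. c * coeff_diff (P t 0) j (unit_index k)"
  note row = substochD(2)[OF transition_substoch[OF P t]]
  have hs: "((\<lambda>j. ?d j * mono_pow s j) has_sum gen_fun P 0 t s * (c * s $ k)) UNIV" if "s \<in> unit_cube" for s
  proof -
    have "((\<lambda>l. P t 0 l * mono_pow s (unit_index k + l)) has_sum s $ k * gen_fun P 0 t s) UNIV"
      using has_sum_cmult_right[OF has_sum_infsum[OF gen_fun_summable[OF P t that, of 0]], of "s $ k"]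
      by (simp add: gen_fun_def mono_pow_add mult_ac)
    from has_sum_cmult_right[OF has_sum_coeff_diff[OF this], of c] show ?thesis by (simp add: mult_ac)
  qed
  have "((\<lambda>j. coeff_diff (P t 0) j (unit_index k) * 1) has_sum infsum (P t 0) UNIV) UNIV"
    by (rule has_sum_coeff_diff) (simp add: row)
  then have ds: "?d summable_on UNIV" by (intro summable_on_cmult_right) (auto dest: has_sum_imp_summable)
  have cube: "s \<in> unit_cube" if "s \<in> corner_box (1 / 2)" for s :: "real ^ 'n"
    using that corner_box_subset_unit_cube[of "1/2"] by auto
  show ?thesis
  proof
    assume "\<forall>j. P t (unit_index k) j = ?d j"
    then show "\<forall>s\<in>corner_box (1 / 2). gen_fun P (unit_index k) t s = gen_fun P 0 t s * (c * s $ k)"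
      using infsumI[OF hs[OF cube]] by (simp add: gen_fun_def)
  next
    assume *: "\<forall>s\<in>corner_box (1 / 2). gen_fun P (unit_index k) t s = gen_fun P 0 t s * (c * s $ k)"
    have "P t (unit_index k) = ?d"
      by (rule power_series_eqD[OF row ds]) (use * infsumI[OF hs[OF cube]] in \<open>simp add: gen_fun_def\<close>)
    then show "\<forall>j. P t (unit_index k) j = ?d j" by (simp only: simp_thms)
  qed
qed

lemma gen_fun_single:
  assumes "\<And>j. j \<noteq> l \<Longrightarrow> P t i j = 0"
  shows "gen_fun P i t s = P t i l * mono_pow s l"
proof -
  have "gen_fun P i t s = (\<Sum>\<^sub>\<infinity>j. if j = l then P t i j * mono_pow s j else 0)"
    unfolding gen_fun_def using assms by (intro infsum_cong) auto
  then show ?thesis by simp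
qed

text \<open>If type \<open>k\<close> never branches, then \<open>unit_index k\<close> can only be
  killed in the immigration-free process, whose generating function there is a constant times
  \<open>s $ k\<close>. The factorization makes the row of \<open>P\<close> a shifted multiple of
  the row at 0.\<close>

lemma nondegenerate_imp_rates_at:
  fixes P :: "real \<Rightarrow> nat ^ 'n::finite \<Rightarrow> nat ^ 'n \<Rightarrow> real"
  assumes P: "transition_function P" and nd: "branching_nondegenerate P"
    and a: "weak_rates_at 0 a" and b: "\<And>k. weak_rates_at (unit_index k) (b k)"
    and eq: "\<And>t. 0 \<le> t \<Longrightarrow> P t = minimal_function (bi_matrix a b) t"
  shows "rates_at (unit_index k) (b k)"
proof (rule ccontr)
  assume "\<not> rates_at (unit_index k) (b k)"
  then have deg: "b k j = 0" if "j \<noteq> unit_index k" for j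
    using weak_rates_at_imp_rates_at[OF b that] by blast
  let ?P' = "minimal_function (bi_matrix (\<lambda>_. 0) b)"
  have "\<forall>j. P t (unit_index k) j = ?P' t (unit_index k) (unit_index k) * coeff_diff (P t 0) j (unit_index k)"
    if t: "0 \<le> t" for t
    unfolding gen_fun_proportional[OF P t]
  proof
    fix s :: "real ^ 'n" assume "s \<in> corner_box (1 / 2)"
    then have s: "s \<in> unit_cube" using corner_box_subset_unit_cube[of "1/2"] by auto
    have "gen_fun ?P' (unit_index k) t s = ?P' t (unit_index k) (unit_index k) * mono_pow s (unit_index k)"
      by (intro gen_fun_single minimal_function_absorbing q_matrix_bi_matrix weak_rates_at_0 b t)
         (simp_all only: bi_matrix_no_immigration branching_rate_unit deg not_False_eq_True)
    moreover have "gen_fun P (unit_index k) t s = gen_fun P 0 t s * gen_fun ?P' (unit_index k) t s"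
    proof -
      have "(\<Prod>l\<in>UNIV. gen_fun ?P' (unit_index l) t s ^ (unit_index k $ l)) = gen_fun ?P' (unit_index k) t s"
        using mono_pow_axis[of "\<chi> l. gen_fun ?P' (unit_index l) t s" k 1] by (simp add: mono_pow_def)
      moreover have "gen_fun P i t s = gen_fun (minimal_function (bi_matrix a b)) i t s" for i
        by (simp add: gen_fun_def eq[OF t])
      ultimately show ?thesis by (simp only: minimal_gen_fun_factorizes[OF a b t s, where i = "unit_index k"])
    qed
    ultimately show "gen_fun P (unit_index k) t s
        = gen_fun P 0 t s * (?P' t (unit_index k) (unit_index k) * s $ k)" by simp
  qed
  with nd show False unfolding branching_nondegenerate_def by blast
qed

text \<open>If the rows were proportional, cancelling the positive factor
  \<open>gen_fun P 0 t s\<close> would concentrate the row of \<open>P'\<close> on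
  \<open>unit_index k\<close> at all times. Its derivative at 0, the branching rates of type
  \<open>k\<close>, would then vanish off \<open>unit_index k\<close>.\<close>

lemma factorizes_by_branching_imp_nondegenerate:
  fixes P :: "real \<Rightarrow> nat ^ 'n::finite \<Rightarrow> nat ^ 'n \<Rightarrow> real"
  assumes P: "transition_function P" and fac: "factorizes_by_branching P"
  shows "branching_nondegenerate P"
proof (rule ccontr)
  obtain Q' P' where Q': "branching_q_matrix Q'" and F': "Feller_minimal Q' P'"
    and fac: "\<And>i t s. 0 \<le> t \<Longrightarrow> s \<in> unit_cube \<Longrightarrow>
      gen_fun P i t s = gen_fun P 0 t s * (\<Prod>k\<in>UNIV. gen_fun P' (unit_index k) t s ^ (i $ k))"
    using fac unfolding factorizes_by_branching_def by blast
  have PQ': "Q_function Q' P'" using F' by (simp add: Feller_minimal_def)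
  note P' = Q_function_transition[OF PQ']
  obtain b where b: "\<And>k. rates_at (unit_index k) (b k)"
    and Qb: "\<And>i j. (\<Sum>k\<in>UNIV. i $ k) > 0 \<Longrightarrow> Q' i j = branching_rate b i j"
    using Q' unfolding branching_q_matrix_def by blast
  have Q'e: "Q' (unit_index k) j = b k j" for k j
    using Qb[of "unit_index k" j] msize_unit[of k] by (simp add: branching_rate_unit[unfolded One_nat_def] msize_def)
  assume "\<not> branching_nondegenerate P"
  then obtain k c where kc: "\<And>t j. 0 \<le> t \<Longrightarrow> P t (unit_index k) j = c t * coeff_diff (P t 0) j (unit_index k)"
    unfolding branching_nondegenerate_def by metis
  have zero: "P' t (unit_index k) j = 0" if t: "0 \<le> t" and j: "j \<noteq> unit_index k" for t j
  proof -
    let ?d = "\<lambda>j. if j = unit_index k then c t else 0"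
    have "P' t (unit_index k) = ?d"
    proof (rule power_series_eqD[OF substochD(2)[OF transition_substoch[OF P' t]] summable_delta(1)])
      fix s :: "real ^ 'n" assume s: "s \<in> corner_box (1 / 2)"
      have s1: "s \<in> corner_box 1" using s corner_box_mono[of "1/2" 1] by auto
      have sc: "s \<in> unit_cube" using s1 corner_box_subset_unit_cube[of 1] by auto
      have "gen_fun P (unit_index k) t s = gen_fun P 0 t s * (c t * s $ k)"
        using gen_fun_proportional[OF P t, of k "c t"] kc[OF t] s by blast
      moreover have "gen_fun P (unit_index k) t s = gen_fun P 0 t s * gen_fun P' (unit_index k) t s"
      proof -
        have "(\<Prod>l\<in>UNIV. gen_fun P' (unit_index l) t s ^ (unit_index k $ l)) = gen_fun P' (unit_index k) t s"
          using mono_pow_axis[of "\<chi> l. gen_fun P' (unit_index l) t s" k 1] by (simp add: mono_pow_def)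
        then show ?thesis using fac[OF t sc, of "unit_index k"] by simp
      qed
      moreover have "0 < gen_fun P 0 t s"
        using gen_fun_ge_diag[OF P t s1, of 0] transition_diag_pos[OF P t, of 0] by simp
      ultimately have "gen_fun P' (unit_index k) t s = c t * s $ k" by simp
      moreover have "(\<Sum>\<^sub>\<infinity>j. ?d j * mono_pow s j) = c t * s $ k"
        by (simp add: if_distrib[of "\<lambda>x. x * _"] cong: if_cong)
      ultimately show "(\<Sum>\<^sub>\<infinity>j. P' t (unit_index k) j * mono_pow s j) = (\<Sum>\<^sub>\<infinity>j. ?d j * mono_pow s j)"
        by (simp add: gen_fun_def)
    qed
    with j show ?thesis by simp
  qed
  have "b k j = 0" if j: "j \<noteq> unit_index k" for j
  proof -
    have "\<forall>\<^sub>F h in at_right 0. (P' h (unit_index k) j - id_kernel (unit_index k) j) / h = 0"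
      using eventually_at_right_less[of 0]
    proof eventually_elim
      case (elim h)
      then show ?case using zero[of h j] j by (auto simp: id_kernel_def)
    qed
    then have "((\<lambda>h. (P' h (unit_index k) j - id_kernel (unit_index k) j) / h) \<longlongrightarrow> 0) (at_right 0)"
      by (rule tendsto_eventually)
    then have "Q' (unit_index k) j = 0"
      by (rule tendsto_unique[OF trivial_limit_at_right_real Q_function_tendsto[OF PQ']])
    then show ?thesis by (simp only: Q'e)
  qed
  then have "infsum (b k) (- {unit_index k}) = 0" by (intro infsum_0) auto
  then show False using b[of k] by (simp add: rates_at_def)
qed

text \<open>Without immigration to other states, 0 can only be killed.\<close>

lemma immigration_nondegenerate_imp_rates_at:
  assumes nd: "immigration_nondegenerate P"
    and a: "weak_rates_at 0 a" and b: "\<And>k. weak_rates_at (unit_index k) (b k)"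
    and eq: "\<And>t. 0 \<le> t \<Longrightarrow> P t = minimal_function (bi_matrix a b) t"
  shows "rates_at 0 a"
proof (rule ccontr)
  assume "\<not> rates_at 0 a"
  then have deg: "a j = 0" if "j \<noteq> 0" for j
    using weak_rates_at_imp_rates_at[OF a that] by blast
  have "bi_matrix a b 0 j = a j" for j
    using coeff_diff_add[of a 0 j] by (simp add: bi_matrix_def branching_rate_0)
  then have "P t 0 j = 0" if "0 \<le> t" "j \<noteq> 0" for t j
    using minimal_function_absorbing[OF q_matrix_bi_matrix[OF a b], of 0 t j] deg that eq by simp
  with nd show False unfolding immigration_nondegenerate_def by blast
qed

theorem theorem5p1:
  fixes P :: "real \<Rightarrow> nat ^ 'n::finite \<Rightarrow> nat ^ 'n \<Rightarrow> real"
  assumes "transition_function P"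
  shows "(minimal_branching_immigration P \<longrightarrow> factorizes_by_branching P) \<and>
         (factorizes_by_branching P \<longrightarrow> factorizes_by_quotients P) \<and>
         (branching_nondegenerate P \<longrightarrow>
            factorizes_by_quotients P \<longrightarrow> factorizes_by_branching P) \<and>
         (immigration_nondegenerate P \<longrightarrow>
            factorizes_by_branching P \<longrightarrow> minimal_branching_immigration P) \<and>
         (factorizes_by_quotients P \<longrightarrow>
            (\<forall>i t. (\<Sum>k\<in>UNIV. i $ k) \<ge> 1 \<longrightarrow> t \<ge> 0 \<longrightarrow>
               P t i 0 = P t 0 0 * (\<Prod>k\<in>UNIV. (P t (unit_index k) 0 / P t 0 0) ^ (i $ k))))"
proof (intro conjI impI allI)
  note P = assms
  show "factorizes_by_branching P" if min: "minimal_branching_immigration P"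
  proof -
    obtain a b Q where a: "rates_at 0 a" and b: "\<And>k. rates_at (unit_index k) (b k)"
      and Q: "\<And>i j. Q i j = branching_rate b i j + coeff_diff a j i" and F: "Feller_minimal Q P"
      using min unfolding minimal_branching_immigration_def branching_immigration_q_matrix_def by blast
    have "Q = bi_matrix a b" by (intro ext) (simp add: Q bi_matrix_def)
    then show ?thesis
      using minimal_imp_factorizes_by_branching[OF rates_at_imp_weak[OF a] b] Feller_minimal_eq[OF F] by blast
  qed
  show "factorizes_by_quotients P" if "factorizes_by_branching P"
    by (rule factorizes_by_branching_imp_quotients[OF that])
  show "factorizes_by_branching P" if nd: "branching_nondegenerate P" and quot: "factorizes_by_quotients P"
  proof -
    interpret quotient_factorization P using P quot by unfold_locales
    obtain a b where ab: "weak_rates_at 0 a" "\<And>k. weak_rates_at (unit_index k) (b k)"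
      "\<And>t. 0 \<le> t \<Longrightarrow> P t = minimal_function (bi_matrix a b) t"
      by (rule quotients_imp_minimal) blast
    show ?thesis
      by (rule minimal_imp_factorizes_by_branching[OF ab(1) nondegenerate_imp_rates_at[OF P nd ab] ab(3)])
  qed
  show "minimal_branching_immigration P" if nd: "immigration_nondegenerate P" and fac: "factorizes_by_branching P"
  proof -
    \<comment> \<open>The rates are obtained from the quotient form; the given branching process
      shows that the branching rates among them are nondegenerate.\<close>
    interpret quotient_factorization P
      using P factorizes_by_branching_imp_quotients[OF fac] by unfold_locales
    obtain a b where ab: "weak_rates_at 0 a" "\<And>k. weak_rates_at (unit_index k) (b k)"
      "\<And>t. 0 \<le> t \<Longrightarrow> P t = minimal_function (bi_matrix a b) t" and PQ: "Q_function (bi_matrix a b) P"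
      by (rule quotients_imp_minimal) blast
    have "rates_at 0 a" by (rule immigration_nondegenerate_imp_rates_at[OF nd ab])
    moreover have "rates_at (unit_index k) (b k)" for k
      by (rule nondegenerate_imp_rates_at[OF P factorizes_by_branching_imp_nondegenerate[OF P fac] ab])
    ultimately have "branching_immigration_q_matrix (bi_matrix a b)"
      unfolding branching_immigration_q_matrix_def
      by (intro exI[of _ a] exI[of _ b]) (simp add: bi_matrix_def)
    then show ?thesis
      unfolding minimal_branching_immigration_def
      using Q_function_eq_minimal_imp_Feller_minimal[OF PQ ab(3)] by blast
  qed
  show "P t i 0 = P t 0 0 * (\<Prod>k\<in>UNIV. (P t (unit_index k) 0 / P t 0 0) ^ (i $ k))"
    if quot: "factorizes_by_quotients P" and t: "t \<ge> 0" for i t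
  proof -
    have "(0 :: real ^ 'n) \<in> unit_cube" by (simp add: unit_cube_def)
    from quot[unfolded factorizes_by_quotients_def, rule_format, OF t this, of i]
    show ?thesis by (simp only: gen_fun_at_0[OF P])
  qed
qed

end
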